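(* For all symmetric $f\in\mathcal{C}^\infty_c(\mathbb{C}^n_{\ne},\mathbb{R})$, $$\mathcal{E}_{\mu_n}(f,f)-2\operatorname{Var}_{\mu_n}(f)=2\|r\|^2_{L^2(\mu_n)}+4\sum_{m=2}^\infty(m-1)\|g_m\|^2_{L^2(\gamma_n)},$$ $$\|A_nf\|^2_{L^2(\mu_n)}-2\mathcal{E}_{\mu_n}(f,f)=\|(A_n+2)\widetilde f\|^2_{L^2(\mu_n)}+4\|r\|^2_{L^2(\mu_n)}+8\sum_{m=2}^\infty(m-1)\|g_m\|^2_{L^2(\gamma_n)},$$ where: (i) $\widetilde f=f-\int_{\mathbb{C}^n}f\,\mathrm{d}\mu_n$; (ii) $g=\sum_{m=0}^\infty g_m$ is the Hermite expansion of $g=U\widetilde f$ in $L^2(\gamma_n)$, $g_m$ being the orthogonal projection of $g$ onto the closed span of the Hermite polynomials $H_{p,q}$ with $p,q\in\mathbb{N}^n$ and $|q|=m$; (iii) $h=U^{-1}g_0=U^{-1}\operatorname{proj}_{\mathcal{H}_n}(U\widetilde f)$, and $\overline h$ is the pointwise complex conjugate of $h$; (iv) $r=\widetilde f-h-\overline h$.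
   Context: $n\ge1$; $\mathbb{C}^n\equiv\mathbb{R}^{2n}$; $\mathbb{N}=\{0,1,2,\dots\}$; $\mathbb{C}^n_{\neq}=\{z\in\mathbb{C}^n:z_j\ne z_k\ \forall j\neq k\}$. A function is symmetric if it is invariant under permutations of the coordinates $z_1,\dots,z_n$. $\gamma_n$ is the probability measure on $\mathbb{C}^n$ with density $(\frac n\pi)^n\mathrm{e}^{-n|z|^2}$, $V_n(z)=\prod_{1\le j<k\le n}(z_k-z_j)$, and $\mathrm{d}\mu_n=\frac1{c_n'}|V_n|^2\mathrm{d}\gamma_n$ with $c_n'$ the normalizing constant making $\mu_n$ a probability measure. $L^2(\mu_n)$, $L^2(\gamma_n)$ consist of complex-valued functions. $U:L^2(\mu_n)\to L^2(\gamma_n)$, $Uf=\frac1{\sqrt{c_n'}}V_nf$, which is unitary. $\mathcal{H}_n$ is the closed subspace of $L^2(\gamma_n)$ of holomorphic functions on $\mathbb{C}^n$ lying in $L^2(\gamma_n)$, and $\operatorname{proj}_{\mathcal{H}_n}$ is the orthogonal projection onto it. $\operatorname{Var}_{\mu_n}(f)=\int f^2\mathrm{d}\mu_n-(\int f\,\mathrm{d}\mu_n)^2$ and $\mathcal{E}_{\mu_n}(f,f)=\frac1n\int_{\mathbb{C}^n}|\nabla f|^2\mathrm{d}\mu_n$ with the Euclidean gradient on $\mathbb{R}^{2n}$. On smooth functions on $\mathbb{C}^n_{\ne}$, $A_n=\frac1n(\Delta-\nabla\Phi_n\cdot\nabla)$ with $\Phi_n(z)=n\sum_{j=1}^n|z_j|^2-2\sum_{j<k}\log|z_j-z_k|$.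 The multivariate complex Hermite polynomials, an orthonormal basis of $L^2(\gamma_n)$ indexed by $p,q\in\mathbb{N}^n$, are $$H_{p,q}(z,\bar z)=\frac{(-1)^{|p|+|q|}}{\sqrt{p!q!}\,n^{(|p|+|q|)/2}}\mathrm{e}^{n|z|^2}\bar\partial_{z_1}^{p_1}\cdots\bar\partial_{z_n}^{p_n}\partial_{z_1}^{q_1}\cdots\partial_{z_n}^{q_n}\mathrm{e}^{-n|z|^2},$$ where $|p|=p_1+\cdots+p_n$, $p!=p_1!\cdots p_n!$ (same for $q$), and for $z_k=x_k+\mathrm{i}y_k$, $\partial_{z_k}=\frac12(\partial_{x_k}-\mathrm{i}\partial_{y_k})$, $\bar\partial_{z_k}=\frac12(\partial_{x_k}+\mathrm{i}\partial_{y_k})$. *)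

theory Defs
  imports "HOL-Analysis.Analysis"
begin

text \<open>
  \<open>\<complex>\<^sup>n\<close> is rendered as \<open>complex ^ 'n\<close> with \<open>'n\<close> a finite linearly ordered index type, so
  \<open>n = CARD('n) \<ge> 1\<close> is arbitrary. The linear order is needed to speak of the pairs \<open>j < k\<close>.
  As a Euclidean space \<open>complex ^ 'n\<close> is \<open>\<real>\<^sup>2\<^sup>n\<close>: its canonical basis consists of the vectors
  \<open>axis k 1\<close> (direction \<open>x\<^sub>k\<close>) and \<open>axis k \<i>\<close> (direction \<open>y\<^sub>k\<close>), and \<open>lborel\<close> is
  Lebesgue measure.
\<close>

subsection \<open>Differential calculus\<close>

definition dir_deriv ::
    "'a::euclidean_space \<Rightarrow> ('a \<Rightarrow> 'b::real_normed_vector) \<Rightarrow> 'a \<Rightarrow> 'b" where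
  "dir_deriv v f x = frechet_derivative f (at x) v"

definition grad :: "('a::euclidean_space \<Rightarrow> real) \<Rightarrow> 'a \<Rightarrow> 'a" where
  "grad f x = (\<Sum>b\<in>Basis. dir_deriv b f x *\<^sub>R b)"

definition laplacian :: "('a::euclidean_space \<Rightarrow> real) \<Rightarrow> 'a \<Rightarrow> real" where
  "laplacian f x = (\<Sum>b\<in>Basis. dir_deriv b (dir_deriv b f) x)"

primrec C_k :: "nat \<Rightarrow> ('a::euclidean_space \<Rightarrow> 'b::real_normed_vector) \<Rightarrow> bool" where
  "C_k 0 f \<longleftrightarrow> continuous_on UNIV f"
| "C_k (Suc k) f \<longleftrightarrow> (\<forall>x. f differentiable (at x)) \<and> (\<forall>v. C_k k (dir_deriv v f))"

definition smooth :: "('a::euclidean_space \<Rightarrow> 'b::real_normed_vector) \<Rightarrow> bool" where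
  "smooth f \<longleftrightarrow> (\<forall>k. C_k k f)"

definition C_neq :: "(complex ^ 'n) set" where
  "C_neq = {z. \<forall>j k. j \<noteq> k \<longrightarrow> z $ j \<noteq> z $ k}"

text \<open>
  The test functions on the open set \<open>C_neq\<close>, extended by \<open>0\<close> to all of \<open>\<complex>\<^sup>n\<close>.
\<close>

definition Cc_inf_neq :: "(complex ^ 'n \<Rightarrow> real) set" where
  "Cc_inf_neq = {f. smooth f \<and> compact (closure {z. f z \<noteq> 0}) \<and> closure {z. f z \<noteq> 0} \<subseteq> C_neq}"

definition symmetric_fun :: "(complex ^ 'n \<Rightarrow> 'b) \<Rightarrow> bool" where
  "symmetric_fun f \<longleftrightarrow> (\<forall>\<pi>. \<pi> permutes UNIV \<longrightarrow> (\<forall>z. f (\<chi> j. z $ \<pi> j) = f z))"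

subsection \<open>Square-integrable functions\<close>

text \<open>
  Elements of \<open>L\<^sup>2\<close> are handled through representatives, which are determined only up to null
  sets. An orthogonal projection is an arbitrarily chosen representative of the projected class.
\<close>

definition L2 :: "'a measure \<Rightarrow> ('a \<Rightarrow> complex) set" where
  "L2 M = {f \<in> borel_measurable M. integrable M (\<lambda>x. (cmod (f x))\<^sup>2)}"

definition L2_norm :: "'a measure \<Rightarrow> ('a \<Rightarrow> 'b::real_normed_vector) \<Rightarrow> real" where
  "L2_norm M f = sqrt (\<integral>x. (norm (f x))\<^sup>2 \<partial>M)"

definition L2_inner :: "'a measure \<Rightarrow> ('a \<Rightarrow> complex) \<Rightarrow> ('a \<Rightarrow> complex) \<Rightarrow> complex" where
  "L2_inner M f g = (\<integral>x. f x * cnj (g x) \<partial>M)"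

definition L2_proj ::
    "'a measure \<Rightarrow> ('a \<Rightarrow> complex) set \<Rightarrow> ('a \<Rightarrow> complex) \<Rightarrow> 'a \<Rightarrow> complex" where
  "L2_proj M S f = (SOME u. u \<in> S \<and> (\<forall>s\<in>S. L2_inner M (\<lambda>x. f x - u x) s = 0))"

definition complex_span :: "('a \<Rightarrow> complex) set \<Rightarrow> ('a \<Rightarrow> complex) set" where
  "complex_span B = {\<lambda>x. \<Sum>b\<in>T. c b * b x | T c. finite T \<and> T \<subseteq> B}"

definition L2_closed_span ::
    "'a measure \<Rightarrow> ('a \<Rightarrow> complex) set \<Rightarrow> ('a \<Rightarrow> complex) set" where
  "L2_closed_span M B =
     {f \<in> L2 M. \<forall>e>0. \<exists>s \<in> complex_span B \<inter> L2 M. L2_norm M (\<lambda>x. f x - s x) < e}"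

subsection \<open>The measures and the unitary map\<close>

definition gamma_n :: "(complex ^ 'n) measure" where
  "gamma_n = density lborel
     (\<lambda>z. ennreal ((real CARD('n) / pi) ^ CARD('n) * exp (- real CARD('n) * (norm z)\<^sup>2)))"

definition vandermonde :: "complex ^ 'n::{finite,linorder} \<Rightarrow> complex" where
  "vandermonde z = (\<Prod>(j,k)\<in>{(j,k). j < k}. z $ k - z $ j)"

definition norm_const :: "'n::{finite,linorder} itself \<Rightarrow> real" where
  "norm_const _ = (\<integral>z. (cmod (vandermonde (z :: complex ^ 'n::{finite,linorder})))\<^sup>2 \<partial>gamma_n)"

definition mu_n :: "(complex ^ 'n::{finite,linorder}) measure" where
  "mu_n = density gamma_n (\<lambda>z. ennreal ((cmod (vandermonde z))\<^sup>2 / norm_const TYPE('n)))"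

definition U_map ::
    "(complex ^ 'n::{finite,linorder} \<Rightarrow> complex) \<Rightarrow> complex ^ 'n::{finite,linorder} \<Rightarrow> complex" where
  "U_map f z = complex_of_real (1 / sqrt (norm_const TYPE('n))) * vandermonde z * f z"

definition U_inv ::
    "(complex ^ 'n::{finite,linorder} \<Rightarrow> complex) \<Rightarrow> complex ^ 'n::{finite,linorder} \<Rightarrow> complex" where
  "U_inv g = (SOME h. h \<in> L2 mu_n \<and> (AE z in gamma_n. U_map h z = g z))"

subsection \<open>Variance, Dirichlet form and generator\<close>

definition Var_mu :: "(complex ^ 'n::{finite,linorder} \<Rightarrow> real) \<Rightarrow> real" where
  "Var_mu f = (\<integral>z. (f z)\<^sup>2 \<partial>mu_n) - (\<integral>z. f z \<partial>mu_n)\<^sup>2"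

definition dirichlet_mu :: "(complex ^ 'n::{finite,linorder} \<Rightarrow> real) \<Rightarrow> real" where
  "dirichlet_mu f = 1 / real CARD('n) * (\<integral>z. (norm (grad f z))\<^sup>2 \<partial>mu_n)"

definition Phi_n :: "complex ^ 'n::{finite,linorder} \<Rightarrow> real" where
  "Phi_n z = real CARD('n) * (\<Sum>j\<in>UNIV. (cmod (z $ j))\<^sup>2)
     - 2 * (\<Sum>(j,k)\<in>{(j,k). j < k}. ln (cmod (z $ j - z $ k)))"

text \<open>
  Only the values on \<open>C_neq\<close> are meaningful; the complement is a null set, and for a function
  that is locally constant near the complement the value there is \<open>0\<close>.
\<close>

definition A_n :: "(complex ^ 'n::{finite,linorder} \<Rightarrow> real) \<Rightarrow> complex ^ 'n::{finite,linorder} \<Rightarrow> real" where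
  "A_n f z = 1 / real CARD('n) * (laplacian f z - grad Phi_n z \<bullet> grad f z)"

subsection \<open>Holomorphic functions and Hermite polynomials\<close>

definition holomorphic_Cn :: "(complex ^ 'n \<Rightarrow> complex) \<Rightarrow> bool" where
  "holomorphic_Cn F \<longleftrightarrow>
     (\<forall>z. \<exists>D. (F has_derivative D) (at z) \<and> (\<forall>c v. D (c *s v) = c * D v))"

definition H_n :: "(complex ^ 'n \<Rightarrow> complex) set" where
  "H_n = {F \<in> L2 gamma_n. holomorphic_Cn F}"

definition d_z :: "'n \<Rightarrow> (complex ^ 'n \<Rightarrow> complex) \<Rightarrow> complex ^ 'n \<Rightarrow> complex" where
  "d_z k F z = 1 / 2 * (dir_deriv (axis k 1) F z - \<i> * dir_deriv (axis k \<i>) F z)"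

definition d_zbar :: "'n \<Rightarrow> (complex ^ 'n \<Rightarrow> complex) \<Rightarrow> complex ^ 'n \<Rightarrow> complex" where
  "d_zbar k F z = 1 / 2 * (dir_deriv (axis k 1) F z + \<i> * dir_deriv (axis k \<i>) F z)"

text \<open>
  \<open>multi_deriv D p\<close> is the composition of the \<open>D k\<close> iterated \<open>p $ k\<close> times, the smallest index
  being outermost.
\<close>

definition multi_deriv :: "('n::{finite,linorder} \<Rightarrow> 'f \<Rightarrow> 'f) \<Rightarrow> nat ^ 'n::{finite,linorder} \<Rightarrow> 'f \<Rightarrow> 'f" where
  "multi_deriv D p = foldr (\<lambda>k. D k ^^ (p $ k)) (sorted_list_of_set UNIV)"

definition mi_abs :: "nat ^ 'n \<Rightarrow> nat" where
  "mi_abs p = (\<Sum>k\<in>UNIV. p $ k)"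

definition mi_fact :: "nat ^ 'n \<Rightarrow> nat" where
  "mi_fact p = (\<Prod>k\<in>UNIV. fact (p $ k))"

definition hermite ::
    "nat ^ 'n::{finite,linorder} \<Rightarrow> nat ^ 'n::{finite,linorder} \<Rightarrow> complex ^ 'n::{finite,linorder} \<Rightarrow> complex" where
  "hermite p q z =
     complex_of_real
       ((-1) ^ (mi_abs p + mi_abs q)
          / (sqrt (real (mi_fact p * mi_fact q))
               * real CARD('n) powr (real (mi_abs p + mi_abs q) / 2))
        * exp (real CARD('n) * (norm z)\<^sup>2))
     * multi_deriv d_zbar p
         (multi_deriv d_z q (\<lambda>w. complex_of_real (exp (- real CARD('n) * (norm w)\<^sup>2)))) z"

definition hermite_space :: "nat \<Rightarrow> (complex ^ 'n::{finite,linorder} \<Rightarrow> complex) set" where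
  "hermite_space m = L2_closed_span gamma_n {hermite p q | p q. mi_abs q = m}"

end

theory Submission
  imports Defs "HOL-Probability.Distributions" "HOL-Complex_Analysis.Cauchy_Integral_Formula"
begin

text \<open>Write \<open>n\<close> for \<open>CARD('n)\<close>, \<open>V\<close> for the Vandermonde polynomial and \<open>g = U f~\<close>. Because \<open>V\<close> is
holomorphic, \<open>dbar_k (V f) = V dbar_k f\<close>, and \<open>|grad f|^2 = 4 (\<Sum>k. |dbar_k f|^2)\<close> for real \<open>f\<close>. So the
Dirichlet form is \<open>4 / n\<close> times the sum of the squared norms of the functions \<open>dbar_k g\<close> in the Gaussian
space. There \<open>dbar_k\<close> is the adjoint of the ladder operator that raises \<open>q_k\<close> by one
(\<open>wirt_adjoint\<close>, \<open>ladder_Suc\<close>), hence the coefficients of \<open>dbar_k g\<close> are shifted and rescaled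
coefficients of \<open>g\<close>. Parseval's identity, applied to \<open>g\<close> and to each \<open>dbar_k g\<close>, gives
\<open>Var f = (\<Sum>m. \<parallel>g_m\<parallel>^2)\<close> and \<open>E(f, f) = 4 (\<Sum>m. m \<parallel>g_m\<parallel>^2)\<close> (\<open>has_sum_dirichlet\<close>).

The remainder satisfies \<open>\<parallel>r\<parallel>^2 = Var f - 2 \<parallel>g_0\<parallel>^2\<close> (\<open>remainder_norm\<close>). As \<open>f~\<close> is real, its inner products
with \<open>h\<close> and with the conjugate of \<open>h\<close> both equal \<open>\<parallel>g_0\<parallel>^2\<close>, and what is left to see is that \<open>h^2\<close> has
mean zero. This is where the symmetry of \<open>f\<close> enters. It makes \<open>g\<close> antisymmetric, so that a monomial can
occur in \<open>g_0\<close> only if its exponents are pairwise distinct. Its degree is then at least that of \<open>V\<close>, and in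
the case of equality the exponents are those of the monomials of \<open>V\<close> itself; since \<open>f~\<close> has mean zero, \<open>g\<close>
is orthogonal to \<open>V\<close> and this case is excluded too (\<open>antisymmetric_coef_eq_0\<close>). Thus
\<open>g_0\<close> is a limit of combinations of monomials of degree greater than that of \<open>V\<close>, all terms of \<open>h = g_0 / V\<close> have positive
weight under the rotations \<open>z \<mapsto> \<omega> z\<close>, and the rotation invariant measure integrates products of
such terms to zero (\<open>integral_square_eq_0\<close>). The first identity is now arithmetic:
\<open>E - 4 Var + 4 \<parallel>g_0\<parallel>^2 = 4 (\<Sum>m\<ge>2. (m - 1) \<parallel>g_m\<parallel>^2)\<close>, the term for \<open>m = 1\<close> being zero and the term
for \<open>m = 0\<close> being cancelled by \<open>4 \<parallel>g_0\<parallel>^2\<close>. The second follows by expanding \<open>\<parallel>(A + 2) f~\<parallel>^2\<close> and the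
integration by parts \<open>\<langle>A f, f~\<rangle> = - E(f, f)\<close> (\<open>generator_by_parts\<close>).

Two facts of analysis support this. The polynomials in \<open>z\<close> and its conjugate are dense
enough for the functions at hand: a square-integrable \<open>u\<close> orthogonal to all polynomials is orthogonal to
all polynomials times narrow Gaussians, hence to all continuous functions of compact support
(\<open>orthogonal_zpoly_imp_orthogonal_Cc\<close>). And the projection to the holomorphic subspace is integration
against the kernel \<open>exp (n z \<cdot> w)\<close>, conjugated in \<open>w\<close>, which reproduces every square-integrable
holomorphic function by the mean value property and kills every Hermite polynomial with \<open>q \<noteq> 0\<close>; so it agrees with the projection to the
component of degree \<open>0\<close> (\<open>L2_proj_H_n_AE\<close>).\<close>

section \<open>Square-integrable functions\<close>

lemma borel_measurable_cnj [measurable (raw)]: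
  "f \<in> borel_measurable M \<Longrightarrow> (\<lambda>x. cnj (f x)) \<in> borel_measurable M"
  by (rule measurable_compose[where N = borel])
     (auto intro: borel_measurable_continuous_onI continuous_intros)

lemma L2_measurable: "u \<in> L2 M \<Longrightarrow> u \<in> borel_measurable M"
  by (simp add: L2_def)

lemma L2_integrable: "u \<in> L2 M \<Longrightarrow> integrable M (\<lambda>x. (cmod (u x))\<^sup>2)"
  by (simp add: L2_def)

lemma L2_bound:
  assumes "u \<in> borel_measurable M" "integrable M b" "AE x in M. (cmod (u x))\<^sup>2 \<le> b x"
  shows "u \<in> L2 M"
proof -
  have "integrable M (\<lambda>x. (cmod (u x))\<^sup>2)"
    by (rule Bochner_Integration.integrable_bound[OF assms(2)])
       (use assms in \<open>auto elim!: eventually_mono\<close>)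
  then show ?thesis using assms by (simp add: L2_def)
qed

lemma cmod_add_sq_le: "(cmod (a + b))\<^sup>2 \<le> 2 * (cmod a)\<^sup>2 + 2 * (cmod b)\<^sup>2"
proof -
  have "(cmod (a + b))\<^sup>2 \<le> (cmod a + cmod b)\<^sup>2"
    by (intro power_mono norm_triangle_ineq) auto
  also have "\<dots> \<le> 2 * (cmod a)\<^sup>2 + 2 * (cmod b)\<^sup>2"
    using sum_squares_bound[of "cmod a" "cmod b"] by (simp add: power2_sum)
  finally show ?thesis .
qed

lemma L2_add:
  assumes "u \<in> L2 M" "v \<in> L2 M"
  shows "(\<lambda>x. u x + v x) \<in> L2 M"
  by (rule L2_bound[where b = "\<lambda>x. 2 * (cmod (u x))\<^sup>2 + 2 * (cmod (v x))\<^sup>2"])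
     (use assms in \<open>auto simp: L2_def intro: cmod_add_sq_le\<close>)

lemma L2_cmult: "u \<in> L2 M \<Longrightarrow> (\<lambda>x. c * u x) \<in> L2 M"
  by (auto simp: L2_def norm_mult power_mult_distrib)

lemma L2_minus:
  assumes "u \<in> L2 M" "v \<in> L2 M"
  shows "(\<lambda>x. u x - v x) \<in> L2 M"
  using L2_add[OF assms(1) L2_cmult[OF assms(2), of "-1"]] by simp

lemma L2_cnj: "u \<in> L2 M \<Longrightarrow> (\<lambda>x. cnj (u x)) \<in> L2 M"
  by (auto simp: L2_def)

lemma L2_zero: "(\<lambda>x. 0) \<in> L2 M"
  by (simp add: L2_def)

lemma L2_sum: "(\<And>i. i \<in> A \<Longrightarrow> u i \<in> L2 M) \<Longrightarrow> (\<lambda>x. \<Sum>i\<in>A. u i x) \<in> L2 M"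
  by (induction A rule: infinite_finite_induct) (auto intro: L2_zero L2_add)

lemma L2_mult_integrable:
  assumes "u \<in> L2 M" "v \<in> L2 M"
  shows "integrable M (\<lambda>x. u x * v x)"
proof (rule Bochner_Integration.integrable_bound[where f = "\<lambda>x. (cmod (u x))\<^sup>2 + (cmod (v x))\<^sup>2"])
  show "AE x in M. cmod (u x * v x) \<le> norm ((cmod (u x))\<^sup>2 + (cmod (v x))\<^sup>2)"
  proof (rule AE_I2)
    fix x
    have "2 * (cmod (u x) * cmod (v x)) \<le> (cmod (u x))\<^sup>2 + (cmod (v x))\<^sup>2"
      using sum_squares_bound[of "cmod (u x)" "cmod (v x)"] by simp
    moreover have "0 \<le> cmod (u x) * cmod (v x)" by simp
    ultimately have "cmod (u x) * cmod (v x) \<le> (cmod (u x))\<^sup>2 + (cmod (v x))\<^sup>2"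
      by linarith
    then show "cmod (u x * v x) \<le> norm ((cmod (u x))\<^sup>2 + (cmod (v x))\<^sup>2)"
      by (simp add: norm_mult)
  qed
qed (use assms in \<open>auto simp: L2_def\<close>)

lemma L2_inner_integrable:
  assumes "u \<in> L2 M" "v \<in> L2 M"
  shows "integrable M (\<lambda>x. u x * cnj (v x))"
  by (rule L2_mult_integrable[OF assms(1) L2_cnj[OF assms(2)]])

lemma L2_inner_add_left:
  assumes "u \<in> L2 M" "v \<in> L2 M" "w \<in> L2 M"
  shows "L2_inner M (\<lambda>x. u x + v x) w = L2_inner M u w + L2_inner M v w"
  unfolding L2_inner_def using assms
  by (simp add: distrib_right L2_inner_integrable)

lemma L2_inner_diff_left:
  assumes "u \<in> L2 M" "v \<in> L2 M" "w \<in> L2 M"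
  shows "L2_inner M (\<lambda>x. u x - v x) w = L2_inner M u w - L2_inner M v w"
  unfolding L2_inner_def using assms
  by (simp add: left_diff_distrib L2_inner_integrable)

lemma L2_inner_cmult_left: "L2_inner M (\<lambda>x. c * u x) w = c * L2_inner M u w"
  unfolding L2_inner_def by (simp add: mult.assoc)

lemma L2_inner_commute: "L2_inner M u v = cnj (L2_inner M v u)"
  unfolding L2_inner_def Bochner_Integration.integral_cnj[symmetric]
  by (simp add: mult.commute del: Bochner_Integration.integral_cnj)

lemma L2_inner_cmult_right: "L2_inner M u (\<lambda>x. c * w x) = cnj c * L2_inner M u w"
  by (subst (1 2) L2_inner_commute) (simp add: L2_inner_cmult_left)

lemma L2_inner_add_right:
  assumes "u \<in> L2 M" "v \<in> L2 M" "w \<in> L2 M"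
  shows "L2_inner M w (\<lambda>x. u x + v x) = L2_inner M w u + L2_inner M w v"
  by (subst (1 2 3) L2_inner_commute) (simp add: L2_inner_add_left assms)

lemma L2_inner_sum_left:
  assumes "\<And>i. i \<in> A \<Longrightarrow> u i \<in> L2 M" "w \<in> L2 M"
  shows "L2_inner M (\<lambda>x. \<Sum>i\<in>A. u i x) w = (\<Sum>i\<in>A. L2_inner M (u i) w)"
  using assms
proof (induction A rule: infinite_finite_induct)
  case (insert i A)
  then show ?case by (simp add: L2_inner_add_left L2_sum)
qed (auto simp: L2_inner_def)

lemma L2_norm_nonneg: "0 \<le> L2_norm M u"
  unfolding L2_norm_def by (intro real_sqrt_ge_zero integral_nonneg_AE) auto

lemma L2_norm_sq: "(L2_norm M u)\<^sup>2 = (\<integral>x. (norm (u x))\<^sup>2 \<partial>M)"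
  unfolding L2_norm_def by (intro real_sqrt_pow2 integral_nonneg_AE) auto

lemma L2_inner_self: "L2_inner M u u = complex_of_real ((L2_norm M u)\<^sup>2)"
proof -
  have "L2_inner M u u = (\<integral>x. complex_of_real ((cmod (u x))\<^sup>2) \<partial>M)"
    unfolding L2_inner_def by (simp add: complex_norm_square del: of_real_power)
  then show ?thesis by (simp add: L2_norm_sq del: of_real_power)
qed

lemma L2_inner_cong_AE:
  assumes "AE x in M. u x = u' x" "AE x in M. v x = v' x"
    "u \<in> borel_measurable M" "u' \<in> borel_measurable M"
    "v \<in> borel_measurable M" "v' \<in> borel_measurable M"
  shows "L2_inner M u v = L2_inner M u' v'"
  unfolding L2_inner_def by (rule integral_cong_AE) (use assms in auto)

lemma L2_norm_cong_AE:
  assumes "AE x in M. u x = (u' x :: complex)" "u \<in> borel_measurable M" "u' \<in> borel_measurable M"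
  shows "L2_norm M u = L2_norm M u'"
  unfolding L2_norm_def by (rule arg_cong[of _ _ sqrt], rule integral_cong_AE) (use assms in auto)

lemma L2_norm_eq_0_AE:
  assumes "u \<in> L2 M" "L2_norm M u = 0"
  shows "AE x in M. u x = 0"
proof -
  have "(\<integral>x. (cmod (u x))\<^sup>2 \<partial>M) = 0" using assms(2) L2_norm_sq[of M u] by simp
  then have "AE x in M. (cmod (u x))\<^sup>2 = 0"
    by (subst (asm) integral_nonneg_eq_0_iff_AE) (use assms in \<open>auto simp: L2_integrable\<close>)
  then show ?thesis by simp
qed

lemma L2_norm_sq_add:
  assumes "u \<in> L2 M" "v \<in> L2 M"
  shows "(L2_norm M (\<lambda>x. u x + v x))\<^sup>2
    = (L2_norm M u)\<^sup>2 + (L2_norm M v)\<^sup>2 + 2 * Re (L2_inner M u v)"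
proof -
  have "complex_of_real ((L2_norm M (\<lambda>x. u x + v x))\<^sup>2)
     = L2_inner M u u + L2_inner M v v + (L2_inner M u v + cnj (L2_inner M u v))"
    using assms by (simp add: L2_inner_self[symmetric] L2_inner_add_left L2_inner_add_right L2_add
        L2_inner_commute[of M v u] del: of_real_power)
  also have "\<dots> = complex_of_real ((L2_norm M u)\<^sup>2 + (L2_norm M v)\<^sup>2 + 2 * Re (L2_inner M u v))"
    by (simp add: L2_inner_self complex_add_cnj)
  finally show ?thesis using of_real_eq_iff by blast
qed

lemma L2_norm_cmult: "L2_norm M (\<lambda>x. c * u x) = cmod c * L2_norm M u"
  by (simp add: L2_norm_def norm_mult power_mult_distrib real_sqrt_mult)

lemma L2_norm_sq_diff:
  assumes "u \<in> L2 M" "v \<in> L2 M"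
  shows "(L2_norm M (\<lambda>x. u x - v x))\<^sup>2
    = (L2_norm M u)\<^sup>2 + (L2_norm M v)\<^sup>2 - 2 * Re (L2_inner M u v)"
  using L2_norm_sq_add[OF assms(1) L2_cmult[OF assms(2), of "-1"]]
    L2_norm_cmult[of M "-1" v] L2_inner_cmult_right[of M u "-1" v] by simp

text \<open>The classical argument: the squared norm of \<open>u - c v\<close> is non-negative for the minimising \<open>c\<close>.\<close>

lemma L2_Cauchy_Schwarz:
  assumes "u \<in> L2 M" "v \<in> L2 M"
  shows "cmod (L2_inner M u v) \<le> L2_norm M u * L2_norm M v"
proof (cases "L2_norm M v = 0")
  case True
  then have "AE x in M. v x = 0" using L2_norm_eq_0_AE assms by blast
  then have "L2_inner M u v = L2_inner M u (\<lambda>x. 0)"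
    by (intro L2_inner_cong_AE) (use assms in \<open>auto simp: L2_measurable\<close>)
  then show ?thesis using True by (simp add: L2_inner_def)
next
  case False
  let ?I = "L2_inner M u v" and ?B = "(L2_norm M v)\<^sup>2"
  define c where "c = ?I / of_real ?B"
  have B: "?B > 0" using False by simp
  have "0 \<le> (L2_norm M (\<lambda>x. u x - c * v x))\<^sup>2" by simp
  also have "\<dots> = (L2_norm M u)\<^sup>2 + (cmod c)\<^sup>2 * ?B - 2 * Re (cnj c * ?I)"
    using assms by (simp add: L2_norm_sq_diff L2_cmult L2_norm_cmult L2_inner_cmult_right
        power_mult_distrib)
  also have "cnj c * ?I = of_real ((cmod ?I)\<^sup>2 / ?B)"
    by (simp add: c_def complex_norm_square mult.commute del: of_real_power)
  also have "(cmod c)\<^sup>2 * ?B = (cmod ?I)\<^sup>2 / ?B"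
    using B by (simp add: c_def norm_divide power_divide norm_power power2_eq_square norm_mult)
  finally have "(cmod ?I)\<^sup>2 / ?B \<le> (L2_norm M u)\<^sup>2" by (simp add: algebra_simps)
  then have "(cmod ?I)\<^sup>2 \<le> (L2_norm M u * L2_norm M v)\<^sup>2"
    using B by (simp add: divide_le_eq power_mult_distrib)
  then show ?thesis
    by (rule power2_le_imp_le) (simp add: L2_norm_nonneg)
qed

lemma L2_norm_triangle:
  assumes "u \<in> L2 M" "v \<in> L2 M"
  shows "L2_norm M (\<lambda>x. u x + v x) \<le> L2_norm M u + L2_norm M v"
proof (rule power2_le_imp_le)
  have "Re (L2_inner M u v) \<le> L2_norm M u * L2_norm M v"
    using L2_Cauchy_Schwarz[OF assms] complex_Re_le_cmod order_trans by blast
  then show "(L2_norm M (\<lambda>x. u x + v x))\<^sup>2 \<le> (L2_norm M u + L2_norm M v)\<^sup>2"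
    by (simp add: L2_norm_sq_add[OF assms] power2_sum)
qed (simp add: L2_norm_nonneg)

lemma L2_norm_minus_commute: "L2_norm M (\<lambda>x. u x - v x) = L2_norm M (\<lambda>x. (v x - u x :: complex))"
  by (simp add: L2_norm_def norm_minus_commute)

text \<open>Only the bound passes to the limit, by Fatou's lemma; the norms themselves need not converge.\<close>

lemma L2_AE_limit:
  assumes s: "\<And>n. s n \<in> L2 M" and u [measurable]: "u \<in> borel_measurable M"
    and lim: "AE x in M. (\<lambda>n. s n x) \<longlonglongrightarrow> u x"
    and B: "\<And>n. L2_norm M (s n) \<le> B"
  shows "u \<in> L2 M" "L2_norm M u \<le> B"
proof -
  have [measurable]: "s n \<in> borel_measurable M" for n using s by (auto simp: L2_def)
  have B0: "0 \<le> B" using B[of 0] L2_norm_nonneg[of M "s 0"] by linarith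
  have "(\<integral>\<^sup>+x. ennreal ((cmod (u x))\<^sup>2) \<partial>M) = (\<integral>\<^sup>+x. liminf (\<lambda>n. ennreal ((cmod (s n x))\<^sup>2)) \<partial>M)"
  proof (rule nn_integral_cong_AE)
    show "AE x in M. ennreal ((cmod (u x))\<^sup>2) = liminf (\<lambda>n. ennreal ((cmod (s n x))\<^sup>2))"
      using lim
    proof eventually_elim
      case (elim x)
      have "(\<lambda>n. ennreal ((cmod (s n x))\<^sup>2)) \<longlonglongrightarrow> ennreal ((cmod (u x))\<^sup>2)"
        by (intro tendsto_intros elim)
      then show ?case by (intro lim_imp_Liminf[symmetric]) simp_all
    qed
  qed
  also have "\<dots> \<le> liminf (\<lambda>n. \<integral>\<^sup>+x. ennreal ((cmod (s n x))\<^sup>2) \<partial>M)"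
    by (rule nn_integral_liminf) simp
  also have "\<dots> \<le> liminf (\<lambda>n::nat. ennreal (B\<^sup>2))"
  proof (intro Liminf_mono always_eventually allI)
    fix n
    have "(\<integral>\<^sup>+x. ennreal ((cmod (s n x))\<^sup>2) \<partial>M) = ennreal ((L2_norm M (s n))\<^sup>2)"
      unfolding L2_norm_sq by (rule nn_integral_eq_integral) (use s in \<open>auto simp: L2_integrable\<close>)
    also have "\<dots> \<le> ennreal (B\<^sup>2)"
      by (intro ennreal_leI power_mono B L2_norm_nonneg)
    finally show "(\<integral>\<^sup>+x. ennreal ((cmod (s n x))\<^sup>2) \<partial>M) \<le> ennreal (B\<^sup>2)" .
  qed
  also have "\<dots> = ennreal (B\<^sup>2)" by (rule Liminf_const) simp
  finally have fin: "(\<integral>\<^sup>+x. ennreal ((cmod (u x))\<^sup>2) \<partial>M) \<le> ennreal (B\<^sup>2)" .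
  show "u \<in> L2 M"
    unfolding L2_def mem_Collect_eq integrable_iff_bounded
    using fin by (auto intro: le_less_trans)
  then have "ennreal ((L2_norm M u)\<^sup>2) \<le> ennreal (B\<^sup>2)"
    using fin unfolding L2_norm_sq by (subst nn_integral_eq_integral[symmetric]) (auto simp: L2_integrable)
  then have "(L2_norm M u)\<^sup>2 \<le> B\<^sup>2" by simp
  then show "L2_norm M u \<le> B" using B0 by (rule power2_le_imp_le)
qed

lemma (in finite_measure) L2_const: "(\<lambda>x. c) \<in> L2 M"
  by (simp add: L2_def)

lemma (in finite_measure) L2_imp_integrable:
  assumes "u \<in> L2 M"
  shows "integrable M u"
  using L2_mult_integrable[OF assms L2_const[of 1]] by simp

text \<open>On a finite measure an \<open>L\<^sup>2\<close> Cauchy sequence is an \<open>L\<^sup>1\<close> Cauchy sequence, so that a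
  subsequence converges almost everywhere; Fatou does the rest.\<close>

lemma (in finite_measure) L2_complete:
  assumes s: "\<And>n. s n \<in> L2 M"
    and cauchy: "\<And>e. e > 0 \<Longrightarrow> \<exists>N. \<forall>i\<ge>N. \<forall>j\<ge>N. L2_norm M (\<lambda>x. s i x - s j x) < e"
  obtains u where "u \<in> L2 M" "(\<lambda>n. L2_norm M (\<lambda>x. u x - s n x)) \<longlonglongrightarrow> 0"
proof -
  define K where "K = L2_norm M (\<lambda>x. 1 :: complex)"
  have K0: "K \<ge> 0" unfolding K_def by (rule L2_norm_nonneg)
  have [measurable]: "s n \<in> borel_measurable M" for n using s by (auto simp: L2_def)
  have L1: "(\<integral>x. norm (s i x - s j x) \<partial>M) \<le> L2_norm M (\<lambda>x. s i x - s j x) * K" for i j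
  proof -
    define w where "w = (\<lambda>x. complex_of_real (cmod (s i x - s j x)))"
    have w: "w \<in> L2 M" using L2_minus[OF s[of i] s[of j]] by (auto simp: w_def L2_def)
    have "L2_inner M w (\<lambda>x. 1) = of_real (\<integral>x. norm (s i x - s j x) \<partial>M)"
      by (simp add: L2_inner_def w_def)
    moreover have "0 \<le> (\<integral>x. norm (s i x - s j x) \<partial>M)" by simp
    ultimately have "(\<integral>x. norm (s i x - s j x) \<partial>M) \<le> L2_norm M w * K"
      using L2_Cauchy_Schwarz[OF w L2_const[of 1]] by (simp add: K_def)
    also have "L2_norm M w = L2_norm M (\<lambda>x. s i x - s j x)" by (simp add: w_def L2_norm_def)
    finally show ?thesis .
  qed
  have "\<exists>N. \<forall>i\<ge>N. \<forall>j\<ge>N. (\<integral>x. norm (s i x - s j x) \<partial>M) < e" if "e > 0" for e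
  proof -
    have "e / (K + 1) > 0" using K0 that by simp
    then obtain N where N: "\<forall>i\<ge>N. \<forall>j\<ge>N. L2_norm M (\<lambda>x. s i x - s j x) < e / (K + 1)"
      using cauchy by blast
    have "(\<integral>x. norm (s i x - s j x) \<partial>M) < e" if "i \<ge> N" "j \<ge> N" for i j
    proof -
      have "(\<integral>x. norm (s i x - s j x) \<partial>M) \<le> L2_norm M (\<lambda>x. s i x - s j x) * (K + 1)"
        using L1[of i j] L2_norm_nonneg[of M "\<lambda>x. s i x - s j x"] by (simp add: algebra_simps)
      also have "\<dots> < e" using N that K0 by (simp add: less_divide_eq)
      finally show ?thesis .
    qed
    then show ?thesis by blast
  qed
  then obtain r where r: "strict_mono r" "AE x in M. Cauchy (\<lambda>i. s (r i) x)"
    by (rule cauchy_L1_AE_cauchy_subseq[OF L2_imp_integrable[OF s]])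
  define u where "u x = lim (\<lambda>i. s (r i) x)" for x
  have [measurable]: "u \<in> borel_measurable M" unfolding u_def by measurable
  have lim: "AE x in M. (\<lambda>i. s (r i) x) \<longlonglongrightarrow> u x"
    using r(2) by eventually_elim (simp add: u_def Cauchy_convergent_iff convergent_LIMSEQ_iff)
  have close: "\<exists>N. \<forall>n\<ge>N. (\<lambda>x. u x - s n x) \<in> L2 M \<and> L2_norm M (\<lambda>x. u x - s n x) \<le> e"
    if pos: "e > 0" for e
  proof -
    obtain N where N: "\<forall>i\<ge>N. \<forall>j\<ge>N. L2_norm M (\<lambda>x. s i x - s j x) < e"
      using cauchy[OF pos] by auto
    have "(\<lambda>x. u x - s n x) \<in> L2 M \<and> L2_norm M (\<lambda>x. u x - s n x) \<le> e" if n: "n \<ge> N" for n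
    proof -
      have a: "(\<lambda>x. s (r (i + N)) x - s n x) \<in> L2 M" for i by (intro L2_minus s)
      have b: "AE x in M. (\<lambda>i. s (r (i + N)) x - s n x) \<longlonglongrightarrow> u x - s n x"
        using lim by eventually_elim (intro tendsto_intros LIMSEQ_ignore_initial_segment)
      have "L2_norm M (\<lambda>x. s (r (i + N)) x - s n x) \<le> e" for i
      proof -
        have "r (i + N) \<ge> N" using seq_suble[OF r(1), of "i + N"] by linarith
        then show ?thesis using N n by (intro less_imp_le) blast
      qed
      from L2_AE_limit[OF a _ b this] show ?thesis by auto
    qed
    then show ?thesis by blast
  qed
  obtain N where "\<forall>n\<ge>N. (\<lambda>x. u x - s n x) \<in> L2 M" using close[of 1] by auto
  then have "(\<lambda>x. u x - s N x) \<in> L2 M" by auto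
  from L2_add[OF this s[of N]] have "u \<in> L2 M" by simp
  moreover have "(\<lambda>n. L2_norm M (\<lambda>x. u x - s n x)) \<longlonglongrightarrow> 0"
  proof (rule LIMSEQ_I)
    fix e :: real assume "e > 0"
    then obtain N where N: "\<And>n. n \<ge> N \<Longrightarrow> L2_norm M (\<lambda>x. u x - s n x) \<le> e / 2"
      using close[of "e / 2"] by auto
    have "norm (L2_norm M (\<lambda>x. u x - s n x) - 0) < e" if n: "n \<ge> N" for n
      using N[OF n] \<open>e > 0\<close> L2_norm_nonneg[of M "\<lambda>x. u x - s n x"] by simp
    then show "\<exists>N. \<forall>n\<ge>N. norm (L2_norm M (\<lambda>x. u x - s n x) - 0) < e" by blast
  qed
  ultimately show ?thesis by (rule that)
qed

section \<open>Orthonormal families\<close>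

text \<open>The index type is countable so that partial sums can be taken along an enumeration.\<close>

locale orthonormal_family = finite_measure M for M :: "'a measure" +
  fixes e :: "'i::countable \<Rightarrow> 'a \<Rightarrow> complex"
  assumes e_L2: "e i \<in> L2 M"
    and e_inner: "L2_inner M (e i) (e j) = (if i = j then 1 else 0)"
begin

definition coef :: "('a \<Rightarrow> complex) \<Rightarrow> 'i \<Rightarrow> complex" where
  "coef u i = L2_inner M u (e i)"

definition cspan :: "'i set \<Rightarrow> ('a \<Rightarrow> complex) set" where
  "cspan J = L2_closed_span M (e ` J)"

lemma inj_e: "inj e"
proof (rule injI)
  fix i j assume "e i = e j"
  then have "L2_inner M (e i) (e j) = L2_inner M (e i) (e i)" by simp
  then show "i = j" by (simp add: e_inner split: if_splits)
qed

lemma comb_L2: "(\<lambda>x. \<Sum>i\<in>T. c i * e i x) \<in> L2 M"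
  by (intro L2_sum L2_cmult e_L2)

lemma complex_span_e:
  "s \<in> complex_span (e ` J) \<longleftrightarrow> (\<exists>T c. finite T \<and> T \<subseteq> J \<and> s = (\<lambda>x. \<Sum>i\<in>T. c i * e i x))"
proof
  assume "s \<in> complex_span (e ` J)"
  then obtain B c where B: "finite B" "B \<subseteq> e ` J" "s = (\<lambda>x. \<Sum>b\<in>B. c b * b x)"
    unfolding complex_span_def by blast
  from B(1,2) obtain T where T: "T \<subseteq> J" "finite T" "B = e ` T" by (meson finite_subset_image)
  then have "s = (\<lambda>x. \<Sum>i\<in>T. c (e i) * e i x)"
    using B(3) by (simp add: sum.reindex inj_on_subset[OF inj_e])
  then show "\<exists>T c. finite T \<and> T \<subseteq> J \<and> s = (\<lambda>x. \<Sum>i\<in>T. c i * e i x)"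
    using T by (intro exI[of _ T] exI[of _ "\<lambda>i. c (e i)"]) simp
next
  assume "\<exists>T c. finite T \<and> T \<subseteq> J \<and> s = (\<lambda>x. \<Sum>i\<in>T. c i * e i x)"
  then obtain T c where T: "finite T" "T \<subseteq> J" "s = (\<lambda>x. \<Sum>i\<in>T. c i * e i x)" by blast
  have "s = (\<lambda>x. \<Sum>b\<in>e ` T. c (inv e b) * b x)"
    by (simp add: T(3) sum.reindex inj_on_subset[OF inj_e] inv_f_f[OF inj_e])
  then show "s \<in> complex_span (e ` J)"
    unfolding complex_span_def mem_Collect_eq using T by (intro exI[of _ "e ` T"] exI[of _ "\<lambda>b. c (inv e b)"]) auto
qed

lemma cspan_iff:
  "w \<in> cspan J \<longleftrightarrow> w \<in> L2 M \<and> (\<forall>\<epsilon>>0. \<exists>T c. finite T \<and> T \<subseteq> J \<and>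
     L2_norm M (\<lambda>x. w x - (\<Sum>i\<in>T. c i * e i x)) < \<epsilon>)"
proof -
  have "(\<exists>s\<in>complex_span (e ` J) \<inter> L2 M. L2_norm M (\<lambda>x. w x - s x) < \<epsilon>) \<longleftrightarrow>
    (\<exists>T c. finite T \<and> T \<subseteq> J \<and> L2_norm M (\<lambda>x. w x - (\<Sum>i\<in>T. c i * e i x)) < \<epsilon>)" (is "?l \<longleftrightarrow> ?r") for \<epsilon>
  proof
    assume ?l
    then show ?r unfolding Bex_def Int_iff complex_span_e by blast
  next
    assume ?r
    then obtain T c where T: "finite T" "T \<subseteq> J" "L2_norm M (\<lambda>x. w x - (\<Sum>i\<in>T. c i * e i x)) < \<epsilon>"
      by blast
    have "(\<lambda>x. \<Sum>i\<in>T. c i * e i x) \<in> complex_span (e ` J) \<inter> L2 M"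
      using T comb_L2 complex_span_e by blast
    with T(3) show ?l by (intro bexI[where x = "\<lambda>x. \<Sum>i\<in>T. c i * e i x"])
  qed
  then show ?thesis by (simp add: cspan_def L2_closed_span_def)
qed

lemma cspan_L2: "w \<in> cspan J \<Longrightarrow> w \<in> L2 M"
  by (simp add: cspan_iff)

lemma inner_comb_left:
  assumes "u \<in> L2 M"
  shows "L2_inner M (\<lambda>x. \<Sum>i\<in>T. c i * e i x) u = (\<Sum>i\<in>T. c i * L2_inner M (e i) u)"
  using assms by (simp add: L2_inner_sum_left L2_cmult e_L2 L2_inner_cmult_left)

lemma coef_comb:
  assumes "finite T"
  shows "coef (\<lambda>x. \<Sum>i\<in>T. c i * e i x) j = (if j \<in> T then c j else 0)"
  using assms by (simp add: coef_def inner_comb_left e_L2 e_inner if_distrib sum.delta' cong: if_cong)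

lemma norm_comb:
  assumes "finite T"
  shows "(L2_norm M (\<lambda>x. \<Sum>i\<in>T. c i * e i x))\<^sup>2 = (\<Sum>i\<in>T. (cmod (c i))\<^sup>2)"
proof -
  let ?s = "\<lambda>x. \<Sum>i\<in>T. c i * e i x"
  have *: "L2_inner M (e i) ?s = cnj (coef ?s i)" for i
    unfolding coef_def by (rule L2_inner_commute)
  have "complex_of_real ((L2_norm M ?s)\<^sup>2) = L2_inner M ?s ?s" by (rule L2_inner_self[symmetric])
  also have "\<dots> = (\<Sum>i\<in>T. c i * L2_inner M (e i) ?s)" by (rule inner_comb_left[OF comb_L2])
  also have "\<dots> = (\<Sum>i\<in>T. c i * cnj (c i))"
    by (rule sum.cong) (simp_all only: * coef_comb[OF assms] if_True)
  also have "\<dots> = complex_of_real (\<Sum>i\<in>T. (cmod (c i))\<^sup>2)"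
    by (simp only: complex_norm_square[symmetric] of_real_sum)
  finally show ?thesis by (simp only: of_real_eq_iff)
qed

text \<open>Completing the square in each coefficient. The last sum is the only part that depends on \<open>c\<close>, which
identifies the best approximation.\<close>

lemma norm_diff_comb:
  assumes "finite T" "u \<in> L2 M"
  shows "(L2_norm M (\<lambda>x. u x - (\<Sum>i\<in>T. c i * e i x)))\<^sup>2
    = (L2_norm M u)\<^sup>2 - (\<Sum>i\<in>T. (cmod (coef u i))\<^sup>2) + (\<Sum>i\<in>T. (cmod (c i - coef u i))\<^sup>2)"
proof -
  let ?s = "\<lambda>x. \<Sum>i\<in>T. c i * e i x"
  have "L2_inner M u ?s = cnj (\<Sum>i\<in>T. c i * L2_inner M (e i) u)"
    by (subst L2_inner_commute) (simp only: inner_comb_left[OF assms(2)])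
  also have "\<dots> = (\<Sum>i\<in>T. cnj (c i) * coef u i)"
    by (simp add: coef_def L2_inner_commute[of M u])
  finally have I: "L2_inner M u ?s = (\<Sum>i\<in>T. cnj (c i) * coef u i)" .
  have "(cmod (c i - coef u i))\<^sup>2 = (cmod (c i))\<^sup>2 + (cmod (coef u i))\<^sup>2 - 2 * Re (cnj (c i) * coef u i)" for i
    by (simp add: cmod_power2 power2_diff)
  then show ?thesis
    by (simp add: L2_norm_sq_diff[OF assms(2) comb_L2] norm_comb[OF assms(1)] I
        sum.distrib sum_subtractf sum_distrib_left)
qed

lemma norm_diff_partial:
  assumes "finite T" "u \<in> L2 M"
  shows "(L2_norm M (\<lambda>x. u x - (\<Sum>i\<in>T. coef u i * e i x)))\<^sup>2
    = (L2_norm M u)\<^sup>2 - (\<Sum>i\<in>T. (cmod (coef u i))\<^sup>2)"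
  using norm_diff_comb[OF assms, of "coef u"] by simp

lemma Bessel:
  assumes "finite T" "u \<in> L2 M"
  shows "(\<Sum>i\<in>T. (cmod (coef u i))\<^sup>2) \<le> (L2_norm M u)\<^sup>2"
  using norm_diff_partial[OF assms] zero_le_power2[of "L2_norm M (\<lambda>x. u x - (\<Sum>i\<in>T. coef u i * e i x))"]
  by linarith

lemma coef_summable:
  assumes "u \<in> L2 M"
  shows "(\<lambda>i. (cmod (coef u i))\<^sup>2) summable_on J"
  using Bessel[OF _ assms] by (intro nonneg_bdd_above_summable_on bdd_aboveI2[where M = "(L2_norm M u)\<^sup>2"]) auto

text \<open>Among the combinations over a fixed index set the partial Fourier sum is the best
  approximation.\<close>

lemma cspan_approx:
  assumes "w \<in> cspan J" "\<epsilon> > 0"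
  obtains T where "finite T" "T \<subseteq> J" "L2_norm M (\<lambda>x. w x - (\<Sum>i\<in>T. coef w i * e i x)) < \<epsilon>"
proof -
  obtain T c where T: "finite T" "T \<subseteq> J" "L2_norm M (\<lambda>x. w x - (\<Sum>i\<in>T. c i * e i x)) < \<epsilon>"
    using assms by (auto simp: cspan_iff)
  have w: "w \<in> L2 M" using assms(1) by (rule cspan_L2)
  have "(L2_norm M (\<lambda>x. w x - (\<Sum>i\<in>T. coef w i * e i x)))\<^sup>2
      \<le> (L2_norm M (\<lambda>x. w x - (\<Sum>i\<in>T. c i * e i x)))\<^sup>2"
    unfolding norm_diff_comb[OF T(1) w] by (simp add: sum_nonneg)
  then have "L2_norm M (\<lambda>x. w x - (\<Sum>i\<in>T. coef w i * e i x)) \<le> L2_norm M (\<lambda>x. w x - (\<Sum>i\<in>T. c i * e i x))"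
    by (rule power2_le_imp_le) (rule L2_norm_nonneg)
  then show ?thesis using T that by force
qed

text \<open>Bessel's inequality bounds the sum from above; the approximability of \<open>w\<close> makes the defect of the partial
sums as small as desired.\<close>

lemma Parseval:
  assumes "w \<in> cspan J"
  shows "((\<lambda>i. (cmod (coef w i))\<^sup>2) has_sum (L2_norm M w)\<^sup>2) J"
proof -
  let ?a = "\<lambda>i. (cmod (coef w i))\<^sup>2"
  have w: "w \<in> L2 M" using assms by (rule cspan_L2)
  have sm: "?a summable_on J" by (rule coef_summable[OF w])
  have "(L2_norm M w)\<^sup>2 \<le> infsum ?a J + \<epsilon>" if pos: "\<epsilon> > 0" for \<epsilon>
  proof -
    obtain T where T: "finite T" "T \<subseteq> J" "L2_norm M (\<lambda>x. w x - (\<Sum>i\<in>T. coef w i * e i x)) < sqrt \<epsilon>"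
      using cspan_approx[OF assms, of "sqrt \<epsilon>"] pos by auto
    have "(L2_norm M (\<lambda>x. w x - (\<Sum>i\<in>T. coef w i * e i x)))\<^sup>2 \<le> (sqrt \<epsilon>)\<^sup>2"
      using T(3) by (intro power_mono L2_norm_nonneg) simp
    then have "(L2_norm M w)\<^sup>2 \<le> sum ?a T + \<epsilon>"
      using pos norm_diff_partial[OF T(1) w] by simp
    also have "sum ?a T \<le> infsum ?a J" by (rule finite_sum_le_infsum[OF sm T(1,2)]) simp
    finally show ?thesis by simp
  qed
  then have "(L2_norm M w)\<^sup>2 \<le> infsum ?a J" by (rule field_le_epsilon)
  moreover have "infsum ?a J \<le> (L2_norm M w)\<^sup>2"
    by (rule infsum_le_finite_sums[OF sm]) (rule Bessel[OF _ w])
  ultimately show ?thesis using sm has_sum_infsum by (metis antisym)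
qed

lemma cspanI:
  assumes w: "w \<in> L2 M" and sum: "((\<lambda>i. (cmod (coef w i))\<^sup>2) has_sum (L2_norm M w)\<^sup>2) J"
  shows "w \<in> cspan J"
  unfolding cspan_iff
proof (intro conjI w allI impI)
  fix \<epsilon> :: real assume "\<epsilon> > 0"
  then have "\<epsilon>\<^sup>2 > 0" by simp
  then obtain T where T: "finite T" "T \<subseteq> J"
    and d: "dist (\<Sum>i\<in>T. (cmod (coef w i))\<^sup>2) ((L2_norm M w)\<^sup>2) \<le> \<epsilon>\<^sup>2 / 2"
    using has_sum_finite_approximation[OF sum, of "\<epsilon>\<^sup>2 / 2"] by (meson half_gt_zero)
  from d have "dist (\<Sum>i\<in>T. (cmod (coef w i))\<^sup>2) ((L2_norm M w)\<^sup>2) < \<epsilon>\<^sup>2"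
    using \<open>\<epsilon>\<^sup>2 > 0\<close> by linarith
  then have "(L2_norm M w)\<^sup>2 - (\<Sum>i\<in>T. (cmod (coef w i))\<^sup>2) < \<epsilon>\<^sup>2"
    by (simp add: dist_real_def abs_less_iff)
  then have "(L2_norm M (\<lambda>x. w x - (\<Sum>i\<in>T. coef w i * e i x)))\<^sup>2 < \<epsilon>\<^sup>2"
    by (simp add: norm_diff_partial[OF T(1) w])
  then have "L2_norm M (\<lambda>x. w x - (\<Sum>i\<in>T. coef w i * e i x)) < \<epsilon>"
    by (rule power2_less_imp_less) (use \<open>\<epsilon> > 0\<close> in simp)
  then show "\<exists>T c. finite T \<and> T \<subseteq> J \<and> L2_norm M (\<lambda>x. w x - (\<Sum>i\<in>T. c i * e i x)) < \<epsilon>"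
    using T by (intro exI[of _ T] exI[of _ "coef w"]) simp
qed

lemma cspan_mono: "J \<subseteq> K \<Longrightarrow> cspan J \<subseteq> cspan K"
  unfolding cspan_iff subset_iff by (meson subset_trans)

text \<open>Orthogonality to \<open>x\<close> is required only of those basis functions that occur in \<open>w\<close>. This allows
closed subspaces to be cut out by the vanishing of coefficients.\<close>

lemma cspan_inner_eq_0:
  assumes w: "w \<in> cspan J" and x: "x \<in> L2 M"
    and 0: "\<And>i. i \<in> J \<Longrightarrow> coef w i * L2_inner M (e i) x = 0"
  shows "L2_inner M w x = 0"
proof -
  have wL: "w \<in> L2 M" using w by (rule cspan_L2)
  define K where "K = L2_norm M x + 1"
  have K: "K > 0" using L2_norm_nonneg[of M x] by (simp add: K_def)
  have "cmod (L2_inner M w x) \<le> 0 + \<epsilon>" if pos: "\<epsilon> > 0" for \<epsilon>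
  proof -
    obtain T where T: "finite T" "T \<subseteq> J" "L2_norm M (\<lambda>x. w x - (\<Sum>i\<in>T. coef w i * e i x)) < \<epsilon> / K"
      using cspan_approx[OF w, of "\<epsilon> / K"] pos K by auto
    have "L2_inner M w x = L2_inner M (\<lambda>x. w x - (\<Sum>i\<in>T. coef w i * e i x)) x"
      using 0 T(2) by (subst L2_inner_diff_left[OF wL comb_L2 x])
        (simp add: inner_comb_left[OF x] sum.neutral subset_iff)
    also have "cmod \<dots> \<le> L2_norm M (\<lambda>x. w x - (\<Sum>i\<in>T. coef w i * e i x)) * L2_norm M x"
      by (rule L2_Cauchy_Schwarz[OF L2_minus[OF wL comb_L2] x])
    also have "\<dots> \<le> \<epsilon> / K * K"
      using T(3) K pos by (intro mult_mono) (auto simp: L2_norm_nonneg K_def)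
    finally show ?thesis using K by simp
  qed
  then have "cmod (L2_inner M w x) \<le> 0" by (rule field_le_epsilon)
  then show ?thesis by simp
qed

lemma coef_cspan_eq_0:
  assumes "w \<in> cspan J" "i \<notin> J"
  shows "coef w i = 0"
  unfolding coef_def by (rule cspan_inner_eq_0[OF assms(1) e_L2]) (use assms(2) in \<open>auto simp: e_inner\<close>)

lemma coef_diff:
  assumes "u \<in> L2 M" "v \<in> L2 M"
  shows "coef (\<lambda>x. u x - v x) i = coef u i - coef v i"
  by (simp add: coef_def L2_inner_diff_left assms e_L2)

lemma cspan_diff:
  assumes u: "u \<in> cspan J" and v: "v \<in> cspan J"
  shows "(\<lambda>x. u x - v x) \<in> cspan J"
  unfolding cspan_iff
proof (intro conjI allI impI L2_minus)
  show uL: "u \<in> L2 M" and vL: "v \<in> L2 M" using u v by (auto simp: cspan_L2)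
  fix \<epsilon> :: real assume "\<epsilon> > 0"
  obtain S where S: "finite S" "S \<subseteq> J" "L2_norm M (\<lambda>x. u x - (\<Sum>i\<in>S. coef u i * e i x)) < \<epsilon> / 2"
    using cspan_approx[OF u, of "\<epsilon> / 2"] \<open>\<epsilon> > 0\<close> by auto
  obtain T where T: "finite T" "T \<subseteq> J" "L2_norm M (\<lambda>x. v x - (\<Sum>i\<in>T. coef v i * e i x)) < \<epsilon> / 2"
    using cspan_approx[OF v, of "\<epsilon> / 2"] \<open>\<epsilon> > 0\<close> by auto
  define c where "c i = (if i \<in> S then coef u i else 0) - (if i \<in> T then coef v i else 0)" for i
  have restr: "(\<Sum>i\<in>S \<union> T. (if i \<in> X then d i else 0) * e i x) = (\<Sum>i\<in>X. d i * e i x)"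
    if "X \<subseteq> S \<union> T" for X d x
  proof -
    have "(\<Sum>i\<in>S \<union> T. (if i \<in> X then d i else 0) * e i x) = (\<Sum>i\<in>S \<union> T. if i \<in> X then d i * e i x else 0)"
      by (rule sum.cong) auto
    also have "\<dots> = (\<Sum>i\<in>(S \<union> T) \<inter> X. d i * e i x)"
      using S(1) T(1) by (subst sum.inter_restrict) auto
    also have "(S \<union> T) \<inter> X = X" using that by auto
    finally show ?thesis .
  qed
  have eq: "(\<Sum>i\<in>S \<union> T. c i * e i x) = (\<Sum>i\<in>S. coef u i * e i x) - (\<Sum>i\<in>T. coef v i * e i x)" for x
    unfolding c_def left_diff_distrib sum_subtractf by (subst (1 2) restr) auto
  have "L2_norm M (\<lambda>x. u x - v x - (\<Sum>i\<in>S \<union> T. c i * e i x))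
     = L2_norm M (\<lambda>x. (u x - (\<Sum>i\<in>S. coef u i * e i x)) + -1 * (v x - (\<Sum>i\<in>T. coef v i * e i x)))"
    by (simp only: eq) (simp add: algebra_simps)
  also have "\<dots> \<le> L2_norm M (\<lambda>x. u x - (\<Sum>i\<in>S. coef u i * e i x))
       + L2_norm M (\<lambda>x. -1 * (v x - (\<Sum>i\<in>T. coef v i * e i x)))"
    by (rule L2_norm_triangle) (intro L2_minus L2_cmult uL vL comb_L2)+
  also have "\<dots> < \<epsilon>" using S(3) T(3) by (subst L2_norm_cmult) simp
  finally show "\<exists>T c. finite T \<and> T \<subseteq> J \<and> L2_norm M (\<lambda>x. u x - v x - (\<Sum>i\<in>T. c i * e i x)) < \<epsilon>"
    using S T by (intro exI[of _ "S \<union> T"] exI[of _ c]) auto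
qed

text \<open>Riesz--Fischer: the partial Fourier sums along an enumeration of the index set form a Cauchy
  sequence because the tails of the Bessel series are small.\<close>

lemma cspan_projection_ex:
  assumes u: "u \<in> L2 M"
  obtains v where "v \<in> cspan J" "\<And>i. coef v i = (if i \<in> J then coef u i else 0)"
proof -
  define B where "B N = {i \<in> J. to_nat i < N}" for N :: nat
  have fB: "finite (B N)" for N
    by (rule finite_imageD[of to_nat]) (auto simp: B_def intro: finite_subset[of _ "{..<N}"] inj_on_subset[OF inj_to_nat])
  define s where "s N x = (\<Sum>i\<in>B N. coef u i * e i x)" for N x
  define a where "a N = (\<Sum>i\<in>B N. (cmod (coef u i))\<^sup>2)" for N
  have Bmono: "B m \<subseteq> B n" if "m \<le> n" for m n using that by (auto simp: B_def)
  have "incseq a" unfolding a_def by (intro monoI sum_mono2 fB Bmono) auto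
  moreover have "a N \<le> (L2_norm M u)\<^sup>2" for N unfolding a_def by (rule Bessel[OF fB u])
  ultimately have "Cauchy a"
    by (metis incseq_convergent LIMSEQ_imp_Cauchy)
  have diff: "(L2_norm M (\<lambda>x. s n x - s m x))\<^sup>2 = \<bar>a n - a m\<bar>" for m n
  proof (induction m n rule: linorder_wlog)
    case (le m n)
    have "s n x - s m x = (\<Sum>i\<in>B n - B m. coef u i * e i x)" for x
      unfolding s_def using sum_diff[OF fB Bmono[OF le]] by metis
    then have "(L2_norm M (\<lambda>x. s n x - s m x))\<^sup>2 = (\<Sum>i\<in>B n - B m. (cmod (coef u i))\<^sup>2)"
      by (simp only: norm_comb[OF finite_Diff[OF fB]])
    also have "\<dots> = a n - a m" unfolding a_def by (rule sum_diff[OF fB Bmono[OF le]])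
    finally show ?case using sum_nonneg[of "B n - B m" "\<lambda>i. (cmod (coef u i))\<^sup>2"]
      by (metis abs_of_nonneg zero_le_power2)
  next
    case (sym m n)
    then show ?case by (simp add: L2_norm_minus_commute[of M "s m"] abs_minus_commute)
  qed
  have sL: "s n \<in> L2 M" for n unfolding s_def by (rule comb_L2)
  have "\<exists>N. \<forall>i\<ge>N. \<forall>j\<ge>N. L2_norm M (\<lambda>x. s i x - s j x) < \<epsilon>" if pos: "\<epsilon> > 0" for \<epsilon>
  proof -
    obtain N where N: "\<And>i j. i \<ge> N \<Longrightarrow> j \<ge> N \<Longrightarrow> \<bar>a i - a j\<bar> < \<epsilon>\<^sup>2"
      using \<open>Cauchy a\<close> pos unfolding Cauchy_def dist_real_def by (meson zero_less_power)
    have "L2_norm M (\<lambda>x. s i x - s j x) < \<epsilon>" if "i \<ge> N" "j \<ge> N" for i j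
      by (rule power2_less_imp_less[of _ \<epsilon>]) (use N[OF that] \<open>\<epsilon> > 0\<close> in \<open>simp_all add: diff\<close>)
    then show ?thesis by blast
  qed
  then obtain v where v: "v \<in> L2 M" and lim: "(\<lambda>n. L2_norm M (\<lambda>x. v x - s n x)) \<longlonglongrightarrow> 0"
    by (rule L2_complete[OF sL])
  have "v \<in> cspan J"
    unfolding cspan_iff
  proof (intro conjI v allI impI)
    fix \<epsilon> :: real assume "\<epsilon> > 0"
    then have "\<forall>\<^sub>F n in sequentially. L2_norm M (\<lambda>x. v x - s n x) < \<epsilon>"
      using lim order_tendstoD(2) by blast
    then obtain n where "L2_norm M (\<lambda>x. v x - s n x) < \<epsilon>" by (auto simp: eventually_sequentially)
    then show "\<exists>T c. finite T \<and> T \<subseteq> J \<and> L2_norm M (\<lambda>x. v x - (\<Sum>i\<in>T. c i * e i x)) < \<epsilon>"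
      using fB by (intro exI[of _ "B n"] exI[of _ "coef u"]) (auto simp: s_def B_def)
  qed
  moreover have "coef v i = (if i \<in> J then coef u i else 0)" for i
  proof (cases "i \<in> J")
    case True
    have "\<forall>\<^sub>F n in sequentially. cmod (coef v i - coef u i) \<le> L2_norm M (\<lambda>x. v x - s n x) * 1"
      using eventually_gt_at_top[of "to_nat i"]
    proof eventually_elim
      case (elim n)
      have "coef (s n) i = coef u i"
        unfolding s_def using True elim by (subst coef_comb[OF fB]) (simp add: B_def)
      then have "coef v i - coef u i = L2_inner M (\<lambda>x. v x - s n x) (e i)"
        using coef_diff[OF v sL[of n], of i] by (simp add: coef_def)
      also have "cmod \<dots> \<le> L2_norm M (\<lambda>x. v x - s n x) * L2_norm M (e i)"
        by (rule L2_Cauchy_Schwarz[OF L2_minus[OF v sL] e_L2])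
      also have "L2_norm M (e i) = 1"
        using L2_inner_self[of M "e i"] e_inner[of i i] L2_norm_nonneg[of M "e i"]
        by (metis of_real_eq_1_iff power2_eq_1_iff neg_0_le_iff_le not_one_le_zero)
      finally show ?case .
    qed
    then have "cmod (coef v i - coef u i) \<le> 0"
      by (intro tendsto_lowerbound[where f = "\<lambda>n. L2_norm M (\<lambda>x. v x - s n x)" and F = sequentially])
         (use lim in simp_all)
    then show ?thesis using True by simp
  qed (use coef_cspan_eq_0[OF \<open>v \<in> cspan J\<close>] in auto)
  ultimately show ?thesis by (rule that)
qed

text \<open>The projection is an arbitrary representative, known only through its defining property, but that property
determines its coefficients and hence its class.\<close>

lemma L2_proj_cspan:
  fixes J
  assumes u: "u \<in> L2 M"
  defines "P \<equiv> L2_proj M (cspan J) u"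
  shows "P \<in> cspan J" "\<And>i. coef P i = (if i \<in> J then coef u i else 0)"
proof -
  obtain v where v: "v \<in> cspan J" "\<And>i. coef v i = (if i \<in> J then coef u i else 0)"
    using cspan_projection_ex[OF u, of J] by blast
  have vL: "v \<in> L2 M" using v by (auto simp: cspan_L2)
  have "L2_inner M (\<lambda>x. u x - v x) s = 0" if s: "s \<in> cspan J" for s
  proof (subst L2_inner_commute, subst cspan_inner_eq_0[OF s L2_minus[OF u vL]])
    fix i assume "i \<in> J"
    then have "coef (\<lambda>x. u x - v x) i = 0" by (simp add: coef_diff[OF u vL] v)
    then show "coef s i * L2_inner M (e i) (\<lambda>x. u x - v x) = 0"
      by (simp add: L2_inner_commute[of M "e i"] coef_def)
  qed simp
  with v(1) have "\<exists>v. v \<in> cspan J \<and> (\<forall>s\<in>cspan J. L2_inner M (\<lambda>x. u x - v x) s = 0)" by blast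
  from someI_ex[OF this] have "P \<in> cspan J \<and> (\<forall>s\<in>cspan J. L2_inner M (\<lambda>x. u x - P x) s = 0)"
    unfolding P_def L2_proj_def .
  then have PJ: "P \<in> cspan J" and *: "\<And>s. s \<in> cspan J \<Longrightarrow> L2_inner M (\<lambda>x. u x - P x) s = 0"
    by auto
  show "P \<in> cspan J" by (rule PJ)
  fix i show "coef P i = (if i \<in> J then coef u i else 0)"
  proof (cases "i \<in> J")
    case True
    have "e i \<in> cspan J"
      unfolding cspan_iff using True
      by (intro conjI e_L2 allI impI exI[of _ "{i}"] exI[of _ "\<lambda>i. 1"]) (simp_all add: L2_norm_def)
    from *[OF this] show ?thesis using True coef_diff[OF u cspan_L2[OF PJ], of i] by (simp add: coef_def)
  qed (simp add: coef_cspan_eq_0[OF PJ])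
qed

end

section \<open>Lebesgue measure on Euclidean space\<close>

lemma lborel_translation_integral:
  fixes G :: "'a::euclidean_space \<Rightarrow> 'b::{banach, second_countable_topology}"
  assumes "integrable lborel G"
  shows "integrable lborel (\<lambda>x. G (x + a))" "(\<integral>x. G (x + a) \<partial>lborel) = (\<integral>x. G x \<partial>lborel)"
proof -
  have m: "G \<in> borel_measurable borel" using borel_measurable_integrable[OF assms] by simp
  have eq: "distr lborel borel (\<lambda>x. x + a) = (lborel :: 'a measure)"
    by (subst lborel_distr_plus[of a, symmetric]) (rule arg_cong[where f = "distr lborel borel"], simp add: fun_eq_iff add.commute)
  have "integrable (distr lborel borel (\<lambda>x. x + a)) G" using assms by (simp only: eq)
  then show "integrable lborel (\<lambda>x. G (x + a))"
    using m by (subst (asm) integrable_distr_eq) auto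
  have "(\<integral>x. G x \<partial>lborel) = (\<integral>x. G x \<partial>distr lborel borel (\<lambda>x. x + a))" by (simp only: eq)
  also have "\<dots> = (\<integral>x. G (x + a) \<partial>lborel)" using m by (subst integral_distr) auto
  finally show "(\<integral>x. G (x + a) \<partial>lborel) = (\<integral>x. G x \<partial>lborel)" by simp
qed

text \<open>The integral of a function does not change under translation by \<open>v\<close>; the difference is
  the integral of \<open>\<partial>\<^sub>v G\<close> along the segment, which by Fubini is the integral of \<open>\<partial>\<^sub>v G\<close>.\<close>

lemma integral_directional_derivative_eq_0:
  fixes G :: "'a::euclidean_space \<Rightarrow> 'b::euclidean_space"
  assumes der: "\<And>x. (G has_derivative G' x) (at x)"
    and cont: "continuous_on UNIV (\<lambda>x. G' x v)"
    and int: "integrable lborel G" and int': "integrable lborel (\<lambda>x. G' x v)"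
  shows "(\<integral>x. G' x v \<partial>lborel) = 0"
proof -
  define d where "d x = G' x v" for x
  have dm [measurable]: "d \<in> borel_measurable borel"
    unfolding d_def by (rule borel_measurable_continuous_onI[OF cont])
  have ftc: "(\<integral>t. indicator {0..1::real} t *\<^sub>R d (x + t *\<^sub>R v) \<partial>lborel) = G (x + v) - G x" for x
  proof -
    have vd: "((\<lambda>t. G (x + t *\<^sub>R v)) has_vector_derivative d (x + t *\<^sub>R v)) (at t within {0..1})" for t :: real
    proof -
      have "((\<lambda>t. G (x + t *\<^sub>R v)) has_derivative (\<lambda>s. G' (x + t *\<^sub>R v) (s *\<^sub>R v))) (at t within {0..1})"
        by (rule has_derivative_compose[OF _ der])
           (auto intro!: derivative_eq_intros)
      moreover have "G' (x + t *\<^sub>R v) (s *\<^sub>R v) = s *\<^sub>R d (x + t *\<^sub>R v)" for s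
        unfolding d_def using has_derivative_linear[OF der] by (simp add: linear_cmul)
      ultimately show ?thesis by (simp add: has_vector_derivative_def)
    qed
    have "continuous_on {0..1} (\<lambda>t. d (x + t *\<^sub>R v))"
      unfolding d_def by (rule continuous_on_compose2[OF cont]) (auto intro!: continuous_intros)
    from integral_FTC_Icc[OF _ vd this] show ?thesis by simp
  qed
  have I: "integrable (lborel \<Otimes>\<^sub>M lborel) (\<lambda>(t, x). indicator {0..1::real} t *\<^sub>R d (x + t *\<^sub>R v))"
  proof (rule lborel_pair.Fubini_integrable)
    show "(\<lambda>(t, x). indicator {0..1::real} t *\<^sub>R d (x + t *\<^sub>R v)) \<in> borel_measurable (lborel \<Otimes>\<^sub>M lborel)"
      by measurable
    have n: "integrable lborel (\<lambda>x. norm (d x))" using int' by (simp add: d_def)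
    have "(\<lambda>t. \<integral>y. norm (case (t, y) of (t, x) \<Rightarrow> indicator {0..1::real} t *\<^sub>R d (x + t *\<^sub>R v)) \<partial>lborel)
       = (\<lambda>t. indicator {0..1} t * (\<integral>x. norm (d x) \<partial>lborel))"
      by (rule ext) (use lborel_translation_integral(2)[OF n] in simp)
    moreover have "integrable lborel (\<lambda>t::real. indicator {0..1} t * (\<integral>x. norm (d x) \<partial>lborel))"
      by simp
    ultimately show "integrable lborel (\<lambda>t. \<integral>y. norm (case (t, y) of (t, x) \<Rightarrow> indicator {0..1::real} t *\<^sub>R d (x + t *\<^sub>R v)) \<partial>lborel)"
      by (simp only:)
    show "AE t in lborel. integrable lborel (\<lambda>y. case (t, y) of (t, x) \<Rightarrow> indicator {0..1::real} t *\<^sub>R d (x + t *\<^sub>R v))"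
      using int' by (auto intro!: AE_I2 integrable_scaleR_right lborel_translation_integral(1) simp: d_def)
  qed
  have dI: "integrable lborel d" using int' by (simp add: d_def[abs_def])
  have "(\<integral>x. G' x v \<partial>lborel) = (\<integral>t. indicator {0..1::real} t *\<^sub>R (\<integral>x. d x \<partial>lborel) \<partial>lborel)"
    by (simp add: d_def)
  also have "\<dots> = (\<integral>t. (\<integral>x. indicator {0..1::real} t *\<^sub>R d (x + t *\<^sub>R v) \<partial>lborel) \<partial>lborel)"
    by (simp add: lborel_translation_integral(2)[OF dI])
  also have "\<dots> = (\<integral>x. (\<integral>t. indicator {0..1::real} t *\<^sub>R d (x + t *\<^sub>R v) \<partial>lborel) \<partial>lborel)"
    using lborel_pair.Fubini_integral[OF I] by simp
  also have "\<dots> = (\<integral>x. G (x + v) - G x \<partial>lborel)" by (simp only: ftc)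
  also have "\<dots> = 0"
    using lborel_translation_integral[OF int, of v] int by simp
  finally show ?thesis .
qed

lemma nn_integral_gaussian:
  assumes "c > 0"
  shows "(\<integral>\<^sup>+x. ennreal (exp (- c * (norm x)\<^sup>2)) \<partial>(lborel :: 'a::euclidean_space measure))
    = ennreal (sqrt (pi / c) ^ DIM('a))"
proof -
  have 1: "(\<integral>\<^sup>+t. ennreal (exp (- c * t\<^sup>2)) \<partial>lborel) = ennreal (sqrt (pi / c))"
  proof -
    define \<sigma> where "\<sigma> = sqrt (1 / (2 * c))"
    have s: "\<sigma> > 0" "\<sigma>\<^sup>2 = 1 / (2 * c)" using assms by (auto simp: \<sigma>_def)
    have "exp (- c * t\<^sup>2) = sqrt (pi / c) * normal_density 0 \<sigma> t" for t
      using assms by (simp add: normal_density_def s(2) field_simps real_sqrt_divide)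
    then have "(\<integral>\<^sup>+t. ennreal (exp (- c * t\<^sup>2)) \<partial>lborel)
       = (\<integral>\<^sup>+t. ennreal (sqrt (pi / c)) * ennreal (normal_density 0 \<sigma> t) \<partial>lborel)"
      using assms by (simp add: ennreal_mult)
    also have "\<dots> = ennreal (sqrt (pi / c)) * (\<integral>\<^sup>+t. ennreal (normal_density 0 \<sigma> t) \<partial>lborel)"
      by (rule nn_integral_cmult) simp
    also have "(\<integral>\<^sup>+t. ennreal (normal_density 0 \<sigma> t) \<partial>lborel) = 1"
      using s(1) by (subst nn_integral_eq_integral) auto
    finally show ?thesis by simp
  qed
  have "exp (- c * (norm x)\<^sup>2) = (\<Prod>b\<in>Basis. exp (- c * (x \<bullet> b)\<^sup>2))" for x :: 'a
  proof -
    have "(norm x)\<^sup>2 = (\<Sum>b\<in>Basis. (x \<bullet> b)\<^sup>2)"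
      unfolding power2_norm_eq_inner by (subst euclidean_inner) (simp add: power2_eq_square)
    then show ?thesis by (simp only: sum_distrib_left exp_sum[OF finite_Basis])
  qed
  then have "(\<integral>\<^sup>+x. ennreal (exp (- c * (norm x)\<^sup>2)) \<partial>(lborel :: 'a measure))
     = (\<integral>\<^sup>+x. (\<Prod>b\<in>Basis. ennreal (exp (- c * (x \<bullet> b)\<^sup>2))) \<partial>(lborel :: 'a measure))"
    by (simp add: prod_ennreal)
  also have "\<dots> = (\<Prod>b\<in>(Basis :: 'a set). (\<integral>\<^sup>+t. ennreal (exp (- c * t\<^sup>2)) \<partial>lborel))"
    by (rule nn_integral_lborel_prod) auto
  also have "\<dots> = ennreal (sqrt (pi / c) ^ DIM('a))"
    using assms by (simp only: 1 prod_constant) (simp add: ennreal_power)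
  finally show ?thesis .
qed

lemma integrable_gaussian:
  assumes "c > 0"
  shows "integrable lborel (\<lambda>x :: 'a::euclidean_space. exp (- c * (norm x)\<^sup>2))"
  by (intro integrableI_nonneg) (use nn_integral_gaussian[OF assms, where 'a = 'a] in simp_all)

lemma integral_gaussian:
  assumes "c > 0"
  shows "(\<integral>x. exp (- c * (norm x)\<^sup>2) \<partial>(lborel :: 'a::euclidean_space measure)) = sqrt (pi / c) ^ DIM('a)"
  using assms by (subst integral_eq_nn_integral) (simp_all add: nn_integral_gaussian[OF assms, simplified])

lemma nn_integral_lborel_translation:
  assumes [measurable]: "f \<in> borel_measurable borel"
  shows "(\<integral>\<^sup>+x. f (x + a) \<partial>lborel) = (\<integral>\<^sup>+x. f x \<partial>(lborel :: 'a::euclidean_space measure))"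
proof -
  have eq: "distr lborel borel (\<lambda>x. x + a) = (lborel :: 'a measure)"
    by (subst lborel_distr_plus[of a, symmetric]) (rule arg_cong[where f = "distr lborel borel"], simp add: fun_eq_iff add.commute)
  have "(\<integral>\<^sup>+x. f x \<partial>lborel) = (\<integral>\<^sup>+x. f x \<partial>distr lborel borel (\<lambda>x. x + a))" by (simp only: eq)
  then show ?thesis by (subst (asm) nn_integral_distr) auto
qed

text \<open>Uniqueness of Haar measure, specialised: the image of Lebesgue measure under a linear map is
  translation invariant, hence proportional to Lebesgue measure by the usual double integral
  argument, and testing against the rotation invariant Gaussian shows that the factor is \<open>1\<close>.\<close>

lemma lborel_distr_linear_isometry:
  fixes T S :: "'a::euclidean_space \<Rightarrow> 'a"
  assumes T: "linear T" and iso: "\<And>x. norm (T x) = norm x" and TS: "\<And>x. T (S x) = x"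
  shows "distr lborel borel T = lborel"
proof (rule measure_eqI)
  show "sets (distr lborel borel T) = sets (lborel :: 'a measure)" by simp
  fix A assume "A \<in> sets (distr lborel borel T)"
  then have [measurable]: "A \<in> sets borel" by simp
  have [measurable]: "T \<in> borel_measurable borel"
    using T by (intro borel_measurable_continuous_onI linear_continuous_on linear_conv_bounded_linear[THEN iffD1])
  \<comment> \<open>any integrable test function that is even and invariant under the isometry would do\<close>
  define \<phi> :: "'a \<Rightarrow> ennreal" where "\<phi> x = ennreal (exp (- 1 * (norm x)\<^sup>2))" for x
  have [measurable]: "\<phi> \<in> borel_measurable borel" unfolding \<phi>_def by measurable
  define f :: "'a \<Rightarrow> ennreal" where "f = indicator A"
  have [measurable]: "f \<in> borel_measurable borel" by (simp add: f_def)
  have \<phi>T: "\<phi> (- T x) = \<phi> x" for x by (simp add: \<phi>_def iso)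
  have swap: "T (x + S y) = T x + y" for x y using T TS by (simp add: linear_add)
  have "(\<integral>\<^sup>+x. f (T x) \<partial>lborel) * (\<integral>\<^sup>+y. \<phi> y \<partial>lborel) = (\<integral>\<^sup>+x. (\<integral>\<^sup>+y. f (T x) * \<phi> y \<partial>lborel) \<partial>lborel)"
    by (simp add: nn_integral_cmult nn_integral_multc)
  also have "\<dots> = (\<integral>\<^sup>+x. (\<integral>\<^sup>+y. f (T x) * \<phi> (y + - T x) \<partial>lborel) \<partial>lborel)"
    by (intro nn_integral_cong nn_integral_lborel_translation[symmetric]) measurable
  also have "\<dots> = (\<integral>\<^sup>+y. (\<integral>\<^sup>+x. f (T x) * \<phi> (y + - T x) \<partial>lborel) \<partial>lborel)"
    by (rule lborel_pair.Fubini') measurable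
  also have "\<dots> = (\<integral>\<^sup>+y. (\<integral>\<^sup>+x. f (T (x + S y)) * \<phi> (y + - T (x + S y)) \<partial>lborel) \<partial>lborel)"
    by (intro nn_integral_cong nn_integral_lborel_translation[symmetric]) measurable
  also have "\<dots> = (\<integral>\<^sup>+y. (\<integral>\<^sup>+x. f (T x + y) * \<phi> x \<partial>lborel) \<partial>lborel)"
    by (simp add: swap \<phi>T)
  also have "\<dots> = (\<integral>\<^sup>+x. (\<integral>\<^sup>+y. f (T x + y) * \<phi> x \<partial>lborel) \<partial>lborel)"
    by (rule lborel_pair.Fubini') measurable
  also have "\<dots> = (\<integral>\<^sup>+x. (\<integral>\<^sup>+y. f (y + T x) \<partial>lborel) * \<phi> x \<partial>lborel)"
    by (simp add: nn_integral_multc add.commute)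
  also have "\<dots> = (\<integral>\<^sup>+y. f y \<partial>lborel) * (\<integral>\<^sup>+y. \<phi> y \<partial>lborel)"
    by (simp add: nn_integral_lborel_translation nn_integral_cmult)
  finally have "(\<integral>\<^sup>+x. f (T x) \<partial>lborel) * (\<integral>\<^sup>+y. \<phi> y \<partial>lborel) = (\<integral>\<^sup>+y. f y \<partial>lborel) * (\<integral>\<^sup>+y. \<phi> y \<partial>lborel)" .
  moreover have "(\<integral>\<^sup>+y. \<phi> y \<partial>lborel) = ennreal (sqrt (pi / 1) ^ DIM('a))"
    unfolding \<phi>_def by (rule nn_integral_gaussian) simp
  ultimately have "(\<integral>\<^sup>+x. f (T x) \<partial>lborel) = (\<integral>\<^sup>+y. f y \<partial>lborel)"
    by (metis mult_divide_eq_ennreal ennreal_eq_0_iff ennreal_neq_top not_le pi_gt_zero div_by_1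
        real_sqrt_gt_zero zero_less_power)
  then have "(\<integral>\<^sup>+x. f x \<partial>distr lborel borel T) = (\<integral>\<^sup>+y. f y \<partial>lborel)"
    by (simp add: nn_integral_distr)
  then show "emeasure (distr lborel borel T) A = emeasure lborel A"
    unfolding f_def by (subst (asm) (1 2) nn_integral_indicator) auto
qed

section \<open>Wirtinger derivatives\<close>

type_synonym 'n cfun = "complex ^ 'n \<Rightarrow> complex"

lemma dir_deriv_eq: "(F has_derivative F') (at z) \<Longrightarrow> dir_deriv v F z = F' v"
  unfolding dir_deriv_def using frechet_derivative_at by metis

lemma has_dir_deriv: "F differentiable at z \<Longrightarrow> (F has_derivative (\<lambda>v. dir_deriv v F z)) (at z)"
  unfolding dir_deriv_def using frechet_derivative_works by metis

lemma dir_deriv_const: "dir_deriv v (\<lambda>z. c) z = 0"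
  by (rule dir_deriv_eq) simp

lemma dir_deriv_add:
  assumes "F differentiable at z" "G differentiable at z"
  shows "dir_deriv v (\<lambda>z. F z + G z) z = dir_deriv v F z + dir_deriv v G z"
  by (rule dir_deriv_eq) (intro has_derivative_add has_dir_deriv assms)

lemma dir_deriv_mult:
  fixes F G :: "'a::euclidean_space \<Rightarrow> 'b::real_normed_field"
  assumes "F differentiable at z" "G differentiable at z"
  shows "dir_deriv v (\<lambda>z. F z * G z) z = dir_deriv v F z * G z + F z * dir_deriv v G z"
  using dir_deriv_eq[OF has_derivative_mult[OF has_dir_deriv[OF assms(1)] has_dir_deriv[OF assms(2)]], of v]
  by simp

lemma dir_deriv_cnj:
  assumes "F differentiable at z"
  shows "dir_deriv v (\<lambda>z. cnj (F z)) z = cnj (dir_deriv v F z)"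
  by (rule dir_deriv_eq) (intro bounded_linear.has_derivative[OF bounded_linear_cnj] has_dir_deriv assms)

lemma differentiable_cnj: "F differentiable at z \<Longrightarrow> (\<lambda>z. cnj (F z)) differentiable at z"
  using bounded_linear.has_derivative[OF bounded_linear_cnj] unfolding differentiable_def by blast

text \<open>An index \<open>(k, True)\<close> stands for \<open>d / d zbar_k\<close> and for the coordinate \<open>zbar_k\<close>, and \<open>(k, False)\<close> for
\<open>d / d z_k\<close> and \<open>z_k\<close>. Treating both kinds alike halves the commutation relations; complex conjugation
acts on the indices by \<open>flip\<close>.\<close>

definition flip :: "'n \<times> bool \<Rightarrow> 'n \<times> bool" where
  "flip i = (fst i, \<not> snd i)"

definition coord :: "'n \<times> bool \<Rightarrow> 'n::finite cfun" where
  "coord i z = (if snd i then cnj (z $ fst i) else z $ fst i)"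

definition wirt :: "'n \<times> bool \<Rightarrow> 'n::finite cfun \<Rightarrow> 'n cfun" where
  "wirt i F z = 1 / 2 * (dir_deriv (axis (fst i) 1) F z
     + (if snd i then \<i> else - \<i>) * dir_deriv (axis (fst i) \<i>) F z)"

lemma wirt_True: "wirt (k, True) = d_zbar k"
  by (intro ext) (simp add: wirt_def d_zbar_def)

lemma wirt_False: "wirt (k, False) = d_z k"
  by (intro ext) (simp add: wirt_def d_z_def)

lemma flip_flip [simp]: "flip (flip i) = i" by (simp add: flip_def)
lemma flip_eq_iff [simp]: "flip i = flip j \<longleftrightarrow> i = j" by (auto simp: flip_def prod_eq_iff)
lemma flip_eq_swap: "flip i = j \<longleftrightarrow> i = flip j" by (auto simp: flip_def prod_eq_iff)

lemma cnj_coord: "cnj (coord i z) = coord (flip i) z"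
  by (simp add: coord_def flip_def)

lemma coord_has_derivative:
  fixes i :: "'n::finite \<times> bool"
  shows "(coord i has_derivative coord i) (at z)"
proof -
  have "((\<lambda>z :: complex ^ 'n. z $ fst i) has_derivative (\<lambda>z. z $ fst i)) (at z)"
    by (rule bounded_linear_imp_has_derivative[OF bounded_linear_vec_nth])
  moreover from bounded_linear.has_derivative[OF bounded_linear_cnj this]
  have "((\<lambda>z :: complex ^ 'n. cnj (z $ fst i)) has_derivative (\<lambda>z. cnj (z $ fst i))) (at z)" .
  ultimately show ?thesis by (cases "snd i") (simp_all add: coord_def[abs_def])
qed

lemma coord_differentiable: "coord i differentiable at z"
  using coord_has_derivative differentiableI by blast

lemma dir_deriv_coord: "dir_deriv v (coord i) z = coord i v"
  by (rule dir_deriv_eq[OF coord_has_derivative])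

lemma wirt_const: "wirt i (\<lambda>z. c) z = 0"
  by (simp add: wirt_def dir_deriv_const)

lemma wirt_add:
  assumes "F differentiable at z" "G differentiable at z"
  shows "wirt i (\<lambda>z. F z + G z) z = wirt i F z + wirt i G z"
  by (simp add: wirt_def dir_deriv_add assms algebra_simps)

lemma wirt_mult:
  assumes "F differentiable at z" "G differentiable at z"
  shows "wirt i (\<lambda>z. F z * G z) z = wirt i F z * G z + F z * wirt i G z"
  by (simp add: wirt_def dir_deriv_mult assms algebra_simps)

lemma wirt_cmult: "F differentiable at z \<Longrightarrow> wirt i (\<lambda>z. a * F z) z = a * wirt i F z"
  by (subst wirt_mult) (simp_all add: wirt_const)

lemma wirt_diff:
  assumes "F differentiable at z" "G differentiable at z"
  shows "wirt i (\<lambda>z. F z - G z) z = wirt i F z - wirt i G z"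
  using wirt_add[of F z "\<lambda>z. - 1 * G z" i] wirt_cmult[OF assms(2), of i "-1"] assms by simp

lemma wirt_coord: "wirt i (coord j) z = (if i = j then 1 else 0)"
  by (simp add: wirt_def dir_deriv_coord coord_def axis_def prod_eq_iff)

lemma wirt_cnj:
  assumes "F differentiable at z"
  shows "wirt i (\<lambda>z. cnj (F z)) z = cnj (wirt (flip i) F z)"
  by (simp add: wirt_def dir_deriv_cnj assms flip_def)

section \<open>Polynomials\<close>

text \<open>The ring of polynomial functions in the coordinates and their conjugates. Working with functions rather
than with formal polynomials is enough, since every property needed is stable under sums and products.\<close>

inductive zpoly :: "'n::finite cfun \<Rightarrow> bool" where
  zpoly_const: "zpoly (\<lambda>z. c)"
| zpoly_coord: "zpoly (coord i)"
| zpoly_add: "zpoly F \<Longrightarrow> zpoly G \<Longrightarrow> zpoly (\<lambda>z. F z + G z)"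
| zpoly_mult: "zpoly F \<Longrightarrow> zpoly G \<Longrightarrow> zpoly (\<lambda>z. F z * G z)"

lemma zpoly_cmult: "zpoly F \<Longrightarrow> zpoly (\<lambda>z. a * F z)"
  by (intro zpoly_mult zpoly_const)

lemma zpoly_diff: "zpoly F \<Longrightarrow> zpoly G \<Longrightarrow> zpoly (\<lambda>z. F z - G z)"
  using zpoly_add[of F "\<lambda>z. -1 * G z"] zpoly_cmult[of G "-1"] by simp

lemma zpoly_sum: "(\<And>i. i \<in> A \<Longrightarrow> zpoly (F i)) \<Longrightarrow> zpoly (\<lambda>z. \<Sum>i\<in>A. F i z)"
  by (induction A rule: infinite_finite_induct) (auto intro: zpoly_const zpoly_add)

lemma zpoly_prod: "(\<And>i. i \<in> A \<Longrightarrow> zpoly (F i)) \<Longrightarrow> zpoly (\<lambda>z. \<Prod>i\<in>A. F i z)"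
  by (induction A rule: infinite_finite_induct) (auto intro: zpoly_const zpoly_mult)

lemma zpoly_power: "zpoly F \<Longrightarrow> zpoly (\<lambda>z. F z ^ m)"
  by (induction m) (auto intro: zpoly_const zpoly_mult)

lemma zpoly_cnj: "zpoly F \<Longrightarrow> zpoly (\<lambda>z. cnj (F z))"
  by (induction rule: zpoly.induct) (auto simp: cnj_coord intro: zpoly.intros)

lemma zpoly_nth: "zpoly (\<lambda>z. z $ k)"
  using zpoly_coord[of "(k, False)"] by (simp add: coord_def[abs_def])

lemma zpoly_differentiable: "zpoly F \<Longrightarrow> F differentiable at z"
  by (induction rule: zpoly.induct) (auto intro: coord_differentiable differentiable_add differentiable_mult)

lemma zpoly_continuous: "zpoly F \<Longrightarrow> continuous_on UNIV F"
  using zpoly_differentiable by (meson continuous_at_imp_continuous_on differentiable_imp_continuous_within)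

lemma zpoly_measurable: "zpoly F \<Longrightarrow> F \<in> borel_measurable borel"
  using zpoly_continuous by (rule borel_measurable_continuous_onI)

lemma zpoly_dir_deriv: "zpoly F \<Longrightarrow> zpoly (dir_deriv v F)"
proof (induction rule: zpoly.induct)
  case (zpoly_const c)
  have "dir_deriv v (\<lambda>z :: complex ^ 'a. c) = (\<lambda>z. 0)" by (rule ext) (rule dir_deriv_const)
  then show ?case by (simp add: zpoly.zpoly_const)
next
  case (zpoly_coord i)
  have "dir_deriv v (coord i) = (\<lambda>z. coord i v)" by (rule ext) (rule dir_deriv_coord)
  then show ?case by (simp add: zpoly_const)
next
  case (zpoly_add F G)
  have "dir_deriv v (\<lambda>z. F z + G z) = (\<lambda>z. dir_deriv v F z + dir_deriv v G z)"
    by (rule ext) (intro dir_deriv_add zpoly_differentiable zpoly_add.hyps)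
  then show ?case using zpoly_add.IH by (simp add: zpoly.zpoly_add)
next
  case (zpoly_mult F G)
  have "dir_deriv v (\<lambda>z. F z * G z) = (\<lambda>z. dir_deriv v F z * G z + F z * dir_deriv v G z)"
    by (rule ext) (intro dir_deriv_mult zpoly_differentiable zpoly_mult.hyps)
  then show ?case using zpoly_mult by (simp add: zpoly.intros)
qed

lemma zpoly_wirt: "zpoly F \<Longrightarrow> zpoly (wirt i F)"
  unfolding wirt_def[abs_def] by (intro zpoly_cmult zpoly_add zpoly_dir_deriv)

lemma wirt_add_fun: "zpoly F \<Longrightarrow> zpoly G \<Longrightarrow> wirt i (\<lambda>z. F z + G z) = (\<lambda>z. wirt i F z + wirt i G z)"
  by (rule ext) (simp add: wirt_add zpoly_differentiable)

lemma wirt_mult_fun: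
  "zpoly F \<Longrightarrow> zpoly G \<Longrightarrow> wirt i (\<lambda>z. F z * G z) = (\<lambda>z. wirt i F z * G z + F z * wirt i G z)"
  by (rule ext) (simp add: wirt_mult zpoly_differentiable)

lemma wirt_coord_fun: "wirt i (coord j) = (\<lambda>z. if i = j then 1 else 0)"
  by (rule ext) (rule wirt_coord)

lemma wirt_const_fun: "wirt i (\<lambda>z. c) = (\<lambda>z. 0)"
  by (rule ext) (rule wirt_const)

text \<open>For polynomials the symmetry of second derivatives is algebraic: it holds for the generators and is
inherited by products through the Leibniz rule.\<close>

lemma wirt_commute: "zpoly F \<Longrightarrow> wirt i (wirt j F) = wirt j (wirt i F)"
proof (induction rule: zpoly.induct)
  case (zpoly_mult F G)
  then show ?case
    by (simp add: wirt_mult_fun wirt_add_fun zpoly_wirt zpoly.zpoly_mult fun_eq_iff algebra_simps)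
qed (simp_all add: wirt_const_fun wirt_coord_fun wirt_add_fun zpoly_wirt)

section \<open>Ladder operators\<close>

text \<open>The Gaussian weight, with values in the complex numbers so that the Wirtinger derivatives apply to it.\<close>

definition wt :: "'n::finite cfun" where
  "wt z = complex_of_real (exp (- real CARD('n) * (norm z)\<^sup>2))"

text \<open>Up to sign, conjugation of \<open>wirt (flip i)\<close> with the Gaussian weight. It is the adjoint of
\<open>wirt i\<close> in the Gaussian space.\<close>

definition raise :: "'n \<times> bool \<Rightarrow> 'n::finite cfun \<Rightarrow> 'n cfun" where
  "raise i F z = of_nat CARD('n) * coord i z * F z - wirt (flip i) F z"

lemma zpoly_raise: "zpoly F \<Longrightarrow> zpoly (raise i F)"
  unfolding raise_def[abs_def] by (intro zpoly_diff zpoly_mult zpoly_const zpoly_coord zpoly_wirt)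

lemma raise_cmult: "zpoly F \<Longrightarrow> raise i (\<lambda>z. a * F z) = (\<lambda>z. a * raise i F z)"
  by (rule ext) (simp add: raise_def wirt_cmult zpoly_differentiable algebra_simps)

text \<open>The canonical commutation relation of creation and annihilation operators.\<close>

lemma wirt_raise:
  fixes F :: "'n::finite cfun"
  assumes "zpoly F"
  shows "wirt k (raise j F) z = raise j (wirt k F) z + (if k = j then of_nat CARD('n) * F z else 0)"
proof -
  note d = zpoly_differentiable zpoly_mult zpoly_const zpoly_coord zpoly_wirt assms zpoly_cmult
  have "wirt k (raise j F) z = wirt k (\<lambda>z. of_nat CARD('n) * (coord j z * F z)) z - wirt k (wirt (flip j) F) z"
    unfolding raise_def[abs_def] mult.assoc by (intro wirt_diff d)
  also have "wirt k (\<lambda>z. of_nat CARD('n) * (coord j z * F z)) z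
     = of_nat CARD('n) * ((if k = j then 1 else 0) * F z + coord j z * wirt k F z)"
    by (subst wirt_cmult) (intro d | subst wirt_mult | simp add: wirt_coord)+
  finally have E: "wirt k (raise j F) z = of_nat CARD('n) * ((if k = j then 1 else 0) * F z + coord j z * wirt k F z)
     - wirt k (wirt (flip j) F) z" .
  have R: "raise j (wirt k F) z = of_nat CARD('n) * coord j z * wirt k F z - wirt (flip j) (wirt k F) z"
    by (rule raise_def)
  show ?thesis unfolding E R wirt_commute[OF assms, of k "flip j"] by (simp add: algebra_simps)
qed

lemma raise_commute:
  fixes F :: "'n::finite cfun"
  assumes "zpoly F"
  shows "raise i (raise j F) = raise j (raise i F)"
proof (rule ext)
  fix z
  have e: "raise i (raise j F) z = of_nat CARD('n) * coord i z *
        (of_nat CARD('n) * coord j z * F z - wirt (flip j) F z)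
      - (of_nat CARD('n) * coord j z * wirt (flip i) F z - wirt (flip j) (wirt (flip i) F) z
         + (if flip i = j then of_nat CARD('n) * F z else 0))" for i j
    unfolding raise_def[of i] wirt_raise[OF assms] by (simp only: raise_def)
  show "raise i (raise j F) z = raise j (raise i F) z"
    unfolding e wirt_commute[OF assms, of "flip i" "flip j"] flip_eq_swap eq_commute[of j]
    by (simp add: algebra_simps)
qed

lemma zpoly_raise_pow: "zpoly F \<Longrightarrow> zpoly ((raise i ^^ a) F)"
  by (induction a) (auto intro: zpoly_raise)

lemma raise_pow_commute: "zpoly F \<Longrightarrow> raise j ((raise i ^^ a) F) = (raise i ^^ a) (raise j F)"
  by (induction a) (simp_all add: raise_commute[of _ j i] zpoly_raise_pow)

text \<open>The iterated operator of \<open>multi_deriv\<close>, for an arbitrary list of indices.\<close>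

definition raise_all :: "('n::finite \<times> bool \<Rightarrow> nat) \<Rightarrow> ('n \<times> bool) list \<Rightarrow> 'n cfun \<Rightarrow> 'n cfun" where
  "raise_all m = foldr (\<lambda>i. raise i ^^ m i)"

lemma zpoly_raise_all: "zpoly F \<Longrightarrow> zpoly (raise_all m is F)"
  by (induction "is") (auto simp: raise_all_def intro: zpoly_raise_pow)

lemma raise_all_cong: "(\<And>i. i \<in> set is \<Longrightarrow> m i = m' i) \<Longrightarrow> raise_all m is = raise_all m' is"
  by (induction "is") (simp_all add: raise_all_def)

lemma raise_all_Cons: "raise_all m (i # is) F = (raise i ^^ m i) (raise_all m is F)"
  by (simp add: raise_all_def)

lemma raise_all_Suc:
  assumes "distinct is" "k \<in> set is" "zpoly F"
  shows "raise_all (m(k := Suc (m k))) is F = raise k (raise_all m is F)"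
  using assms(1,2)
proof (induction "is")
  case (Cons i "is")
  show ?case
  proof (cases "i = k")
    case True
    then have "raise_all (m(k := Suc (m k))) is = raise_all m is"
      using Cons.prems by (intro raise_all_cong) auto
    then show ?thesis using True by (simp add: raise_all_Cons fun_upd_same del: fun_upd_apply)
  next
    case False
    then have "raise_all (m(k := Suc (m k))) is F = raise k (raise_all m is F)"
      using Cons.IH Cons.prems by (simp del: fun_upd_apply)
    moreover have "(m(k := Suc (m k))) i = m i" using False by simp
    ultimately have "raise_all (m(k := Suc (m k))) (i # is) F = (raise i ^^ m i) (raise k (raise_all m is F))"
      by (simp only: raise_all_Cons)
    then show ?thesis by (simp only: raise_all_Cons raise_pow_commute[OF zpoly_raise_all[OF assms(3)]])
  qed
qed simp

definition all_idx :: "('n::{finite,linorder} \<times> bool) list" where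
  "all_idx = map (\<lambda>k. (k, False)) (sorted_list_of_set UNIV) @ map (\<lambda>k. (k, True)) (sorted_list_of_set UNIV)"

lemma all_idx: "distinct all_idx" "i \<in> set all_idx"
  by (cases i, auto simp: all_idx_def distinct_map inj_on_def)+

definition ladder :: "('n::{finite,linorder} \<times> bool \<Rightarrow> nat) \<Rightarrow> 'n cfun" where
  "ladder m = raise_all m all_idx (\<lambda>z. 1)"

lemma zpoly_ladder: "zpoly (ladder m)"
  unfolding ladder_def by (intro zpoly_raise_all zpoly_const)

lemma ladder_0: "ladder (\<lambda>_. 0) = (\<lambda>z. 1)"
proof -
  have "raise_all (\<lambda>_. 0) is F = F" for "is" and F :: "'a cfun"
    by (induction "is") (auto simp: raise_all_def)
  then show ?thesis by (simp add: ladder_def)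
qed

lemma ladder_Suc: "ladder (m(k := Suc (m k))) = raise k (ladder m)"
  unfolding ladder_def by (intro raise_all_Suc all_idx zpoly_const)

text \<open>Induction on the total degree, in the form in which the ladder operators build up multi-indices.\<close>

lemma multi_index_induct [case_names zero Suc]:
  fixes m :: "'i::finite \<Rightarrow> nat"
  assumes "P (\<lambda>_. 0)" "\<And>m k. P m \<Longrightarrow> P (m(k := Suc (m k)))"
  shows "P m"
proof (induction "sum m UNIV" arbitrary: m)
  case 0
  then have "m = (\<lambda>_. 0)" by auto
  then show ?case using assms(1) by simp
next
  case (Suc s)
  then obtain k where k: "m k \<noteq> 0" by (metis nat.distinct(1) sum.neutral)
  let ?m = "m(k := m k - 1)"
  have m: "m = ?m(k := Suc (?m k))" using k by auto
  have "sum m UNIV = Suc (sum ?m UNIV)"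
    using k by (simp add: sum.remove[of UNIV k] )
  then have "P ?m" using Suc by simp
  then show ?case using assms(2)[of ?m k] m by metis
qed

text \<open>Moving the derivative past all raising operators produces one commutator for each factor \<open>raise k\<close>. The
truncated subtraction is harmless, as the factor \<open>m k\<close> is \<open>0\<close> in that case.\<close>

lemma wirt_ladder:
  fixes m :: "'n::{finite,linorder} \<times> bool \<Rightarrow> nat"
  shows "wirt k (ladder m) = (\<lambda>z. of_nat CARD('n) * of_nat (m k) * ladder (m(k := m k - 1)) z)"
proof (induction m rule: multi_index_induct)
  case zero
  show ?case by (rule ext) (simp add: ladder_0 wirt_const)
next
  case (Suc m j)
  have 1: "wirt k (ladder (m(j := Suc (m j)))) z
     = raise j (wirt k (ladder m)) z + (if k = j then of_nat CARD('n) * ladder m z else 0)" for z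
    by (simp add: ladder_Suc wirt_raise zpoly_ladder)
  have 2: "raise j (wirt k (ladder m)) z
     = of_nat CARD('n) * of_nat (m k) * raise j (ladder (m(k := m k - 1))) z" for z
    by (simp only: Suc.IH raise_cmult[OF zpoly_ladder])
  have *: "wirt k (ladder (m(j := Suc (m j)))) z
     = of_nat CARD('n) * of_nat (m k) * ladder ((m(k := m k - 1))(j := Suc ((m(k := m k - 1)) j))) z
       + (if k = j then of_nat CARD('n) * ladder m z else 0)" for z
    unfolding 1 2 by (simp only: ladder_Suc)
  show ?case
  proof (cases "k = j")
    case False
    then have "(m(k := m k - 1))(j := Suc ((m(k := m k - 1)) j)) = (m(j := Suc (m j)))(k := (m(j := Suc (m j))) k - 1)"
      by (auto simp: fun_eq_iff)
    moreover have "(m(j := Suc (m j))) k = m k" using False by simp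
    ultimately show ?thesis using False by (intro ext) (simp add: * del: fun_upd_apply)
  next
    case True
    show ?thesis
    proof (cases "m k")
      case 0
      then have "(m(j := Suc (m j)))(k := (m(j := Suc (m j))) k - 1) = m" using True by (auto simp: fun_eq_iff)
      moreover have "(m(j := Suc (m j))) k = Suc (m k)" using True by simp
      ultimately show ?thesis by (simp only:) (rule ext, subst *, use True 0 in simp)
    next
      case (Suc l)
      then have e1: "(m(k := m k - 1))(j := Suc ((m(k := m k - 1)) j)) = m"
        and e2: "(m(j := Suc (m j)))(k := (m(j := Suc (m j))) k - 1) = m"
        and e3: "(m(j := Suc (m j))) k = Suc (m k)"
        using True by (auto simp: fun_eq_iff)
      show ?thesis unfolding e2 e3
        by (rule ext, subst *, subst e1) (use True in \<open>simp add: algebra_simps\<close>)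
    qed
  qed
qed

section \<open>Identification of the Hermite polynomials\<close>

lemma wt_has_derivative:
  fixes z :: "complex ^ 'n::finite"
  shows "(wt has_derivative (\<lambda>v. wt z * complex_of_real (- real CARD('n) * (2 * (z \<bullet> v))))) (at z)"
proof -
  have "((\<lambda>z :: complex ^ 'n. exp (- real CARD('n) * (z \<bullet> z))) has_derivative
      (\<lambda>v. exp (- real CARD('n) * (z \<bullet> z)) * (- real CARD('n) * (2 * (z \<bullet> v))))) (at z)"
    by (auto intro!: derivative_eq_intros simp: inner_commute algebra_simps)
  from has_derivative_of_real[OF this] show ?thesis
    by (simp add: wt_def[abs_def] power2_norm_eq_inner)
qed

lemma wt_differentiable: "wt differentiable at z"
  using wt_has_derivative differentiableI by blast

lemma wirt_wt:
  fixes z :: "complex ^ 'n::finite"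
  shows "wirt i wt z = - of_nat CARD('n) * coord (flip i) z * wt z"
proof -
  have "z \<bullet> axis k 1 = Re (z $ k)" "z \<bullet> axis k \<i> = Im (z $ k)" for k
    by (simp_all add: inner_axis inner_complex_def)
  then show ?thesis
    by (simp add: wirt_def dir_deriv_eq[OF wt_has_derivative] coord_def flip_def complex_eq_iff algebra_simps)
qed

lemma wirt_mult_wt:
  assumes "zpoly F"
  shows "wirt i (\<lambda>z. F z * wt z) = (\<lambda>z. (-1 * raise (flip i) F z) * wt z)"
  by (rule ext) (simp add: wirt_mult zpoly_differentiable[OF assms] wt_differentiable wirt_wt raise_def algebra_simps)

lemma wirt_pow_mult_wt:
  "zpoly F \<Longrightarrow> (wirt i ^^ a) (\<lambda>z. F z * wt z) = (\<lambda>z. ((-1) ^ a * (raise (flip i) ^^ a) F z) * wt z)"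
proof (induction a)
  case (Suc a)
  have "(wirt i ^^ Suc a) (\<lambda>z. F z * wt z) = wirt i (\<lambda>z. ((-1) ^ a * (raise (flip i) ^^ a) F z) * wt z)"
    by (simp add: Suc)
  also have "\<dots> = (\<lambda>z. (-1 * raise (flip i) (\<lambda>z. (-1) ^ a * (raise (flip i) ^^ a) F z) z) * wt z)"
    by (intro wirt_mult_wt zpoly_cmult zpoly_raise_pow Suc.prems)
  also have "\<dots> = (\<lambda>z. (-1 * ((-1) ^ a * raise (flip i) ((raise (flip i) ^^ a) F) z)) * wt z)"
    by (simp only: raise_cmult[OF zpoly_raise_pow[OF Suc.prems]])
  finally show ?case by simp
qed simp

lemma raise_pow_cmult: "zpoly F \<Longrightarrow> (raise i ^^ a) (\<lambda>z. b * F z) = (\<lambda>z. b * (raise i ^^ a) F z)"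
  by (induction a) (simp_all add: raise_cmult zpoly_raise_pow)

text \<open>Each derivative that passes the Gaussian weight becomes minus a raising operator.\<close>

lemma foldr_wirt_wt:
  assumes "zpoly F"
  shows "foldr (\<lambda>k. wirt (k, b) ^^ (p $ k)) ks (\<lambda>z. F z * wt z)
    = (\<lambda>z. (-1) ^ (\<Sum>k\<leftarrow>ks. p $ k) * foldr (\<lambda>k. raise (k, \<not> b) ^^ (p $ k)) ks F z * wt z)"
proof (induction ks)
  case (Cons k ks)
  have zp: "zpoly (foldr (\<lambda>k. raise (k, \<not> b) ^^ (p $ k)) ks F)"
    by (induction ks) (auto intro: zpoly_raise_pow assms)
  have "foldr (\<lambda>k. wirt (k, b) ^^ (p $ k)) (k # ks) (\<lambda>z. F z * wt z)
      = (wirt (k, b) ^^ (p $ k)) (\<lambda>z. ((-1) ^ (\<Sum>k\<leftarrow>ks. p $ k) * foldr (\<lambda>k. raise (k, \<not> b) ^^ (p $ k)) ks F z) * wt z)"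
    by (simp add: Cons.IH)
  also have "\<dots> = (\<lambda>z. ((-1) ^ (p $ k) * ((-1) ^ (\<Sum>k\<leftarrow>ks. p $ k) *
      (raise (flip (k, b)) ^^ (p $ k)) (foldr (\<lambda>k. raise (k, \<not> b) ^^ (p $ k)) ks F) z)) * wt z)"
    by (simp only: wirt_pow_mult_wt[OF zpoly_cmult[OF zp]] raise_pow_cmult[OF zp])
  finally show ?case by (simp add: flip_def power_add algebra_simps)
qed simp

definition join_idx :: "nat ^ 'n \<Rightarrow> nat ^ 'n \<Rightarrow> 'n \<times> bool \<Rightarrow> nat" where
  "join_idx p q i = (if snd i then q $ fst i else p $ fst i)"

text \<open>The squared norm of \<open>ladder m\<close> in the Gaussian space.\<close>

definition idx_weight :: "('n::finite \<times> bool \<Rightarrow> nat) \<Rightarrow> real" where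
  "idx_weight m = (\<Prod>i\<in>UNIV. fact (m i) * real CARD('n) ^ m i)"

lemma idx_weight_pos: "idx_weight m > 0"
  unfolding idx_weight_def by (intro prod_pos) auto

lemma UNIV_idx_prod:
  fixes f :: "'n::finite \<times> bool \<Rightarrow> 'a::comm_monoid_mult"
  shows "(\<Prod>i\<in>UNIV. f i) = (\<Prod>k\<in>UNIV. f (k, False)) * (\<Prod>k\<in>UNIV. f (k, True))"
proof -
  have "(\<Prod>i\<in>UNIV. f i) = (\<Prod>k\<in>UNIV. \<Prod>b\<in>UNIV. f (k, b))"
    by (simp add: prod.cartesian_product UNIV_Times_UNIV[symmetric] del: UNIV_Times_UNIV)
  then show ?thesis by (simp add: UNIV_bool prod.distrib)
qed

lemma hermite_eq_ladder:
  fixes p q :: "nat ^ 'n::{finite,linorder}"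
  shows "hermite p q = (\<lambda>z. complex_of_real (1 / sqrt (idx_weight (join_idx p q))) * ladder (join_idx p q) z)"
proof
  fix z :: "complex ^ 'n::{finite,linorder}"
  define ks where "ks = sorted_list_of_set (UNIV :: 'n::{finite,linorder} set)"
  have ks: "(\<Sum>k\<leftarrow>ks. p $ k) = mi_abs p" for p :: "nat ^ 'n::{finite,linorder}"
    unfolding ks_def mi_abs_def by (subst sum_list_distinct_conv_sum_set) auto
  let ?c = "real CARD('n)"
  have md: "multi_deriv d_z q wt = (\<lambda>z. (-1) ^ mi_abs q * foldr (\<lambda>k. raise (k, True) ^^ (q $ k)) ks (\<lambda>z. 1) z * wt z)"
    using foldr_wirt_wt[OF zpoly_const[of 1], where b = False and p = q and ks = ks]
    by (simp add: multi_deriv_def wirt_False ks ks_def[symmetric])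
  define Q where "Q = foldr (\<lambda>k. raise (k, True) ^^ (q $ k)) ks (\<lambda>z. 1)"
  have Q: "zpoly Q" unfolding Q_def by (induction ks) (auto intro: zpoly_raise_pow zpoly_const)
  have Qp: "zpoly (foldr (\<lambda>k. raise (k, False) ^^ (p $ k)) ks Q)"
    by (induction ks) (auto intro: zpoly_raise_pow Q)
  have cm: "foldr (\<lambda>k. raise (k, False) ^^ (p $ k)) ks (\<lambda>z. a * Q z)
      = (\<lambda>z. a * foldr (\<lambda>k. raise (k, False) ^^ (p $ k)) ks Q z)" for a
  proof (induction ks)
    case (Cons k ks)
    have "zpoly (foldr (\<lambda>k. raise (k, False) ^^ (p $ k)) ks Q)"
      by (induction ks) (auto intro: zpoly_raise_pow Q)
    then show ?case by (simp add: Cons.IH raise_pow_cmult)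
  qed simp
  have "multi_deriv d_zbar p (multi_deriv d_z q wt) z
     = (-1) ^ mi_abs p * ((-1) ^ mi_abs q * foldr (\<lambda>k. raise (k, False) ^^ (p $ k)) ks Q z) * wt z"
    unfolding md Q_def[symmetric]
    using foldr_wirt_wt[OF zpoly_cmult[OF Q, of "(-1) ^ mi_abs q"], where b = True and p = p and ks = ks]
    by (simp add: multi_deriv_def wirt_True ks ks_def[symmetric] cm)
  also have "foldr (\<lambda>k. raise (k, False) ^^ (p $ k)) ks Q = ladder (join_idx p q)"
    unfolding ladder_def raise_all_def all_idx_def ks_def[symmetric] Q_def
    by (simp add: foldr_map o_def join_idx_def)
  finally have 1: "multi_deriv d_zbar p (multi_deriv d_z q wt) z
     = (-1) ^ (mi_abs p + mi_abs q) * ladder (join_idx p q) z * wt z" by (simp add: power_add)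
  have 2: "idx_weight (join_idx p q) = real (mi_fact p * mi_fact q) * ?c ^ (mi_abs p + mi_abs q)"
    by (simp add: idx_weight_def UNIV_idx_prod join_idx_def mi_fact_def mi_abs_def prod.distrib power_add
        power_sum)
  have 3: "sqrt (?c ^ a) = ?c powr (real a / 2)" for a :: nat
    by (simp add: powr_half_sqrt[symmetric] powr_realpow[symmetric] powr_powr)
  have 4: "exp (?c * (norm z)\<^sup>2) * exp (- ?c * (norm z)\<^sup>2) = 1"
    by (simp add: exp_add[symmetric])
  have w: "(\<lambda>w :: complex ^ 'n::{finite,linorder}. complex_of_real (exp (- ?c * (norm w)\<^sup>2))) = wt"
    by (rule ext) (simp add: wt_def)
  have s: "(-1) ^ (mi_abs p + mi_abs q) * (-1) ^ (mi_abs p + mi_abs q) = (1::complex)"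
    by (simp add: power_add[symmetric] mult_2[symmetric])
  have "hermite p q z = complex_of_real (1 / (sqrt (real (mi_fact p * mi_fact q)) * ?c powr (real (mi_abs p + mi_abs q) / 2)))
     * ((-1) ^ (mi_abs p + mi_abs q) * (-1) ^ (mi_abs p + mi_abs q))
     * complex_of_real (exp (?c * (norm z)\<^sup>2) * exp (- ?c * (norm z)\<^sup>2)) * ladder (join_idx p q) z"
    unfolding hermite_def w 1 by (simp add: wt_def)
  then show "hermite p q z = complex_of_real (1 / sqrt (idx_weight (join_idx p q))) * ladder (join_idx p q) z"
    unfolding 4 s 2 real_sqrt_mult 3 by simp
qed

section \<open>Growth conditions\<close>

text \<open>Bounds by Gaussians serve as integrability criterion: exponents add under products, and
polynomials satisfy the bound for every positive exponent.\<close>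

definition growth :: "real \<Rightarrow> ('a::real_normed_vector \<Rightarrow> 'b::real_normed_vector) \<Rightarrow> bool" where
  "growth \<delta> F \<longleftrightarrow> (\<exists>C. \<forall>z. norm (F z) \<le> C * exp (\<delta> * (norm z)\<^sup>2))"

lemma growthE:
  assumes "growth \<delta> F"
  obtains C where "C \<ge> 0" "\<And>z. norm (F z) \<le> C * exp (\<delta> * (norm z)\<^sup>2)"
proof -
  obtain C where C: "\<And>z. norm (F z) \<le> C * exp (\<delta> * (norm z)\<^sup>2)" using assms by (auto simp: growth_def)
  have "0 \<le> C * exp (\<delta> * (norm (0::'a))\<^sup>2)" using C[of 0] norm_ge_zero order_trans by blast
  then have "C \<ge> 0" by simp
  then show ?thesis using C by (rule that)
qed

lemma growth_add:
  assumes "growth \<delta> F" "growth \<delta> G"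
  shows "growth \<delta> (\<lambda>z. F z + G z)"
proof -
  obtain C D where "\<And>z. norm (F z) \<le> C * exp (\<delta> * (norm z)\<^sup>2)" "\<And>z. norm (G z) \<le> D * exp (\<delta> * (norm z)\<^sup>2)"
    using assms by (auto simp: growth_def)
  then have "norm (F z + G z) \<le> (C + D) * exp (\<delta> * (norm z)\<^sup>2)" for z
    by (metis norm_triangle_mono distrib_right)
  then show ?thesis by (auto simp: growth_def)
qed

lemma growth_mult:
  fixes F G :: "'a::real_normed_vector \<Rightarrow> 'b::real_normed_field"
  assumes "growth \<delta> F" "growth \<epsilon> G"
  shows "growth (\<delta> + \<epsilon>) (\<lambda>z. F z * G z)"
proof -
  obtain C where C: "C \<ge> 0" "\<And>z. norm (F z) \<le> C * exp (\<delta> * (norm z)\<^sup>2)"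
    using growthE[OF assms(1)] by blast
  obtain D where D: "D \<ge> 0" "\<And>z. norm (G z) \<le> D * exp (\<epsilon> * (norm z)\<^sup>2)"
    using growthE[OF assms(2)] by blast
  have "norm (F z * G z) \<le> (C * D) * exp ((\<delta> + \<epsilon>) * (norm z)\<^sup>2)" for z
  proof -
    have "norm (F z * G z) \<le> (C * exp (\<delta> * (norm z)\<^sup>2)) * (D * exp (\<epsilon> * (norm z)\<^sup>2))"
      unfolding norm_mult using C D by (intro mult_mono) auto
    then show ?thesis by (simp add: distrib_right exp_add algebra_simps)
  qed
  then show ?thesis unfolding growth_def by blast
qed

lemma growth_mono: "growth \<delta> F \<Longrightarrow> \<delta> \<le> \<epsilon> \<Longrightarrow> growth \<epsilon> F"
proof -
  assume "growth \<delta> F" and le: "\<delta> \<le> \<epsilon>"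
  then obtain C where C: "C \<ge> 0" "\<And>z. norm (F z) \<le> C * exp (\<delta> * (norm z)\<^sup>2)" using growthE by blast
  have "C * exp (\<delta> * (norm z)\<^sup>2) \<le> C * exp (\<epsilon> * (norm z)\<^sup>2)" for z :: 'a
    using C(1) le by (intro mult_left_mono) (auto intro: mult_right_mono)
  then show ?thesis unfolding growth_def using C(2) order_trans by blast
qed

lemma growth_bounded:
  assumes "\<And>z. norm (F z) \<le> B" "\<delta> \<ge> 0"
  shows "growth \<delta> F"
proof -
  have "B \<ge> 0" using assms(1)[of undefined] norm_ge_zero order_trans by blast
  then have "B * 1 \<le> B * exp (\<delta> * (norm z)\<^sup>2)" for z :: 'a
    using assms(2) by (intro mult_left_mono) auto
  then show ?thesis unfolding growth_def using assms(1) by (metis mult.right_neutral order_trans)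
qed

lemma growth_const: "\<delta> \<ge> 0 \<Longrightarrow> growth \<delta> (\<lambda>z. c)"
  by (rule growth_bounded[of _ "norm c"]) auto

lemma growth_cmult:
  fixes F :: "'a::real_normed_vector \<Rightarrow> 'b::real_normed_field"
  shows "growth \<delta> F \<Longrightarrow> growth \<delta> (\<lambda>z. c * F z)"
  using growth_mult[OF growth_const[of 0 c], of \<delta> F] by simp

lemma growth_le: "growth \<delta> F \<Longrightarrow> (\<And>z. norm (G z) \<le> norm (F z)) \<Longrightarrow> growth \<delta> G"
  unfolding growth_def by (meson order_trans)

lemma growth_cnj: "growth \<delta> F \<Longrightarrow> growth \<delta> (\<lambda>z. cnj (F z))"
  by (rule growth_le) auto

lemma growth_linear:
  assumes "\<delta> > 0" "\<And>z. norm (F z) \<le> K * norm z"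
  shows "growth \<delta> F"
proof -
  have "norm (F z) \<le> (\<bar>K\<bar> * (1 + 1 / \<delta>)) * exp (\<delta> * (norm z)\<^sup>2)" for z
  proof -
    have n: "norm z \<le> 1 + (norm z)\<^sup>2"
    proof -
      have "2 * 1 * norm z \<le> 1\<^sup>2 + (norm z)\<^sup>2" by (rule sum_squares_bound)
      then show ?thesis using norm_ge_zero[of z] unfolding power_one mult_1_right by linarith
    qed
    have "norm (F z) \<le> \<bar>K\<bar> * norm z"
      using assms(2)[of z] by (meson abs_ge_self mult_right_mono norm_ge_zero order_trans)
    also have "\<dots> \<le> \<bar>K\<bar> * (1 + (norm z)\<^sup>2)" using n by (intro mult_left_mono) auto
    also have "1 + (norm z)\<^sup>2 \<le> (1 + 1 / \<delta>) * (1 + \<delta> * (norm z)\<^sup>2)"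
      using assms(1) by (simp add: field_simps)
    also have "\<dots> \<le> (1 + 1 / \<delta>) * exp (\<delta> * (norm z)\<^sup>2)"
      using assms(1) by (intro mult_left_mono exp_ge_add_one_self) auto
    finally show ?thesis by (simp add: mult_left_mono mult.assoc)
  qed
  then show ?thesis unfolding growth_def by blast
qed

lemma zpoly_growth: "zpoly F \<Longrightarrow> \<delta> > 0 \<Longrightarrow> growth \<delta> F"
proof (induction arbitrary: \<delta> rule: zpoly.induct)
  case (zpoly_const c)
  then show ?case by (intro growth_const) simp
next
  case (zpoly_coord i)
  have "cmod (coord i z) \<le> 1 * norm z" for z :: "complex ^ 'a"
    by (simp add: coord_def Finite_Cartesian_Product.norm_nth_le)
  then show ?case by (rule growth_linear[OF zpoly_coord])
next
  case (zpoly_add F G)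
  then show ?case by (intro growth_add) auto
next
  case (zpoly_mult F G)
  then show ?case using growth_mult[of "\<delta> / 2" F "\<delta> / 2" G] by simp
qed

section \<open>The Gaussian measure\<close>

definition gdens :: "complex ^ 'n \<Rightarrow> real" where
  "gdens z = (real CARD('n) / pi) ^ CARD('n) * exp (- real CARD('n) * (norm z)\<^sup>2)"

lemma gamma_n_density: "gamma_n = density lborel (\<lambda>z. ennreal (gdens z))"
  by (simp add: gamma_n_def gdens_def)

lemma gdens_pos: "gdens (z :: complex ^ 'n::finite) > 0"
  by (simp add: gdens_def)

lemma gdens_measurable [measurable]: "gdens \<in> borel_measurable borel"
  unfolding gdens_def[abs_def] by measurable

lemma sets_gamma_n [measurable_cong, simp]: "sets gamma_n = sets borel"
  by (simp add: gamma_n_density)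

lemma space_gamma_n [simp]: "space gamma_n = UNIV"
  by (simp add: gamma_n_density)

lemma measurable_gamma_n [simp]: "borel_measurable gamma_n = borel_measurable borel"
  by (rule measurable_cong_sets) auto

lemma AE_gamma_n: "(AE z in (gamma_n :: (complex ^ 'n::finite) measure). P z) \<longleftrightarrow> (AE z in lborel. P z)"
  unfolding gamma_n_density by (subst AE_density) (auto simp: gdens_pos)

lemma gdens_wt:
  "complex_of_real (gdens z) = complex_of_real ((real CARD('n) / pi) ^ CARD('n)) * wt z"
  for z :: "complex ^ 'n::finite"
  by (simp add: gdens_def wt_def)

lemma integrable_gamma_n:
  fixes F :: "complex ^ 'n::finite \<Rightarrow> 'b::{banach, second_countable_topology}"
  assumes [measurable]: "F \<in> borel_measurable borel"
  shows "integrable gamma_n F \<longleftrightarrow> integrable lborel (\<lambda>z. gdens z *\<^sub>R F z)"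
  unfolding gamma_n_density by (subst integrable_density) (auto simp: gdens_pos less_imp_le)

lemma integral_gamma_n:
  fixes F :: "complex ^ 'n::finite \<Rightarrow> 'b::{banach, second_countable_topology}"
  assumes [measurable]: "F \<in> borel_measurable borel"
  shows "(\<integral>z. F z \<partial>gamma_n) = (\<integral>z. gdens z *\<^sub>R F z \<partial>lborel)"
  unfolding gamma_n_density by (subst integral_density) (auto simp: gdens_pos less_imp_le)

lemma growth_integrable_lborel:
  fixes F :: "'a::euclidean_space \<Rightarrow> 'b::{banach, second_countable_topology}"
  assumes "F \<in> borel_measurable borel" "growth \<delta> F" "\<delta> < 0"
  shows "integrable lborel F"
proof -
  obtain C where C: "C \<ge> 0" "\<And>z. norm (F z) \<le> C * exp (\<delta> * (norm z)\<^sup>2)" using growthE[OF assms(2)] by blast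
  have "integrable lborel (\<lambda>z :: 'a. C * exp (\<delta> * (norm z)\<^sup>2))"
    using integrable_gaussian[of "- \<delta>", where 'a = 'a] assms(3) by simp
  then show ?thesis
    by (rule Bochner_Integration.integrable_bound) (use assms(1) C order_trans abs_ge_self in \<open>auto intro!: AE_I2\<close>)
qed

lemma growth_gdens: "growth (- real CARD('n)) (gdens :: complex ^ 'n::finite \<Rightarrow> real)"
  unfolding growth_def by (rule exI[of _ "(real CARD('n) / pi) ^ CARD('n)"]) (simp add: gdens_def)

lemma growth_integrable_gamma:
  fixes F :: "complex ^ 'n::finite \<Rightarrow> 'b::{banach, second_countable_topology}"
  assumes m [measurable]: "F \<in> borel_measurable borel" and g: "growth \<delta> F" and d: "\<delta> < real CARD('n)"
  shows "integrable gamma_n F"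
  unfolding integrable_gamma_n[OF m]
proof (rule growth_integrable_lborel[of _ "- real CARD('n) + \<delta>"])
  have "growth \<delta> (\<lambda>z. norm (F z))" using g by (rule growth_le) simp
  from growth_mult[OF growth_gdens this] show "growth (- real CARD('n) + \<delta>) (\<lambda>z. gdens z *\<^sub>R F z)"
    by (rule growth_le) (simp add: abs_mult)
qed (use d in auto)

lemma growth_L2_gamma:
  fixes F :: "'n::finite cfun"
  assumes m [measurable]: "F \<in> borel_measurable borel" and g: "growth \<delta> F" and d: "2 * \<delta> < real CARD('n)"
  shows "F \<in> L2 gamma_n"
proof -
  have "growth (\<delta> + \<delta>) (\<lambda>z. F z * F z)" by (rule growth_mult[OF g g])
  then have "growth (\<delta> + \<delta>) (\<lambda>z. (cmod (F z))\<^sup>2)"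
    by (rule growth_le) (simp add: norm_mult power2_eq_square)
  then have "integrable gamma_n (\<lambda>z. (cmod (F z))\<^sup>2)"
    using d by (intro growth_integrable_gamma[of _ "\<delta> + \<delta>"]) auto
  then show ?thesis by (simp add: L2_def)
qed

lemma zpoly_L2_gamma:
  fixes F :: "'n::finite cfun"
  assumes "zpoly F"
  shows "F \<in> L2 gamma_n"
proof (rule growth_L2_gamma[where \<delta> = "1 / 4"])
  have "real CARD('n) \<ge> 1" by (simp add: Suc_leI)
  then show "2 * (1 / 4) < real CARD('n)" by linarith
qed (use zpoly_growth[OF assms, of "1 / 4"] zpoly_measurable[OF assms] in auto)

lemma prob_space_gamma_n: "prob_space (gamma_n :: (complex ^ 'n::finite) measure)"
proof
  let ?c = "real CARD('n)"
  have "emeasure (gamma_n :: (complex ^ 'n) measure) UNIV = (\<integral>\<^sup>+z. ennreal (gdens z) \<partial>(lborel :: (complex ^ 'n) measure))"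
    unfolding gamma_n_density by (subst emeasure_density) auto
  also have "\<dots> = (\<integral>\<^sup>+z. ennreal ((?c / pi) ^ CARD('n)) * ennreal (exp (- ?c * (norm z)\<^sup>2)) \<partial>(lborel :: (complex ^ 'n) measure))"
    by (simp add: gdens_def ennreal_mult)
  also have "\<dots> = ennreal ((?c / pi) ^ CARD('n)) * ennreal (sqrt (pi / ?c) ^ DIM(complex ^ 'n))"
    using nn_integral_gaussian[of ?c, where 'a = "complex ^ 'n"] by (subst nn_integral_cmult) auto
  also have "\<dots> = ennreal ((?c / pi) ^ CARD('n) * sqrt (pi / ?c) ^ DIM(complex ^ 'n))"
    by (simp add: ennreal_mult)
  also have "(?c / pi) ^ CARD('n) * sqrt (pi / ?c) ^ DIM(complex ^ 'n) = 1"
  proof -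
    have "sqrt (pi / ?c) ^ DIM(complex ^ 'n) = (sqrt (pi / ?c) ^ 2) ^ CARD('n)"
      by (simp only: DIM_cart DIM_complex power_mult[symmetric]) (simp add: mult.commute)
    also have "sqrt (pi / ?c) ^ 2 = pi / ?c" by (rule real_sqrt_pow2) simp
    finally show ?thesis by (simp add: power_mult_distrib[symmetric])
  qed
  finally show "emeasure gamma_n (space (gamma_n :: (complex ^ 'n) measure)) = 1" by simp
qed

section \<open>The ladder operators are adjoint to the derivatives\<close>

text \<open>What integration by parts requires of each factor. The class is closed under products, with exponents
adding up, so that the integrand only has to end up with a negative exponent.\<close>

definition tame :: "real \<Rightarrow> 'n::finite cfun \<Rightarrow> bool" where
  "tame \<delta> F \<longleftrightarrow> (\<forall>z. F differentiable at z) \<and> (\<forall>v. continuous_on UNIV (dir_deriv v F))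
     \<and> growth \<delta> F \<and> (\<forall>v. growth \<delta> (dir_deriv v F))"

lemma tame_differentiable: "tame \<delta> F \<Longrightarrow> F differentiable at z" by (simp add: tame_def)
lemma tame_growth: "tame \<delta> F \<Longrightarrow> growth \<delta> F" by (simp add: tame_def)

lemma tame_continuous: "tame \<delta> F \<Longrightarrow> continuous_on UNIV F"
  unfolding tame_def by (meson continuous_at_imp_continuous_on differentiable_imp_continuous_within)

lemma tame_measurable: "tame \<delta> F \<Longrightarrow> F \<in> borel_measurable borel"
  by (rule borel_measurable_continuous_onI[OF tame_continuous])

lemma zpoly_tame: "zpoly F \<Longrightarrow> \<delta> > 0 \<Longrightarrow> tame \<delta> F"
  by (simp add: tame_def zpoly_differentiable zpoly_growth zpoly_dir_deriv zpoly_continuous)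

lemma tame_mono: "tame \<delta> F \<Longrightarrow> \<delta> \<le> \<epsilon> \<Longrightarrow> tame \<epsilon> F"
  unfolding tame_def using growth_mono by blast

lemma tame_mult:
  assumes F: "tame \<delta> F" and G: "tame \<epsilon> G"
  shows "tame (\<delta> + \<epsilon>) (\<lambda>z. F z * G z)"
proof -
  have d: "dir_deriv v (\<lambda>z. F z * G z) = (\<lambda>z. dir_deriv v F z * G z + F z * dir_deriv v G z)" for v
    by (rule ext) (intro dir_deriv_mult tame_differentiable[OF F] tame_differentiable[OF G])
  show ?thesis
    unfolding tame_def d using assms tame_continuous[OF F] tame_continuous[OF G]
    by (auto simp: tame_def intro!: differentiable_mult continuous_on_add continuous_on_mult growth_add growth_mult)
qed

lemma tame_add:
  assumes F: "tame \<delta> F" and G: "tame \<delta> G"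
  shows "tame \<delta> (\<lambda>z. F z + G z)"
proof -
  have d: "dir_deriv v (\<lambda>z. F z + G z) = (\<lambda>z. dir_deriv v F z + dir_deriv v G z)" for v
    by (rule ext) (intro dir_deriv_add tame_differentiable[OF F] tame_differentiable[OF G])
  show ?thesis
    unfolding tame_def d using assms
    by (auto simp: tame_def intro!: differentiable_add continuous_on_add growth_add)
qed

lemma tame_cmult:
  assumes F: "tame \<delta> F"
  shows "tame \<delta> (\<lambda>z. c * F z)"
proof -
  have d: "dir_deriv v (\<lambda>z. c * F z) = (\<lambda>z. c * dir_deriv v F z)" for v
    by (rule ext) (simp add: dir_deriv_mult tame_differentiable[OF F] dir_deriv_const)
  show ?thesis
    unfolding tame_def d using assms
    by (auto simp: tame_def intro!: differentiable_mult continuous_on_mult growth_cmult)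
qed

lemma tame_wt:
  assumes "\<epsilon> > 0"
  shows "tame (- real CARD('n) + \<epsilon>) (wt :: 'n::finite cfun)"
proof -
  have w: "growth (- real CARD('n)) (wt :: 'n cfun)"
    unfolding growth_def by (rule exI[of _ 1]) (simp add: wt_def)
  have c: "continuous_on UNIV (wt :: 'n cfun)"
    by (meson continuous_at_imp_continuous_on differentiable_imp_continuous_within wt_differentiable)
  have d: "dir_deriv v wt = (\<lambda>z. wt z * complex_of_real (- real CARD('n) * (2 * (z \<bullet> v))))"
    for v :: "complex ^ 'n"
    by (rule ext) (rule dir_deriv_eq[OF wt_has_derivative])
  have l: "growth \<epsilon> (\<lambda>z. complex_of_real (- real CARD('n) * (2 * (z \<bullet> v))))" for v :: "complex ^ 'n"
  proof (rule growth_linear[OF assms])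
    fix z
    show "cmod (complex_of_real (- real CARD('n) * (2 * (z \<bullet> v)))) \<le> (real CARD('n) * 2 * norm v) * norm z"
      using Cauchy_Schwarz_ineq2[of z v] unfolding norm_of_real
      by (simp add: abs_mult mult.commute mult.left_commute)
  qed
  show ?thesis
    unfolding tame_def d using assms
    by (intro conjI allI wt_differentiable growth_mult[OF w l] growth_mono[OF w] continuous_intros c) auto
qed

lemma tame_cnj:
  assumes F: "tame \<delta> F"
  shows "tame \<delta> (\<lambda>z. cnj (F z))"
proof -
  have d: "dir_deriv v (\<lambda>z. cnj (F z)) = (\<lambda>z. cnj (dir_deriv v F z))" for v
    by (rule ext) (intro dir_deriv_cnj tame_differentiable[OF F])
  show ?thesis
    unfolding tame_def d using assms
    by (auto simp: tame_def intro!: differentiable_cnj continuous_on_cnj growth_cnj)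
qed

lemma tame_wirt: "tame \<delta> F \<Longrightarrow> growth \<delta> (wirt i F)" "tame \<delta> F \<Longrightarrow> wirt i F \<in> borel_measurable borel"
proof -
  assume F: "tame \<delta> F"
  show "growth \<delta> (wirt i F)"
    unfolding wirt_def[abs_def] using F by (intro growth_cmult growth_add) (auto simp: tame_def)
  show "wirt i F \<in> borel_measurable borel"
    unfolding wirt_def[abs_def] using F
    by (intro borel_measurable_continuous_onI continuous_intros) (auto simp: tame_def)
qed

lemma integral_wirt_eq_0:
  assumes F: "tame \<delta> F" and d: "\<delta> < 0"
  shows "(\<integral>z. wirt i F z \<partial>lborel) = 0"
proof -
  have I: "integrable lborel (dir_deriv v F)" for v
    using F d by (intro growth_integrable_lborel[of _ \<delta>] borel_measurable_continuous_onI) (auto simp: tame_def)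
  have 0: "(\<integral>z. dir_deriv v F z \<partial>lborel) = 0" for v
    by (rule integral_directional_derivative_eq_0[where G = F])
      (use F d I tame_measurable[OF F] in \<open>auto simp: tame_def intro!: has_dir_deriv growth_integrable_lborel[of F \<delta>]\<close>)
  show ?thesis unfolding wirt_def using I by (simp add: 0)
qed

text \<open>Since the derivative of \<open>\<phi> cnj \<psi> exp (- n |z|^2)\<close> integrates to zero, the derivative can be moved to \<open>\<psi>\<close>
and to the weight, and together these two terms form the raising operator.\<close>

lemma wirt_adjoint:
  fixes \<phi> \<psi> :: "'n::finite cfun"
  assumes \<phi>: "tame \<delta> \<phi>" and \<psi>: "zpoly \<psi>" and \<delta>: "\<delta> < real CARD('n)"
  shows "L2_inner gamma_n (wirt i \<phi>) \<psi> = L2_inner gamma_n \<phi> (raise i \<psi>)"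
proof -
  \<comment> \<open>the exponents of \<open>\<psi>\<close> and of the weight each cost an \<open>\<epsilon>\<close>, which leaves a negative total\<close>
  define \<epsilon> where "\<epsilon> = (real CARD('n) - \<delta>) / 4"
  have \<epsilon>: "\<epsilon> > 0" using \<delta> by (simp add: \<epsilon>_def)
  let ?P = "\<lambda>z. \<phi> z * cnj (\<psi> z) * wt z"
  have tP: "tame (\<delta> + \<epsilon> + (- real CARD('n) + \<epsilon>)) ?P"
    by (intro tame_mult \<phi> tame_cnj zpoly_tame[OF \<psi>] tame_wt \<epsilon>)
  have "\<delta> + \<epsilon> + (- real CARD('n) + \<epsilon>) < 0" using \<delta> by (simp add: \<epsilon>_def field_simps)
  from integral_wirt_eq_0[OF tP this] have 0: "(\<integral>z. wirt i ?P z \<partial>lborel) = 0" .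
  have wP: "wirt i ?P z = (wirt i \<phi> z * cnj (\<psi> z) - \<phi> z * cnj (raise i \<psi> z)) * wt z" for z
    by (simp add: wirt_mult tame_differentiable[OF \<phi>] zpoly_differentiable[OF \<psi>] wt_differentiable
        differentiable_cnj wirt_wt wirt_cnj raise_def cnj_coord algebra_simps)
  let ?A = "\<lambda>z. wirt i \<phi> z * cnj (\<psi> z)" and ?B = "\<lambda>z. \<phi> z * cnj (raise i \<psi> z)"
  have m [measurable]: "wirt i \<phi> \<in> borel_measurable borel" "\<phi> \<in> borel_measurable borel"
    "\<psi> \<in> borel_measurable borel" "raise i \<psi> \<in> borel_measurable borel"
    using tame_wirt(2)[OF \<phi>] tame_measurable[OF \<phi>] zpoly_measurable[OF \<psi>]
      zpoly_measurable[OF zpoly_raise[OF \<psi>]] by auto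
  have g: "growth \<epsilon> (\<lambda>z. cnj (F z))" if "zpoly F" for F :: "'n cfun"
    using zpoly_growth[OF that \<epsilon>] by (rule growth_le) simp
  have lt: "\<delta> + \<epsilon> < real CARD('n)" using \<delta> by (simp add: \<epsilon>_def field_simps)
  have IA: "integrable gamma_n ?A"
    by (rule growth_integrable_gamma[OF _ growth_mult[OF tame_wirt(1)[OF \<phi>] g[OF \<psi>]] lt]) measurable
  have IB: "integrable gamma_n ?B"
    by (rule growth_integrable_gamma[OF _ growth_mult[OF tame_growth[OF \<phi>] g[OF zpoly_raise[OF \<psi>]]] lt]) measurable
  have "L2_inner gamma_n (wirt i \<phi>) \<psi> - L2_inner gamma_n \<phi> (raise i \<psi>) = (\<integral>z. ?A z - ?B z \<partial>gamma_n)"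
    unfolding L2_inner_def using IA IB by simp
  also have "\<dots> = (\<integral>z. gdens z *\<^sub>R (?A z - ?B z) \<partial>lborel)"
    by (rule integral_gamma_n) measurable
  also have "\<dots> = (\<integral>z. complex_of_real ((real CARD('n) / pi) ^ CARD('n)) * wirt i ?P z \<partial>lborel)"
    by (rule Bochner_Integration.integral_cong) (simp_all only: wP gdens_wt scaleR_conv_of_real, simp_all add: ac_simps)
  also have "\<dots> = 0" by (simp add: 0)
  finally show ?thesis by simp
qed

section \<open>Orthonormality\<close>

lemma idx_weight_Suc:
  fixes m :: "'n::finite \<times> bool \<Rightarrow> nat"
  shows "idx_weight (m(k := Suc (m k))) = real CARD('n) * real (Suc (m k)) * idx_weight m"
proof -
  have "idx_weight (m(k := Suc (m k))) = fact (Suc (m k)) * real CARD('n) ^ Suc (m k)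
      * (\<Prod>i\<in>UNIV - {k}. fact (m i) * real CARD('n) ^ m i)"
    unfolding idx_weight_def by (subst prod.remove[of _ k]) auto
  moreover have "idx_weight m = fact (m k) * real CARD('n) ^ m k
      * (\<Prod>i\<in>UNIV - {k}. fact (m i) * real CARD('n) ^ m i)"
    unfolding idx_weight_def by (subst prod.remove[of _ k]) auto
  ultimately show ?thesis by simp
qed

text \<open>Each raising operator on the right acts as a derivative on the left, which lowers the degree there;
the number of such steps must match in every index.\<close>

lemma ladder_inner:
  fixes m m' :: "'n::{finite,linorder} \<times> bool \<Rightarrow> nat"
  shows "L2_inner gamma_n (ladder m) (ladder m') = (if m = m' then of_real (idx_weight m) else 0)"
proof (induction m' arbitrary: m rule: multi_index_induct)
  case zero
  show ?case
  proof (cases "m = (\<lambda>_. 0)")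
    case True
    interpret prob_space "gamma_n :: (complex ^ 'n::{finite,linorder}) measure" by (rule prob_space_gamma_n)
    show ?thesis using True prob_space by (simp add: ladder_0 L2_inner_def idx_weight_def)
  next
    case False
    then have "\<exists>k. m k \<noteq> 0" by (meson ext)
    then obtain k where k: "m k \<noteq> 0" ..
    let ?m = "m(k := m k - 1)"
    have m: "m = ?m(k := Suc (?m k))" using k by auto
    have 1: "tame (1 / 2) (\<lambda>z :: complex ^ 'n::{finite,linorder}. 1)" by (rule zpoly_tame[OF zpoly_const]) simp
    have lt: "1 / 2 < real CARD('n)" using zero_less_card_finite[where 'a = 'n] by linarith
    have "L2_inner gamma_n (\<lambda>z. 1) (raise k (ladder ?m)) = L2_inner gamma_n (wirt k (\<lambda>z. 1)) (ladder ?m)"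
      by (rule wirt_adjoint[OF 1 zpoly_ladder lt, symmetric])
    also have "\<dots> = 0" by (simp add: wirt_const L2_inner_def)
    finally have "L2_inner gamma_n (ladder (\<lambda>_. 0)) (ladder m) = 0"
      by (subst m) (simp only: ladder_Suc ladder_0)
    then have "L2_inner gamma_n (ladder m) (ladder (\<lambda>_. 0)) = 0"
      by (subst L2_inner_commute) simp
    then show ?thesis using False by simp
  qed
next
  case (Suc m' k)
  have t: "tame (1 / 2) (ladder m)" by (rule zpoly_tame[OF zpoly_ladder]) simp
  have lt: "1 / 2 < real CARD('n)" using zero_less_card_finite[where 'a = 'n] by linarith
  have "L2_inner gamma_n (ladder m) (ladder (m'(k := Suc (m' k)))) = L2_inner gamma_n (wirt k (ladder m)) (ladder m')"
    unfolding ladder_Suc by (rule wirt_adjoint[OF t zpoly_ladder lt, symmetric])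
  also have "\<dots> = of_nat CARD('n) * of_nat (m k)
      * (if m(k := m k - 1) = m' then of_real (idx_weight (m(k := m k - 1))) else 0)"
    unfolding wirt_ladder by (subst L2_inner_cmult_left) (simp only: Suc.IH)
  also have "\<dots> = (if m = m'(k := Suc (m' k)) then of_real (idx_weight m) else 0)"
  proof (cases "m = m'(k := Suc (m' k))")
    case True
    then have 1: "m(k := m k - 1) = m'" "m k = Suc (m' k)" by auto
    have 2: "idx_weight m = real CARD('n) * real (Suc (m' k)) * idx_weight m'"
      unfolding True by (rule idx_weight_Suc)
    show ?thesis unfolding 1 2 using True by (simp del: fun_upd_apply of_nat_Suc)
  next
    case False
    show ?thesis
    proof (cases "m(k := m k - 1) = m'")
      case True
      have "m k = 0"
      proof (rule ccontr)
        assume "m k \<noteq> 0"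
        then have "m = m'(k := Suc (m' k))" unfolding True[symmetric] by (auto simp: fun_eq_iff)
        then show False using False by simp
      qed
      then show ?thesis using False by simp
    qed (use False in simp)
  qed
  finally show ?case .
qed

definition hm :: "('n::{finite,linorder} \<times> bool \<Rightarrow> nat) \<Rightarrow> 'n cfun" where
  "hm m z = complex_of_real (1 / sqrt (idx_weight m)) * ladder m z"

lemma zpoly_hm: "zpoly (hm m)"
  unfolding hm_def[abs_def] by (intro zpoly_cmult zpoly_ladder)

lemma hermite_eq_hm: "hermite p q = hm (join_idx p q)"
  by (rule ext) (simp add: hermite_eq_ladder hm_def)

lemma orthonormal_hm: "orthonormal_family gamma_n (hm :: ('n::{finite,linorder} \<times> bool \<Rightarrow> nat) \<Rightarrow> _)"
proof -
  interpret prob_space "gamma_n :: (complex ^ 'n::{finite,linorder}) measure" by (rule prob_space_gamma_n)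
  show ?thesis
  proof
    fix i j :: "'n \<times> bool \<Rightarrow> nat"
    show "hm i \<in> L2 gamma_n" by (rule zpoly_L2_gamma[OF zpoly_hm])
    have "L2_inner gamma_n (hm i) (hm j) = of_real (1 / sqrt (idx_weight i)) *
        (of_real (1 / sqrt (idx_weight j)) * L2_inner gamma_n (ladder i) (ladder j))"
      unfolding hm_def[abs_def] L2_inner_cmult_left L2_inner_cmult_right by simp
    also have "\<dots> = (if i = j then 1 else 0)"
      using idx_weight_pos[of j] by (simp add: ladder_inner flip: of_real_mult)
    finally show "L2_inner gamma_n (hm i) (hm j) = (if i = j then 1 else 0)" .
  qed
qed

section \<open>Functions orthogonal to all polynomials\<close>

lemma (in pair_sigma_finite) integrable_pair_bound:
  fixes f :: "'a \<Rightarrow> 'b \<Rightarrow> 'c::{banach, second_countable_topology}"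
  assumes m [measurable]: "(\<lambda>(x, y). f x y) \<in> borel_measurable (M1 \<Otimes>\<^sub>M M2)"
    and a: "integrable M1 a" and b: "integrable M2 b"
    and le: "\<And>x y. norm (f x y) \<le> a x * b y"
  shows "integrable (M1 \<Otimes>\<^sub>M M2) (\<lambda>(x, y). f x y)"
proof (rule Fubini_integrable[OF m])
  have bx: "integrable M2 (\<lambda>y. a x * b y)" for x using b by simp
  have fm: "(\<lambda>y. f x y) \<in> borel_measurable M2" if "x \<in> space M1" for x
    using measurable_compose[OF measurable_Pair1'[OF that] m] by simp
  have fI: "integrable M2 (f x)" if "x \<in> space M1" for x
    by (rule Bochner_Integration.integrable_bound[OF bx[of x] fm[OF that]], rule AE_I2)
       (use order_trans[OF le abs_ge_self] in simp)
  then show "AE x in M1. integrable M2 (\<lambda>y. case (x, y) of (x, y) \<Rightarrow> f x y)" by (intro AE_I2) simp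
  show "integrable M1 (\<lambda>x. \<integral>y. norm (case (x, y) of (x, y) \<Rightarrow> f x y) \<partial>M2)"
  proof (rule Bochner_Integration.integrable_bound[where f = "\<lambda>x. a x * (\<integral>y. b y \<partial>M2)"])
    show "integrable M1 (\<lambda>x. a x * (\<integral>y. b y \<partial>M2))" using a by simp
    show "(\<lambda>x. \<integral>y. norm (case (x, y) of (x, y) \<Rightarrow> f x y) \<partial>M2) \<in> borel_measurable M1" by measurable
    have "(\<integral>y. norm (f x y) \<partial>M2) \<le> a x * (\<integral>y. b y \<partial>M2)" if "x \<in> space M1" for x
      using integral_mono[OF integrable_norm[OF fI[OF that]] bx le] by simp
    then show "AE x in M1. norm (\<integral>y. norm (case (x, y) of (x, y) \<Rightarrow> f x y) \<partial>M2) \<le> norm (a x * (\<integral>y. b y \<partial>M2))"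
      by (intro AE_I2) (auto intro: order_trans[OF _ abs_ge_self])
  qed
qed

lemma integral_lborel_affine:
  fixes G :: "'a::euclidean_space \<Rightarrow> 'b::{banach, second_countable_topology}"
  assumes m [measurable]: "G \<in> borel_measurable borel" and s: "s > 0"
  shows "(\<integral>y. G y \<partial>lborel) = s ^ DIM('a) *\<^sub>R (\<integral>t. G (x + s *\<^sub>R t) \<partial>lborel)"
proof -
  have "(\<integral>y. G y \<partial>lborel) = (\<integral>y. G y \<partial>density (distr lborel borel (\<lambda>t. x + s *\<^sub>R t)) (\<lambda>_. ennreal (\<bar>s\<bar> ^ DIM('a))))"
    using s by (subst lborel_affine[of s x]) auto
  also have "\<dots> = (\<integral>y. \<bar>s\<bar> ^ DIM('a) *\<^sub>R G y \<partial>distr lborel borel (\<lambda>t. x + s *\<^sub>R t))"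
    by (subst integral_density) auto
  also have "\<dots> = (\<integral>t. \<bar>s\<bar> ^ DIM('a) *\<^sub>R G (x + s *\<^sub>R t) \<partial>lborel)"
    by (subst integral_distr) auto
  finally show ?thesis using s by simp
qed

lemma zpoly_norm_sq: "zpoly (\<lambda>x. complex_of_real ((norm (x - y))\<^sup>2))"
proof -
  have "complex_of_real ((norm (x - y))\<^sup>2) = (\<Sum>k\<in>UNIV. (x $ k - y $ k) * cnj (x $ k - y $ k))" for x :: "complex ^ 'a"
  proof -
    have "(norm (x - y))\<^sup>2 = (\<Sum>k\<in>UNIV. (cmod (x $ k - y $ k))\<^sup>2)"
      by (simp add: norm_vec_def L2_set_def sum_nonneg)
    then show ?thesis by (simp only: of_real_sum complex_norm_square)
  qed
  moreover have "zpoly (\<lambda>x. \<Sum>k\<in>UNIV. (x $ k - y $ k) * cnj (x $ k - y $ k))"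
    by (intro zpoly_sum zpoly_mult zpoly_diff zpoly_nth zpoly_const zpoly_cnj)
  ultimately show ?thesis by simp
qed

text \<open>The Taylor polynomials of \<open>exp (- \<epsilon> Q)\<close>, with \<open>Q = |x - y|^2\<close>, are only dominated by \<open>exp (\<epsilon> Q)\<close>. This
dominating function is square-integrable for small \<open>\<epsilon>\<close> alone, so a narrow Gaussian cannot be reached in one
step. But \<open>exp (- \<epsilon> Q)\<close> is bounded, and the same argument can be repeated after multiplying by it.\<close>

lemma orthogonal_poly_gaussian:
  fixes u :: "'n::finite cfun" and y :: "complex ^ 'n"
  assumes u: "u \<in> L2 gamma_n" and orth: "\<And>P. zpoly P \<Longrightarrow> L2_inner gamma_n P u = 0"
  defines "\<epsilon> \<equiv> real CARD('n) / 8"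
  shows "zpoly P \<Longrightarrow> L2_inner gamma_n (\<lambda>x. P x * complex_of_real (exp (- (real k * \<epsilon>) * (norm (x - y))\<^sup>2))) u = 0"
proof (induction k arbitrary: P)
  case 0
  then show ?case using orth by simp
next
  case (Suc k)
  have c: "real CARD('n) \<ge> 1" by (simp add: Suc_leI)
  then have e: "\<epsilon> > 0" by (simp add: \<epsilon>_def)
  define Q where "Q x = (norm (x - y))\<^sup>2" for x
  define E where "E x = complex_of_real (exp (- (real k * \<epsilon>) * Q x))" for x
  have Qm [measurable]: "Q \<in> borel_measurable borel" unfolding Q_def by measurable
  have Em [measurable]: "E \<in> borel_measurable borel" unfolding E_def by measurable
  have um [measurable]: "u \<in> borel_measurable borel" using u by (simp add: L2_def)
  have Pm [measurable]: "P \<in> borel_measurable borel" using Suc.prems by (rule zpoly_measurable)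
  have Q0: "Q x \<ge> 0" for x by (simp add: Q_def)
  have E1: "cmod (E x) \<le> 1" for x using e Q0[of x] by (simp add: E_def)
  define t where "t j x = P x * complex_of_real (Q x) ^ j * E x * cnj (u x)" for j x
  have tint: "integrable gamma_n (t j)" "(\<integral>x. t j x \<partial>gamma_n) = 0" for j
  proof -
    have z: "zpoly (\<lambda>x. P x * complex_of_real (Q x) ^ j)"
      unfolding Q_def by (intro zpoly_mult zpoly_power zpoly_norm_sq Suc.prems)
    have "growth (1 / 4) (\<lambda>x. P x * complex_of_real (Q x) ^ j * E x)"
    proof (rule growth_le[OF zpoly_growth[OF z]])
      fix x show "cmod (P x * complex_of_real (Q x) ^ j * E x) \<le> cmod (P x * complex_of_real (Q x) ^ j)"
        unfolding norm_mult using E1[of x] by (intro mult_left_le) auto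
    qed simp
    then have "(\<lambda>x. P x * complex_of_real (Q x) ^ j * E x) \<in> L2 gamma_n"
      by (rule growth_L2_gamma[rotated]) (use c in linarith, measurable)
    from L2_inner_integrable[OF this u] show "integrable gamma_n (t j)" by (simp add: t_def[abs_def])
    show "(\<integral>x. t j x \<partial>gamma_n) = 0"
      using Suc.IH[OF z] by (simp add: t_def L2_inner_def E_def Q_def)
  qed
  \<comment> \<open>the choice of \<open>\<epsilon>\<close> gives this function growth \<open>3 n / 8\<close>, below the threshold \<open>n / 2\<close>\<close>
  define w where "w = (\<lambda>x. P x * complex_of_real (exp (\<epsilon> * Q x)))"
  have "growth (\<epsilon> + 2 * \<epsilon>) w"
    unfolding w_def
  proof (rule growth_mult[OF zpoly_growth[OF Suc.prems e]])
    have "norm (complex_of_real (exp (\<epsilon> * Q x))) \<le> exp (2 * \<epsilon> * (norm y)\<^sup>2) * exp (2 * \<epsilon> * (norm x)\<^sup>2)" for x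
    proof -
      have "Q x \<le> (norm x + norm y)\<^sup>2" unfolding Q_def by (intro power_mono norm_triangle_ineq4) auto
      also have "\<dots> \<le> 2 * (norm x)\<^sup>2 + 2 * (norm y)\<^sup>2"
        using sum_squares_bound[of "norm x" "norm y"] by (simp add: power2_sum)
      finally have "\<epsilon> * Q x \<le> \<epsilon> * (2 * (norm x)\<^sup>2 + 2 * (norm y)\<^sup>2)" using e by (intro mult_left_mono) auto
      then show ?thesis by (simp add: exp_add[symmetric] algebra_simps)
    qed
    then show "growth (2 * \<epsilon>) (\<lambda>x. complex_of_real (exp (\<epsilon> * Q x)))" unfolding growth_def by blast
  qed
  then have wL: "w \<in> L2 gamma_n"
    by (rule growth_L2_gamma[rotated]) (use c in \<open>simp_all add: w_def \<epsilon>_def\<close>)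
  define s where "s N x = (\<Sum>j<N. (complex_of_real (- \<epsilon>) ^ j / fact j) * t j x)" for N x
  have s_alt: "s N x = P x * E x * cnj (u x) * (\<Sum>j<N. complex_of_real (- \<epsilon> * Q x) ^ j / fact j)" for N x
    unfolding s_def t_def sum_distrib_left by (rule sum.cong) (simp_all only: of_real_mult power_mult_distrib, simp_all add: mult_ac)
  have "(\<lambda>N. \<integral>x. s N x \<partial>gamma_n) \<longlonglongrightarrow> (\<integral>x. P x * E x * cnj (u x) * exp (complex_of_real (- \<epsilon> * Q x)) \<partial>gamma_n)"
  proof (rule integral_dominated_convergence[where w = "\<lambda>x. cmod (w x * u x)"])
    show "integrable gamma_n (\<lambda>x. cmod (w x * u x))"
      by (intro integrable_norm L2_mult_integrable wL u)
    show "s N \<in> borel_measurable gamma_n" for N unfolding s_alt by measurable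
    show "(\<lambda>x. P x * E x * cnj (u x) * exp (complex_of_real (- \<epsilon> * Q x))) \<in> borel_measurable gamma_n"
      unfolding exp_of_real by measurable
    show "AE x in gamma_n. (\<lambda>N. s N x) \<longlonglongrightarrow> P x * E x * cnj (u x) * exp (complex_of_real (- \<epsilon> * Q x))"
    proof (rule AE_I2)
      fix x
      have "(\<lambda>N. \<Sum>j<N. complex_of_real (- \<epsilon> * Q x) ^ j / fact j) \<longlonglongrightarrow> exp (complex_of_real (- \<epsilon> * Q x))"
        using exp_converges[of "complex_of_real (- \<epsilon> * Q x)"]
        by (simp add: sums_def scaleR_conv_of_real divide_inverse mult.commute)
      then show "(\<lambda>N. s N x) \<longlonglongrightarrow> P x * E x * cnj (u x) * exp (complex_of_real (- \<epsilon> * Q x))"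
        unfolding s_alt by (intro tendsto_intros)
    qed
    show "AE x in gamma_n. norm (s N x) \<le> cmod (w x * u x)" for N
    proof (rule AE_I2)
      fix x
      have "cmod (\<Sum>j<N. complex_of_real (- \<epsilon> * Q x) ^ j / fact j) \<le> (\<Sum>j<N. (\<epsilon> * Q x) ^ j / fact j)"
        by (rule sum_norm_le) (use e Q0[of x] in \<open>simp add: norm_divide norm_power norm_mult\<close>)
      also have "\<dots> \<le> (\<Sum>j. (\<epsilon> * Q x) ^ j / fact j)"
        using summable_exp_generic[of "\<epsilon> * Q x"] e Q0[of x]
        by (intro sum_le_suminf) (auto simp: divide_inverse mult.commute)
      also have "\<dots> = exp (\<epsilon> * Q x)" by (simp add: exp_def divide_inverse mult.commute)
      finally have le: "cmod (\<Sum>j<N. complex_of_real (- \<epsilon> * Q x) ^ j / fact j) \<le> exp (\<epsilon> * Q x)" .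
      have "cmod (P x) * cmod (E x) * cmod (u x) * cmod (\<Sum>j<N. complex_of_real (- \<epsilon> * Q x) ^ j / fact j)
          \<le> cmod (P x) * 1 * cmod (u x) * exp (\<epsilon> * Q x)"
        using E1[of x] le by (intro mult_mono) auto
      then show "norm (s N x) \<le> cmod (w x * u x)" unfolding s_alt w_def by (simp add: norm_mult mult_ac)
    qed
  qed
  moreover have "(\<integral>x. s N x \<partial>gamma_n) = 0" for N
    unfolding s_def by (subst Bochner_Integration.integral_sum) (auto simp: tint)
  ultimately have "(\<integral>x. P x * E x * cnj (u x) * exp (complex_of_real (- \<epsilon> * Q x)) \<partial>gamma_n) = 0"
    by (simp add: LIMSEQ_const_iff)
  moreover have "P x * E x * cnj (u x) * exp (complex_of_real (- \<epsilon> * Q x))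
      = P x * complex_of_real (exp (- (real (Suc k) * \<epsilon>) * (norm (x - y))\<^sup>2)) * cnj (u x)" for x
  proof -
    have "exp (- (real (Suc k) * \<epsilon>) * (norm (x - y))\<^sup>2) = exp (- (real k * \<epsilon>) * Q x) * exp (- \<epsilon> * Q x)"
      by (simp add: exp_add[symmetric] Q_def algebra_simps)
    then show ?thesis unfolding E_def exp_of_real by (simp only: of_real_mult mult_ac)
  qed
  ultimately show ?case by (simp only: L2_inner_def)
qed

text \<open>Convolving a continuous function of compact support with ever narrower Gaussians recovers the function,
and each convolution is a superposition of translated Gaussians.\<close>

lemma orthogonal_zpoly_imp_orthogonal_Cc:
  fixes u F :: "'n::finite cfun"
  assumes u: "u \<in> L2 gamma_n" and orth: "\<And>P. zpoly P \<Longrightarrow> L2_inner gamma_n P u = 0"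
    and F: "continuous_on UNIV F" and supp: "\<And>x. norm x > R \<Longrightarrow> F x = 0"
  shows "L2_inner gamma_n F u = 0"
proof -
  interpret gam: prob_space "gamma_n :: (complex ^ 'n) measure" by (rule prob_space_gamma_n)
  interpret pair: pair_sigma_finite "gamma_n :: (complex ^ 'n) measure" "lborel :: (complex ^ 'n) measure" ..
  define \<epsilon> where "\<epsilon> = real CARD('n) / 8"
  have e: "\<epsilon> > 0" by (simp add: \<epsilon>_def)
  have Fm [measurable]: "F \<in> borel_measurable borel" using F by (rule borel_measurable_continuous_onI)
  have um [measurable]: "u \<in> borel_measurable borel" using u by (simp add: L2_def)
  have uI: "integrable gamma_n u" by (rule gam.L2_imp_integrable[OF u])
  have "compact (F ` cball 0 R)"
    by (intro compact_continuous_image continuous_on_subset[OF F]) auto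
  then obtain B0 where B0: "\<And>x. x \<in> cball 0 R \<Longrightarrow> cmod (F x) \<le> B0"
    using compact_imp_bounded bounded_iff by (metis imageI)
  define B where "B = max B0 0"
  have B: "cmod (F x) \<le> B" for x
    using B0[of x] supp[of x] by (cases "norm x > R") (auto simp: B_def)
  have B_nonneg: "B \<ge> 0" by (simp add: B_def)
  have "set_integrable lborel (cball 0 R) F"
    by (rule borel_integrable_compact[unfolded set_integrable_def[symmetric]])
       (auto intro: continuous_on_subset[OF F])
  moreover have "indicator (cball 0 R) x *\<^sub>R F x = F x" for x
    using supp[of x] by (auto simp: indicator_def)
  ultimately have FI: "integrable lborel F" by (simp add: set_integrable_def)
  \<comment> \<open>the convolution in rescaled variables, with the width \<open>s\<close> moved into the argument of \<open>F\<close>\<close>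
  define G where "G s x t = F (x + s *\<^sub>R t) * complex_of_real (exp (- 1 * (norm t)\<^sup>2))" for s :: real and x t :: "complex ^ 'n"
  have conv0: "(\<integral>x. (\<integral>t. G s x t \<partial>lborel) * cnj (u x) \<partial>gamma_n) = 0"
    if s: "s = 1 / sqrt (real (Suc k) * \<epsilon>)" for s k
  proof -
    define a where "a = real (Suc k) * \<epsilon>"
    have a: "a > 0" using e by (simp add: a_def)
    have s0: "s > 0" and s2: "s\<^sup>2 * a = 1" using a unfolding s a_def[symmetric] by (simp_all add: power_divide)
    define H where "H x y = F y * complex_of_real (exp (- a * (norm (x - y))\<^sup>2))" for x y
    have Hm [measurable]: "(\<lambda>(x, y). H x y) \<in> borel_measurable (borel \<Otimes>\<^sub>M borel)"
      unfolding H_def by measurable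
    have HF: "cmod (H x y) \<le> cmod (F y)" for x y
      using a by (simp add: H_def norm_mult mult_left_le)
    have HI: "integrable lborel (H x)" for x
      by (rule Bochner_Integration.integrable_bound[OF FI]) (auto simp: HF intro!: AE_I2)
    have I: "integrable (gamma_n \<Otimes>\<^sub>M lborel) (\<lambda>(x, y). H x y * cnj (u x))"
    proof (rule pair.integrable_pair_bound[where a = "\<lambda>x. cmod (u x)" and b = "\<lambda>y. cmod (F y)"])
      show "(\<lambda>(x, y). H x y * cnj (u x)) \<in> borel_measurable (gamma_n \<Otimes>\<^sub>M lborel)" by measurable
      show "norm (H x y * cnj (u x)) \<le> cmod (u x) * cmod (F y)" for x y
        using mult_left_mono[OF HF[of x y], of "cmod (u x)"] by (simp add: norm_mult mult.commute)
    qed (use uI FI in auto)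
    have "(\<integral>x. (\<integral>y. H x y \<partial>lborel) * cnj (u x) \<partial>gamma_n) = (\<integral>x. (\<integral>y. H x y * cnj (u x) \<partial>lborel) \<partial>gamma_n)"
      by simp
    also have "\<dots> = (\<integral>y. (\<integral>x. H x y * cnj (u x) \<partial>gamma_n) \<partial>lborel)"
      using pair.Fubini_integral[OF I] by simp
    also have "\<dots> = (\<integral>y. F y * L2_inner gamma_n (\<lambda>x. 1 * complex_of_real (exp (- (real (Suc k) * \<epsilon>) * (norm (x - y))\<^sup>2))) u \<partial>lborel)"
      by (simp add: L2_inner_def H_def a_def mult.assoc)
    also have "\<dots> = 0"
      unfolding \<epsilon>_def by (subst orthogonal_poly_gaussian[OF u orth zpoly_const]) simp_all
    finally have 0: "(\<integral>x. (\<integral>y. H x y \<partial>lborel) * cnj (u x) \<partial>gamma_n) = 0" .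
    have "(\<integral>y. H x y \<partial>lborel) = s ^ DIM(complex ^ 'n) *\<^sub>R (\<integral>t. G s x t \<partial>lborel)" for x
    proof -
      have "H x (x + s *\<^sub>R t) = G s x t" for t
        using s0 s2 by (simp add: H_def G_def power_mult_distrib mult.assoc[symmetric] mult.commute[of a])
      then show ?thesis using integral_lborel_affine[of "H x" s x] s0 by simp
    qed
    then have "s ^ DIM(complex ^ 'n) *\<^sub>R (\<integral>x. (\<integral>t. G s x t \<partial>lborel) * cnj (u x) \<partial>gamma_n) = 0"
      using 0 by simp
    then show ?thesis using s0 by simp
  qed
  define s where "s k = 1 / sqrt (real (Suc k) * \<epsilon>)" for k
  have s_lim: "s \<longlonglongrightarrow> 0"
  proof -
    have "filterlim (\<lambda>k. sqrt (real (Suc k) * \<epsilon>)) at_top sequentially"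
      by (intro filterlim_compose[OF sqrt_at_top] filterlim_at_top_mult_tendsto_pos[OF tendsto_const e]
          filterlim_compose[OF filterlim_real_sequentially filterlim_Suc, unfolded o_def])
    from real_tendsto_divide_at_top[OF tendsto_const[of 1] this] show ?thesis by (simp only: s_def[abs_def])
  qed
  define K where "K = (\<integral>t. exp (- 1 * (norm t)\<^sup>2) \<partial>(lborel :: (complex ^ 'n) measure))"
  have KI: "integrable lborel (\<lambda>t :: complex ^ 'n. exp (- 1 * (norm t)\<^sup>2))" by (rule integrable_gaussian) simp
  have K: "K > 0" unfolding K_def by (subst integral_gaussian) auto
  have Gm [measurable]: "(\<lambda>(x, t). G r x t) \<in> borel_measurable (borel \<Otimes>\<^sub>M borel)" for r
    unfolding G_def by measurable
  have GB: "cmod (G r x t) \<le> B * exp (- 1 * (norm t)\<^sup>2)" for r x t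
    using B by (simp add: G_def norm_mult mult_right_mono)
  have Glim: "(\<lambda>k. \<integral>t. G (s k) x t \<partial>lborel) \<longlonglongrightarrow> F x * complex_of_real K" for x
  proof -
    have "(\<lambda>k. \<integral>t. G (s k) x t \<partial>lborel) \<longlonglongrightarrow> (\<integral>t. F x * complex_of_real (exp (- 1 * (norm t)\<^sup>2)) \<partial>(lborel :: (complex ^ 'n) measure))"
    proof (rule integral_dominated_convergence[where w = "\<lambda>t :: complex ^ 'n. B * exp (- 1 * (norm t)\<^sup>2)"])
      show "AE t in lborel. (\<lambda>k. G (s k) x t) \<longlonglongrightarrow> F x * complex_of_real (exp (- 1 * (norm t)\<^sup>2))"
      proof (rule AE_I2)
        fix t :: "complex ^ 'n"
        have "isCont F x" using F by (simp add: continuous_on_eq_continuous_at)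
        moreover have "(\<lambda>k. x + s k *\<^sub>R t) \<longlonglongrightarrow> x + 0 *\<^sub>R t" by (intro tendsto_intros s_lim)
        ultimately have "(\<lambda>k. F (x + s k *\<^sub>R t)) \<longlonglongrightarrow> F x" by (intro isCont_tendsto_compose[of x F]) auto
        then show "(\<lambda>k. G (s k) x t) \<longlonglongrightarrow> F x * complex_of_real (exp (- 1 * (norm t)\<^sup>2))"
          unfolding G_def by (intro tendsto_intros)
      qed
    qed (use KI GB in auto)
    then show ?thesis by (simp add: K_def)
  qed
  have GKB: "cmod (\<integral>t. G r x t \<partial>lborel) \<le> B * K" for r x
  proof -
    have "integrable lborel (G r x)"
      by (rule Bochner_Integration.integrable_bound[OF integrable_mult_right[OF KI, of B]])
        (measurable, intro AE_I2, unfold real_norm_def, rule order_trans[OF GB abs_ge_self])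
    then have "cmod (\<integral>t. G r x t \<partial>lborel) \<le> (\<integral>t. B * exp (- 1 * (norm t)\<^sup>2) \<partial>(lborel :: (complex ^ 'n) measure))"
      using GB KI by (intro Bochner_Integration.integral_norm_bound_integral) auto
    then show ?thesis by (simp add: K_def)
  qed
  have "(\<lambda>k. \<integral>x. (\<integral>t. G (s k) x t \<partial>lborel) * cnj (u x) \<partial>gamma_n) \<longlonglongrightarrow> (\<integral>x. F x * complex_of_real K * cnj (u x) \<partial>gamma_n)"
  proof (rule integral_dominated_convergence[where w = "\<lambda>x. (B * K) * cmod (u x)"])
    show "integrable gamma_n (\<lambda>x. (B * K) * cmod (u x))" using uI by simp
    show "AE x in gamma_n. (\<lambda>k. (\<integral>t. G (s k) x t \<partial>lborel) * cnj (u x)) \<longlonglongrightarrow> F x * complex_of_real K * cnj (u x)"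
      by (intro AE_I2 tendsto_intros Glim)
    show "AE x in gamma_n. norm ((\<integral>t. G (s k) x t \<partial>lborel) * cnj (u x)) \<le> (B * K) * cmod (u x)" for k
      using GKB by (intro AE_I2) (simp add: norm_mult mult_right_mono)
  qed measurable
  moreover have "(\<integral>x. (\<integral>t. G (s k) x t \<partial>lborel) * cnj (u x) \<partial>gamma_n) = 0" for k
    by (rule conv0[OF s_def])
  ultimately have "(\<integral>x. F x * complex_of_real K * cnj (u x) \<partial>gamma_n) = 0"
    by (simp add: LIMSEQ_const_iff)
  moreover have "(\<integral>x. F x * complex_of_real K * cnj (u x) \<partial>gamma_n) = complex_of_real K * L2_inner gamma_n F u"
    unfolding L2_inner_def by (simp add: mult_ac flip: integral_mult_right_zero)
  ultimately show ?thesis using K by simp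
qed

section \<open>The reproducing kernel\<close>

text \<open>The Hermitian inner product of \<open>\<complex>\<^sup>n\<close>, conjugate linear in the second argument.\<close>

definition cdot :: "complex ^ 'n \<Rightarrow> complex ^ 'n \<Rightarrow> complex" where
  "cdot z w = (\<Sum>k\<in>UNIV. z $ k * cnj (w $ k))"

text \<open>The reproducing kernel of the Segal--Bargmann space, as a holomorphic function of \<open>w\<close>.\<close>

definition kern :: "complex ^ 'n \<Rightarrow> 'n::finite cfun" where
  "kern z w = exp (of_nat CARD('n) * cdot w z)"

lemma cnj_cdot: "cnj (cdot z w) = cdot w z"
  by (simp add: cdot_def mult.commute)

lemma cdot_add_left: "cdot (z + z') w = cdot z w + cdot z' w"
  by (simp add: cdot_def distrib_right sum.distrib)

lemma cdot_add_right: "cdot w (z + z') = cdot w z + cdot w z'"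
  by (simp add: cdot_def distrib_left sum.distrib)

lemma cdot_scale: "cdot (a *s z) w = a * cdot z w"
  by (simp add: cdot_def sum_distrib_left mult.assoc)

lemma cdot_scaleR: "cdot (r *\<^sub>R z) w = r *\<^sub>R cdot z w"
  by (simp add: cdot_def scaleR_sum_right)

lemma cdot_self: "cdot z z = complex_of_real ((norm z)\<^sup>2)"
proof -
  have "(norm z)\<^sup>2 = (\<Sum>k\<in>UNIV. (cmod (z $ k))\<^sup>2)"
    by (simp add: norm_vec_def L2_set_def sum_nonneg)
  then show ?thesis by (simp only: cdot_def of_real_sum complex_norm_square)
qed

lemma norm_cdot_le: "cmod (cdot z w) \<le> norm z * norm w"
proof -
  have "cmod (cdot z w) \<le> (\<Sum>k\<in>UNIV. \<bar>cmod (z $ k)\<bar> * \<bar>cmod (w $ k)\<bar>)"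
    unfolding cdot_def by (rule sum_norm_le) (simp add: norm_mult)
  also have "\<dots> \<le> norm z * norm w"
    unfolding norm_vec_def by (rule L2_set_mult_ineq)
  finally show ?thesis .
qed

lemma bounded_linear_cdot: "bounded_linear (\<lambda>z. cdot z w)"
  by (rule bounded_linear_intro[where K = "norm w"]) (auto simp: cdot_add_left cdot_scaleR norm_cdot_le)

lemma zpoly_cdot: "zpoly (\<lambda>w. cdot w z)" "zpoly (\<lambda>w. cdot z w)"
  unfolding cdot_def by (intro zpoly_sum zpoly_mult zpoly_nth zpoly_const zpoly_cnj)+

lemma cnj_kern: "cnj (kern z w) = exp (of_nat CARD('n) * cdot z w)" for z :: "complex ^ 'n::finite"
  by (simp add: kern_def exp_cnj cnj_cdot)

lemma growth_exp_norm:
  assumes "\<delta> > 0" "\<And>z. norm (F z) \<le> exp (K * norm z)"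
  shows "growth \<delta> F"
proof -
  have "norm (F z) \<le> exp (K\<^sup>2 / (4 * \<delta>)) * exp (\<delta> * (norm z)\<^sup>2)" for z
  proof -
    have "0 \<le> \<delta> * (norm z - K / (2 * \<delta>))\<^sup>2" using assms(1) by simp
    also have "\<dots> = \<delta> * (norm z)\<^sup>2 + K\<^sup>2 / (4 * \<delta>) - K * norm z"
      using assms(1) by (simp add: power2_diff power_divide field_simps power2_eq_square)
    finally have "exp (K * norm z) \<le> exp (K\<^sup>2 / (4 * \<delta>) + \<delta> * (norm z)\<^sup>2)" by simp
    then show ?thesis using assms(2)[of z] unfolding exp_add by linarith
  qed
  then show ?thesis unfolding growth_def by blast
qed

lemma norm_kern_le: "cmod (kern z w) \<le> exp ((real CARD('n) * norm z) * norm w)"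
  for z :: "complex ^ 'n::finite"
proof -
  have "Re (of_nat CARD('n) * cdot w z) \<le> real CARD('n) * cmod (cdot w z)"
    by (simp add: complex_Re_le_cmod mult_left_mono)
  also have "\<dots> \<le> real CARD('n) * (norm w * norm z)" by (intro mult_left_mono norm_cdot_le) simp
  finally show ?thesis by (simp add: kern_def mult_ac)
qed

lemma growth_kern: "\<delta> > 0 \<Longrightarrow> growth \<delta> (kern z)"
  by (rule growth_exp_norm[OF _ norm_kern_le])

lemma kern_has_derivative:
  fixes z :: "complex ^ 'n::finite"
  shows "(kern z has_derivative (\<lambda>v. of_nat CARD('n) * cdot v z * kern z w)) (at w)"
proof -
  have "((\<lambda>w. cdot w z) has_derivative (\<lambda>v. cdot v z)) (at w)"
    by (rule bounded_linear_imp_has_derivative[OF bounded_linear_cdot])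
  then have l: "((\<lambda>w. of_nat CARD('n) * cdot w z) has_derivative (\<lambda>v. of_nat CARD('n) * cdot v z)) (at w)"
    by (rule has_derivative_mult_right)
  have "(exp has_derivative (*) (exp (of_nat CARD('n) * cdot w z))) (at (of_nat CARD('n) * cdot w z))"
    using DERIV_exp[of "of_nat CARD('n) * cdot w z"] by (simp add: has_field_derivative_def)
  from has_derivative_compose[OF l this] show ?thesis
    by (simp add: kern_def[abs_def] mult_ac)
qed

lemma tame_kern:
  fixes z :: "complex ^ 'n::finite"
  assumes "\<delta> > 0"
  shows "tame \<delta> (kern z)"
proof -
  have diff: "kern z differentiable at w" for w using kern_has_derivative differentiableI by blast
  have cont: "continuous_on UNIV (kern z)"
    using diff by (meson continuous_at_imp_continuous_on differentiable_imp_continuous_within)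
  have d: "dir_deriv v (kern z) = (\<lambda>w. of_nat CARD('n) * cdot v z * kern z w)" for v
    by (rule ext) (rule dir_deriv_eq[OF kern_has_derivative])
  show ?thesis
    unfolding tame_def d using diff assms
    by (auto intro!: growth_cmult growth_kern continuous_intros cont)
qed

lemma wirt_kern: "wirt (k, True) (kern z) w = 0"
  by (simp add: wirt_def dir_deriv_eq[OF kern_has_derivative] cdot_def axis_def if_distrib[of "\<lambda>x. x * _"] cong: if_cong)
     (simp add: complex_eq_iff algebra_simps)

lemma kern_L2: "kern z \<in> L2 gamma_n" for z :: "complex ^ 'n::finite"
proof (rule growth_L2_gamma[where \<delta> = "1 / 4"])
  have "real CARD('n) \<ge> 1" by (simp add: Suc_leI)
  then show "2 * (1 / 4) < real CARD('n)" by linarith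
qed (use growth_kern[of "1 / 4" z] tame_measurable[OF tame_kern[of 1 z]] in auto)

lemma hm_eq_raise:
  assumes "m i \<noteq> 0"
  shows "\<exists>a m'. hm m = (\<lambda>z. complex_of_real a * raise i (ladder m') z)"
proof -
  let ?m = "m(i := m i - 1)"
  have "m = ?m(i := Suc (?m i))" using assms by auto
  then have "ladder m = raise i (ladder ?m)" using ladder_Suc by metis
  then show ?thesis unfolding hm_def[abs_def] by metis
qed

text \<open>A Hermite polynomial of positive degree in \<open>(k, True)\<close> is in the image of the adjoint of
\<open>d / d zbar_k\<close>, which annihilates the kernel.\<close>

lemma kern_orthogonal_hm:
  fixes m :: "'n::{finite,linorder} \<times> bool \<Rightarrow> nat"
  assumes "m (k, True) \<noteq> 0"
  shows "L2_inner gamma_n (kern z) (hm m) = 0"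
proof -
  obtain a m' where hm: "hm m = (\<lambda>z. complex_of_real a * raise (k, True) (ladder m') z)"
    using hm_eq_raise[of m "(k, True)", OF assms] by blast
  have lt: "1 / 2 < real CARD('n)" using zero_less_card_finite[where 'a = 'n] by linarith
  have "L2_inner gamma_n (kern z) (raise (k, True) (ladder m')) = L2_inner gamma_n (wirt (k, True) (kern z)) (ladder m')"
    by (rule wirt_adjoint[OF tame_kern zpoly_ladder lt, symmetric]) simp
  also have "\<dots> = 0" by (simp add: L2_inner_def wirt_kern)
  finally show ?thesis unfolding hm L2_inner_cmult_right by simp
qed

text \<open>Differentiation under the integral sign; the quadratic Taylor bound of \<open>exp\<close> gives an error of second
order, uniformly in \<open>w\<close> up to a factor of Gaussian growth.\<close>

lemma holomorphic_kern_transform: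
  fixes g :: "'n::finite cfun"
  assumes g: "g \<in> L2 gamma_n"
  shows "holomorphic_Cn (\<lambda>z. L2_inner gamma_n g (kern z))"
  unfolding holomorphic_Cn_def
proof
  fix z :: "complex ^ 'n"
  let ?c = "of_nat CARD('n) :: complex"
  define D where "D v = (\<integral>w. g w * (?c * cdot v w * exp (?c * cdot z w)) \<partial>gamma_n)" for v
  have gm [measurable]: "g \<in> borel_measurable borel" using g by (simp add: L2_def)
  have cm [measurable]: "(\<lambda>w. cdot v w) \<in> borel_measurable borel" for v :: "complex ^ 'n"
    using zpoly_cdot(2) by (rule zpoly_measurable)
  have c1: "real CARD('n) \<ge> 1" by (simp add: Suc_leI)
  have ge: "growth (1 / 8) (\<lambda>w. exp (?c * cdot z w))"
    using growth_cnj[OF growth_kern[of "1 / 8" z]] by (simp add: cnj_kern)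
  have eL: "(\<lambda>w. exp (?c * cdot z w)) \<in> L2 gamma_n"
    by (rule growth_L2_gamma[OF _ ge]) (measurable, use c1 in linarith)
  have em: "(\<lambda>w. exp (?c * cdot z w)) \<in> borel_measurable borel" using eL by (simp add: L2_def)
  have "2 * (1 / 8 + 1 / 8) = (1 / 2 :: real)" by simp
  with c1 have c2: "2 * (1 / 8 + 1 / 8) < real CARD('n)" by linarith
  have dL: "(\<lambda>w. ?c * cdot v w * exp (?c * cdot z w)) \<in> L2 gamma_n" for v
  proof (rule growth_L2_gamma[of _ "1 / 8 + 1 / 8"])
    show "growth (1 / 8 + 1 / 8) (\<lambda>w. ?c * cdot v w * exp (?c * cdot z w))"
      by (intro growth_mult[OF zpoly_growth ge] zpoly_cmult zpoly_cdot) simp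
    show "(\<lambda>w. ?c * cdot v w * exp (?c * cdot z w)) \<in> borel_measurable borel"
      by (intro borel_measurable_times borel_measurable_const cm em)
  qed (rule c2)
  define h where "h w = (real CARD('n) * norm w) ^ 2 * exp (real CARD('n) * norm w)" for w :: "complex ^ 'n"
  have h0: "h w \<ge> 0" for w by (simp add: h_def)
  have hL: "(\<lambda>w. complex_of_real (h w) * exp (?c * cdot z w)) \<in> L2 gamma_n"
  proof (rule growth_L2_gamma[of _ "(1 / 24 + 1 / 24 + 1 / 24) + 1 / 8"])
    have a: "growth (1 / 24) (\<lambda>w :: complex ^ 'n. complex_of_real (real CARD('n) * norm w))"
      by (rule growth_linear[where K = "real CARD('n)"]) (auto simp: norm_mult)
    have b: "growth (1 / 24) (\<lambda>w :: complex ^ 'n. complex_of_real (exp (real CARD('n) * norm w)))"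
      by (rule growth_exp_norm[where K = "real CARD('n)"]) auto
    have "growth (1 / 24 + 1 / 24 + 1 / 24) (\<lambda>w. complex_of_real (h w))"
      using growth_mult[OF growth_mult[OF a a] b] by (simp add: h_def power2_eq_square)
    then show "growth ((1 / 24 + 1 / 24 + 1 / 24) + 1 / 8) (\<lambda>w. complex_of_real (h w) * exp (?c * cdot z w))"
      by (rule growth_mult[OF _ ge])
    show "(\<lambda>w. complex_of_real (h w) * exp (?c * cdot z w)) \<in> borel_measurable borel"
      unfolding h_def by measurable
    have "2 * (1 / 24 + 1 / 24 + 1 / 24 + 1 / 8) = (1 / 2 :: real)" by simp
    with c1 show "2 * (1 / 24 + 1 / 24 + 1 / 24 + 1 / 8) < real CARD('n)" by linarith
  qed
  define C where "C = (\<integral>w. cmod (g w * (complex_of_real (h w) * exp (?c * cdot z w))) \<partial>gamma_n)"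
  have taylor: "cmod (exp (?c * cdot (z + v) w) - exp (?c * cdot z w) - ?c * cdot v w * exp (?c * cdot z w))
      \<le> (norm v)\<^sup>2 * cmod (complex_of_real (h w) * exp (?c * cdot z w))" if v: "norm v \<le> 1" for v w
  proof -
    let ?x = "?c * cdot v w"
    have x: "cmod ?x \<le> norm v * (real CARD('n) * norm w)"
      using mult_left_mono[OF norm_cdot_le[of v w], of "real CARD('n)"] by (simp add: norm_mult mult_ac)
    have x2: "cmod ?x \<le> real CARD('n) * norm w"
    proof -
      have "norm v * (real CARD('n) * norm w) \<le> 1 * (real CARD('n) * norm w)"
        using v by (intro mult_right_mono) auto
      with x show ?thesis unfolding mult_1 by linarith
    qed
    have "cmod (exp ?x - (\<Sum>i\<le>1. ?x ^ i / fact i)) \<le> exp \<bar>Re ?x\<bar> * (cmod ?x) ^ Suc 1 / fact 1"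
      by (rule Taylor_exp)
    then have "cmod (exp ?x - 1 - ?x) \<le> exp \<bar>Re ?x\<bar> * (cmod ?x)\<^sup>2"
      by (simp add: numeral_2_eq_2 diff_diff_eq)
    also have "\<dots> \<le> exp (real CARD('n) * norm w) * (norm v * (real CARD('n) * norm w))\<^sup>2"
      using x x2 abs_Re_le_cmod[of ?x] by (intro mult_mono power_mono) auto
    finally have 1: "cmod (exp ?x - 1 - ?x) \<le> (norm v)\<^sup>2 * h w"
      by (simp add: h_def power_mult_distrib mult_ac)
    have "exp (?c * cdot (z + v) w) - exp (?c * cdot z w) - ?c * cdot v w * exp (?c * cdot z w)
        = (exp ?x - 1 - ?x) * exp (?c * cdot z w)"
      by (simp add: cdot_add_left distrib_left exp_add algebra_simps)
    also have "cmod \<dots> \<le> ((norm v)\<^sup>2 * h w) * cmod (exp (?c * cdot z w))"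
      unfolding norm_mult using 1 by (intro mult_right_mono) auto
    also have "\<dots> = (norm v)\<^sup>2 * cmod (complex_of_real (h w) * exp (?c * cdot z w))"
      using h0[of w] by (simp add: norm_mult)
    finally show ?thesis .
  qed
  have I: "L2_inner gamma_n g (kern z) = (\<integral>w. g w * exp (?c * cdot z w) \<partial>gamma_n)" for z
    by (simp add: L2_inner_def cnj_kern)
  have eI: "integrable gamma_n (\<lambda>w. g w * exp (?c * cdot z w))" for z
    using L2_inner_integrable[OF g kern_L2[of z]] by (simp add: cnj_kern)
  have dI: "integrable gamma_n (\<lambda>w. g w * (?c * cdot v w * exp (?c * cdot z w)))" for v
    by (rule L2_mult_integrable[OF g dL])
  have hI: "integrable gamma_n (\<lambda>w. g w * (complex_of_real (h w) * exp (?c * cdot z w)))"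
    by (rule L2_mult_integrable[OF g hL])
  have lin: "D (a *s v) = a * D v" "D (v + v') = D v + D v'" for a v v'
  proof -
    have "D (a *s v) = (\<integral>w. a * (g w * (?c * cdot v w * exp (?c * cdot z w))) \<partial>gamma_n)"
      unfolding D_def by (simp add: cdot_scale mult_ac)
    then show "D (a *s v) = a * D v" by (simp add: D_def)
    have "D (v + v') = (\<integral>w. g w * (?c * cdot v w * exp (?c * cdot z w)) + g w * (?c * cdot v' w * exp (?c * cdot z w)) \<partial>gamma_n)"
      unfolding D_def by (simp add: cdot_add_left algebra_simps)
    also have "\<dots> = D v + D v'" unfolding D_def by (rule Bochner_Integration.integral_add[OF dI dI])
    finally show "D (v + v') = D v + D v'" .
  qed
  have scaleR: "r *\<^sub>R v = complex_of_real r *s v" for r and v :: "complex ^ 'n"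
    by (simp add: vec_eq_iff scaleR_conv_of_real[symmetric])
  have "linear D" by (rule linearI) (simp_all add: lin scaleR scaleR_conv_of_real)
  then have bl: "bounded_linear D" by (simp add: linear_conv_bounded_linear)
  have err: "norm (L2_inner gamma_n g (kern (z + v)) - L2_inner gamma_n g (kern z) - D v) \<le> C * (norm v)\<^sup>2"
    if v: "norm v \<le> 1" for v
  proof -
    have "L2_inner gamma_n g (kern (z + v)) - L2_inner gamma_n g (kern z) - D v
       = (\<integral>w. g w * exp (?c * cdot (z + v) w) - g w * exp (?c * cdot z w)
            - g w * (?c * cdot v w * exp (?c * cdot z w)) \<partial>gamma_n)"
      unfolding I D_def using eI dI by simp
    also have "norm \<dots> \<le> (\<integral>w. (norm v)\<^sup>2 * cmod (g w * (complex_of_real (h w) * exp (?c * cdot z w))) \<partial>gamma_n)"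
    proof (rule Bochner_Integration.integral_norm_bound_integral)
      fix w
      have "norm (g w * exp (?c * cdot (z + v) w) - g w * exp (?c * cdot z w) - g w * (?c * cdot v w * exp (?c * cdot z w)))
        = cmod (g w) * cmod (exp (?c * cdot (z + v) w) - exp (?c * cdot z w) - ?c * cdot v w * exp (?c * cdot z w))"
        by (simp only: right_diff_distrib[symmetric] norm_mult)
      also have "\<dots> \<le> cmod (g w) * ((norm v)\<^sup>2 * cmod (complex_of_real (h w) * exp (?c * cdot z w)))"
        by (rule mult_left_mono[OF taylor[OF v]]) simp
      finally show "norm (g w * exp (?c * cdot (z + v) w) - g w * exp (?c * cdot z w) - g w * (?c * cdot v w * exp (?c * cdot z w)))
        \<le> (norm v)\<^sup>2 * cmod (g w * (complex_of_real (h w) * exp (?c * cdot z w)))"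
        by (simp only: norm_mult mult_ac)
    qed (use eI dI hI in \<open>auto intro!: Bochner_Integration.integrable_diff integrable_mult_right integrable_norm\<close>)
    also have "\<dots> = C * (norm v)\<^sup>2" by (simp add: C_def)
    finally show ?thesis .
  qed
  have "((\<lambda>z. L2_inner gamma_n g (kern z)) has_derivative D) (at z)"
    unfolding has_derivative_at
  proof (intro conjI bl)
    have up: "((\<lambda>v :: complex ^ 'n. C * norm v) \<longlongrightarrow> C * 0) (at 0)" by (intro tendsto_intros tendsto_norm_zero tendsto_ident_at)
    have ev: "\<forall>\<^sub>F v in at (0 :: complex ^ 'n). norm v < 1"
      unfolding eventually_at by (rule exI[of _ 1]) simp
    show "(\<lambda>v. norm (L2_inner gamma_n g (kern (z + v)) - L2_inner gamma_n g (kern z) - D v) / norm v) \<midarrow>0\<rightarrow> 0"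
    proof (rule tendsto_sandwich[OF _ _ tendsto_const])
      show "((\<lambda>v :: complex ^ 'n. C * norm v) \<longlongrightarrow> 0) (at 0)" using up by simp
      show "\<forall>\<^sub>F v in at 0. norm (L2_inner gamma_n g (kern (z + v)) - L2_inner gamma_n g (kern z) - D v) / norm v \<le> C * norm v"
        using ev
      proof eventually_elim
        case (elim v)
        have "norm (L2_inner gamma_n g (kern (z + v)) - L2_inner gamma_n g (kern z) - D v) / norm v \<le> (C * (norm v)\<^sup>2) / norm v"
          using err[of v] elim by (intro divide_right_mono) auto
        then show ?case by (simp add: power2_eq_square split: if_splits)
      qed
    qed simp
  qed
  then show "\<exists>D. ((\<lambda>z. L2_inner gamma_n g (kern z)) has_derivative D) (at z) \<and> (\<forall>c v. D (c *s v) = c * D v)"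
    using lin(1) by blast
qed

section \<open>Rotations\<close>

lemma norm_smult: "norm (a *s z) = cmod a * norm z" for z :: "complex ^ 'n::finite"
proof -
  have "(norm (a *s z))\<^sup>2 = (cmod a * norm z)\<^sup>2"
    by (simp add: norm_vec_def L2_set_def sum_nonneg norm_mult power_mult_distrib sum_distrib_left)
  then show ?thesis by (rule power2_eq_imp_eq) auto
qed

lemma smult_scaleR: "a *s (r *\<^sub>R z) = r *\<^sub>R (a *s z)" for z :: "complex ^ 'n::finite"
  by (simp add: vec_eq_iff)

lemma linear_smult: "linear (\<lambda>z :: complex ^ 'n::finite. a *s z)"
  by (rule linearI) (simp_all add: smult_scaleR vec_eq_iff distrib_left)

lemma gamma_n_isometry:
  fixes T :: "complex ^ 'n::finite \<Rightarrow> complex ^ 'n"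
  assumes T: "linear T" and iso: "\<And>x. norm (T x) = norm x" and TS: "\<And>x. T (S x) = x"
  shows "distr gamma_n borel T = gamma_n"
proof -
  have [measurable]: "T \<in> borel_measurable borel"
    using T by (intro borel_measurable_continuous_onI linear_continuous_on linear_conv_bounded_linear[THEN iffD1])
  have "gamma_n = density (distr lborel borel T) (\<lambda>z. ennreal (gdens z))"
    by (simp only: gamma_n_density lborel_distr_linear_isometry[OF assms])
  also have "\<dots> = distr (density lborel (\<lambda>z. ennreal (gdens (T z)))) borel T"
    by (rule density_distr) auto
  also have "density lborel (\<lambda>z. ennreal (gdens (T z))) = gamma_n"
    by (simp add: gamma_n_density gdens_def iso)
  finally show ?thesis by simp
qed

lemma integral_gamma_n_isometry:
  fixes T :: "complex ^ 'n::finite \<Rightarrow> complex ^ 'n" and G :: "complex ^ 'n \<Rightarrow> 'b::{banach, second_countable_topology}"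
  assumes T: "linear T" and iso: "\<And>x. norm (T x) = norm x" and TS: "\<And>x. T (S x) = x"
    and G [measurable]: "G \<in> borel_measurable borel"
  shows "(\<integral>z. G (T z) \<partial>gamma_n) = (\<integral>z. G z \<partial>gamma_n)"
    and "integrable gamma_n (\<lambda>z. G (T z)) \<longleftrightarrow> integrable gamma_n G"
proof -
  have Tm [measurable]: "T \<in> borel_measurable borel"
    using T by (intro borel_measurable_continuous_onI linear_continuous_on linear_conv_bounded_linear[THEN iffD1])
  have eq: "distr gamma_n borel T = gamma_n" by (rule gamma_n_isometry[OF T iso TS])
  have Tm' : "T \<in> measurable gamma_n borel" by simp
  show "(\<integral>z. G (T z) \<partial>gamma_n) = (\<integral>z. G z \<partial>gamma_n)"
    using integral_distr[OF Tm' G] by (simp only: eq)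
  show "integrable gamma_n (\<lambda>z. G (T z)) \<longleftrightarrow> integrable gamma_n G"
    using integrable_distr_eq[OF Tm' G] by (simp only: eq)
qed

lemma integral_gamma_n_rotate:
  fixes G :: "complex ^ 'n::finite \<Rightarrow> 'b::{banach, second_countable_topology}"
  assumes "cmod \<omega> = 1" "G \<in> borel_measurable borel"
  shows "(\<integral>z. G (\<omega> *s z) \<partial>gamma_n) = (\<integral>z. G z \<partial>gamma_n)"
    and "integrable gamma_n (\<lambda>z. G (\<omega> *s z)) \<longleftrightarrow> integrable gamma_n G"
proof -
  have "\<omega> \<noteq> 0" using assms(1) by auto
  then have inv: "\<omega> *s (inverse \<omega> *s x) = x" for x :: "complex ^ 'n"
    by (simp add: vec_eq_iff)
  have iso: "norm (\<omega> *s x) = norm x" for x :: "complex ^ 'n"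
    using assms(1) by (simp add: norm_smult)
  show "(\<integral>z. G (\<omega> *s z) \<partial>gamma_n) = (\<integral>z. G z \<partial>gamma_n)"
    by (rule integral_gamma_n_isometry(1)[OF linear_smult iso inv assms(2)])
  show "integrable gamma_n (\<lambda>z. G (\<omega> *s z)) \<longleftrightarrow> integrable gamma_n G"
    by (rule integral_gamma_n_isometry(2)[OF linear_smult iso inv assms(2)])
qed

section \<open>Holomorphic functions\<close>

lemma holomorphic_Cn_continuous: "holomorphic_Cn F \<Longrightarrow> continuous_on UNIV F"
  unfolding holomorphic_Cn_def
  by (metis continuous_at_imp_continuous_on has_derivative_continuous)

lemma holomorphic_Cn_measurable: "holomorphic_Cn F \<Longrightarrow> F \<in> borel_measurable borel"
  by (rule borel_measurable_continuous_onI[OF holomorphic_Cn_continuous])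

lemma holomorphic_Cn_line:
  fixes F :: "'n::finite cfun"
  assumes "holomorphic_Cn F"
  shows "(\<lambda>a. F (a *s w)) holomorphic_on UNIV"
  unfolding holomorphic_on_def field_differentiable_def
proof
  fix a :: complex
  obtain D where D: "(F has_derivative D) (at (a *s w))" "\<And>c v. D (c *s v) = c * D v"
    using assms unfolding holomorphic_Cn_def by blast
  have "linear (\<lambda>a. a *s w)"
    by (rule linearI) (simp_all add: vec_eq_iff distrib_right)
  then have "((\<lambda>a. a *s w) has_derivative (\<lambda>a. a *s w)) (at a)"
    by (intro bounded_linear_imp_has_derivative) (simp add: linear_conv_bounded_linear)
  from has_derivative_compose[OF this D(1)]
  have "((\<lambda>a. F (a *s w)) has_derivative (\<lambda>h. D w * h)) (at a)"
    by (simp add: D(2) mult.commute)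
  then show "\<exists>f'. ((\<lambda>a. F (a *s w)) has_field_derivative f') (at a within UNIV)"
    unfolding has_field_derivative_def by blast
qed

text \<open>Cauchy's integral formula at the centre of the unit circle.\<close>

lemma circle_mean_value:
  assumes "\<phi> holomorphic_on UNIV"
  shows "(\<integral>t. indicator {0..1} t *\<^sub>R \<phi> (cis (2 * pi * t)) \<partial>lborel) = \<phi> 0"
proof -
  have c: "continuous_on UNIV \<phi>" using assms by (rule holomorphic_on_imp_continuous_on)
  have "((\<lambda>u. \<phi> u / (u - 0)) has_contour_integral (2 * of_real pi * \<i> * \<phi> 0)) (circlepath 0 1)"
    by (rule Cauchy_integral_circlepath_simple) (use assms holomorphic_on_subset in auto)
  then have "((\<lambda>t. \<phi> (circlepath 0 1 t) / circlepath 0 1 t * vector_derivative (circlepath 0 1) (at t within {0..1}))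
      has_integral (2 * of_real pi * \<i> * \<phi> 0)) {0..1}"
    by (simp add: has_contour_integral_def)
  moreover have "\<phi> (circlepath 0 1 t) / circlepath 0 1 t * vector_derivative (circlepath 0 1) (at t within {0..1})
      = (2 * of_real pi * \<i>) * \<phi> (cis (2 * pi * t))" if "t \<in> {0..1}" for t
  proof -
    have cp: "circlepath 0 1 t = cis (2 * pi * t)" by (simp add: circlepath cis_conv_exp mult_ac)
    have vd: "vector_derivative (circlepath 0 1) (at t within {0..1}) = 2 * of_real pi * \<i> * cis (2 * pi * t)"
      using that by (subst vector_derivative_circlepath01) (auto simp: cis_conv_exp mult_ac)
    show ?thesis unfolding cp vd by simp
  qed
  ultimately have "((\<lambda>t. (2 * of_real pi * \<i>) * \<phi> (cis (2 * pi * t))) has_integral (2 * of_real pi * \<i> * \<phi> 0)) {0..1}"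
    by (rule has_integral_eq[rotated]) auto
  note I = this
  have nz: "2 * of_real pi * \<i> \<noteq> (0 :: complex)" by simp
  have k: "inverse (2 * of_real pi * \<i>) * (2 * of_real pi * \<i> * x) = x" for x :: complex
    by (metis mult.assoc left_inverse mult_1 nz)
  from has_integral_mult_right[OF I, of "inverse (2 * of_real pi * \<i>)"]
  have hk: "((\<lambda>t. \<phi> (cis (2 * pi * t))) has_integral \<phi> 0) {0..1}"
    by (simp only: k)
  have "continuous_on {0..1::real} (\<lambda>t. \<phi> (cis (2 * pi * t)))"
    by (rule continuous_on_compose2[OF c]) (auto intro!: continuous_intros simp: cis_conv_exp)
  then have "set_integrable lborel {0..1} (\<lambda>t. \<phi> (cis (2 * pi * t)))"
    unfolding set_integrable_def by (intro borel_integrable_compact) auto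
  from set_borel_integral_eq_integral(2)[OF this] hk show ?thesis
    by (simp add: set_lebesgue_integral_def integral_unique)
qed

text \<open>The Gaussian is invariant under multiplication by \<open>e\<^sup>i\<^sup>\<theta>\<close>, and averaging a holomorphic function
  over that circle action gives its value at the origin.\<close>

lemma gamma_n_mean_value:
  fixes G :: "'n::finite cfun"
  assumes G: "holomorphic_Cn G" and I: "integrable gamma_n G"
  shows "(\<integral>w. G w \<partial>gamma_n) = G 0"
proof -
  interpret prob_space "gamma_n :: (complex ^ 'n) measure" by (rule prob_space_gamma_n)
  interpret pair: pair_sigma_finite "lborel :: real measure" "gamma_n :: (complex ^ 'n) measure" ..
  have Gm [measurable]: "G \<in> borel_measurable borel" by (rule holomorphic_Cn_measurable[OF G])
  define \<rho> where "\<rho> t z = cis (2 * pi * t) *s z" for t and z :: "complex ^ 'n"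
  have "continuous_on UNIV (\<lambda>(t, z). \<rho> t z)"
    unfolding \<rho>_def case_prod_unfold vector_scalar_mult_def cis_conv_exp
    by (intro continuous_on_vec_lambda continuous_intros)
  then have [measurable]: "(\<lambda>(t, z). \<rho> t z) \<in> borel_measurable (borel \<Otimes>\<^sub>M borel)"
    unfolding borel_prod by (rule borel_measurable_continuous_onI)
  have rot: "(\<integral>z. G (\<rho> t z) \<partial>gamma_n) = (\<integral>z. G z \<partial>gamma_n)" "integrable gamma_n (\<lambda>z. G (\<rho> t z))" for t
    unfolding \<rho>_def using integral_gamma_n_rotate[of "cis (2 * pi * t)" G] I by simp_all
  have rotn: "(\<integral>z. cmod (G (\<rho> t z)) \<partial>gamma_n) = (\<integral>z. cmod (G z) \<partial>gamma_n)" for t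
    unfolding \<rho>_def using integral_gamma_n_rotate(1)[of "cis (2 * pi * t)" "\<lambda>z. cmod (G z)"] by simp
  have PI: "integrable (lborel \<Otimes>\<^sub>M gamma_n) (\<lambda>(t, z). indicator {0..1} t *\<^sub>R G (\<rho> t z))"
  proof (rule pair.Fubini_integrable)
    show "(\<lambda>(t, z). indicator {0..1} t *\<^sub>R G (\<rho> t z)) \<in> borel_measurable (lborel \<Otimes>\<^sub>M gamma_n)"
      by measurable
    show "integrable lborel (\<lambda>t. \<integral>z. norm (case (t, z) of (t, z) \<Rightarrow> indicator {0..1} t *\<^sub>R G (\<rho> t z)) \<partial>gamma_n)"
      by (simp add: rotn)
    show "AE t in lborel. integrable gamma_n (\<lambda>z. case (t, z) of (t, z) \<Rightarrow> indicator {0..1} t *\<^sub>R G (\<rho> t z))"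
      using rot(2) by simp
  qed
  have "(\<integral>w. G w \<partial>gamma_n) = (\<integral>t. indicator {0..1::real} t *\<^sub>R (\<integral>w. G w \<partial>gamma_n) \<partial>lborel)" by simp
  also have "\<dots> = (\<integral>t. (\<integral>z. indicator {0..1} t *\<^sub>R G (\<rho> t z) \<partial>gamma_n) \<partial>lborel)" by (simp add: rot)
  also have "\<dots> = (\<integral>z. (\<integral>t. indicator {0..1} t *\<^sub>R G (\<rho> t z) \<partial>lborel) \<partial>gamma_n)"
    using pair.Fubini_integral[OF PI] by simp
  also have "\<dots> = (\<integral>z. G (0 *s z) \<partial>gamma_n)"
    unfolding \<rho>_def circle_mean_value[OF holomorphic_Cn_line[OF G]] ..
  also have "\<dots> = G 0" using prob_space by simp
  finally show ?thesis .
qed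

text \<open>Translation by \<open>z\<close> changes the Gaussian weight by a factor that the kernel absorbs up to a holomorphic factor
equal to \<open>1\<close> at the origin, so that the integral is the Gaussian mean of a holomorphic function with value
\<open>F z\<close> at the origin.\<close>

lemma holomorphic_reproducing:
  fixes F :: "'n::finite cfun"
  assumes F: "F \<in> H_n"
  shows "L2_inner gamma_n F (kern z) = F z"
proof -
  let ?c = "of_nat CARD('n) :: complex"
  have hF: "holomorphic_Cn F" and FL: "F \<in> L2 gamma_n" using F by (auto simp: H_n_def)
  have Fm [measurable]: "F \<in> borel_measurable borel" by (rule holomorphic_Cn_measurable[OF hF])
  define G where "G w = F (w + z) * kern (- z) w" for w
  have km [measurable]: "kern x \<in> borel_measurable borel" for x :: "complex ^ 'n"
    by (rule tame_measurable[OF tame_kern[of 1]]) simp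
  have hG: "holomorphic_Cn G"
    unfolding holomorphic_Cn_def
  proof
    fix w
    obtain D where D: "(F has_derivative D) (at (w + z))" "\<And>c v. D (c *s v) = c * D v"
      using hF unfolding holomorphic_Cn_def by blast
    have "((\<lambda>w. w + z) has_derivative (\<lambda>v. v)) (at w)" by (auto intro!: derivative_eq_intros)
    from has_derivative_compose[OF this D(1)] have "((\<lambda>w. F (w + z)) has_derivative D) (at w)" by simp
    from has_derivative_mult[OF this kern_has_derivative]
    have "(G has_derivative (\<lambda>v. F (w + z) * (?c * cdot v (- z) * kern (- z) w) + D v * kern (- z) w)) (at w)"
      by (simp add: G_def[abs_def])
    moreover have "F (w + z) * (?c * cdot (c *s v) (- z) * kern (- z) w) + D (c *s v) * kern (- z) w
       = c * (F (w + z) * (?c * cdot v (- z) * kern (- z) w) + D v * kern (- z) w)" for c v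
      by (simp add: cdot_scale D(2) algebra_simps)
    ultimately show "\<exists>D. (G has_derivative D) (at w) \<and> (\<forall>c v. D (c *s v) = c * D v)" by blast
  qed
  have key: "gdens (w + z) *\<^sub>R (F (w + z) * cnj (kern z (w + z))) = gdens w *\<^sub>R G w" for w
  proof -
    have 1: "complex_of_real ((norm (w + z))\<^sup>2) = complex_of_real ((norm w)\<^sup>2) + cdot z w + cdot w z + cdot z z"
      unfolding cdot_self[symmetric] by (simp add: cdot_add_left cdot_add_right)
    have e: "complex_of_real (- real CARD('n) * x) = - ?c * complex_of_real x" for x by simp
    have neg: "cdot w (- z) = - cdot w z" by (simp add: cdot_def sum_negf)
    have "- ?c * complex_of_real ((norm (w + z))\<^sup>2) + ?c * cdot z (w + z)
        = - ?c * complex_of_real ((norm w)\<^sup>2) + ?c * cdot w (- z)"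
      unfolding 1 neg cdot_add_right by (simp only: algebra_simps) simp
    then have "exp (complex_of_real (- real CARD('n) * (norm (w + z))\<^sup>2)) * exp (?c * cdot z (w + z))
        = exp (complex_of_real (- real CARD('n) * (norm w)\<^sup>2)) * exp (?c * cdot w (- z))"
      unfolding exp_add[symmetric] e by (simp only:)
    then have "wt (w + z) * cnj (kern z (w + z)) = wt w * kern (- z) w"
      unfolding wt_def cnj_kern exp_of_real[symmetric] by (simp add: kern_def)
    then show ?thesis
      unfolding scaleR_conv_of_real gdens_wt G_def by (simp add: mult_ac)
  qed
  have I0: "integrable gamma_n (\<lambda>w. F w * cnj (kern z w))" by (rule L2_inner_integrable[OF FL kern_L2])
  then have I: "integrable lborel (\<lambda>w. gdens w *\<^sub>R (F w * cnj (kern z w)))"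
    by (subst (asm) integrable_gamma_n) auto
  have Gm [measurable]: "G \<in> borel_measurable borel" by (rule holomorphic_Cn_measurable[OF hG])
  have "integrable gamma_n G"
    using lborel_translation_integral(1)[OF I, of z] by (subst integrable_gamma_n) (auto simp: key)
  then have "(\<integral>w. G w \<partial>gamma_n) = F z"
    using gamma_n_mean_value[OF hG] by (simp add: G_def kern_def cdot_def)
  moreover have "L2_inner gamma_n F (kern z) = (\<integral>w. G w \<partial>gamma_n)"
    unfolding L2_inner_def
    using lborel_translation_integral(2)[OF I, of z] by (subst (1 2) integral_gamma_n) (auto simp: key)
  ultimately show ?thesis by simp
qed

text \<open>Integrating \<open>cnj (hm m)\<close> by parts against \<open>F\<close> would need bounds on the derivatives of \<open>F\<close>. Writing \<open>F\<close> as an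
integral against the kernel avoids them: by Fubini it is enough that the kernel is orthogonal to
\<open>hm m\<close>.\<close>

lemma H_n_orthogonal_hm:
  fixes F :: "complex ^ 'n::{finite,linorder} \<Rightarrow> complex"
  assumes F: "F \<in> H_n" and m: "m (k, True) \<noteq> 0"
  shows "L2_inner gamma_n F (hm m) = 0"
proof -
  interpret prob_space "gamma_n :: (complex ^ 'n::{finite,linorder}) measure" by (rule prob_space_gamma_n)
  interpret pair: pair_sigma_finite "gamma_n :: (complex ^ 'n::{finite,linorder}) measure" "gamma_n :: (complex ^ 'n::{finite,linorder}) measure" ..
  let ?c = "real CARD('n)"
  have c1: "?c \<ge> 1" by (simp add: Suc_leI)
  have FL: "F \<in> L2 gamma_n" using F by (simp add: H_n_def)
  have Fm [measurable]: "F \<in> borel_measurable borel" using FL by (simp add: L2_def)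
  have hmm [measurable]: "hm m \<in> borel_measurable borel" by (rule zpoly_measurable[OF zpoly_hm])
  have "continuous_on UNIV (\<lambda>(w, z). kern w z :: complex)" (is "continuous_on _ ?K")
    unfolding kern_def cdot_def case_prod_unfold by (intro continuous_intros)
  then have [measurable]: "(\<lambda>(w, z). kern w z :: complex) \<in> borel_measurable (borel \<Otimes>\<^sub>M (borel :: (complex ^ 'n::{finite,linorder}) measure))"
    unfolding borel_prod by (rule borel_measurable_continuous_onI)
  \<comment> \<open>from \<open>|w| |z| \<le> 3/4 |w|^2 + 1/3 |z|^2\<close>: the first exponent must stay below \<open>n\<close>, and the second below
    \<open>n / 2\<close>, as \<open>F\<close> is merely square-integrable\<close>
  define a where "a w = cmod (hm m w) * exp (3 / 4 * ?c * (norm w)\<^sup>2)" for w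
  define b where "b z = cmod (F z) * exp (1 / 3 * ?c * (norm z)\<^sup>2)" for z :: "complex ^ 'n::{finite,linorder}"
  have aI: "integrable gamma_n a"
  proof (rule growth_integrable_gamma[of _ "1 / 8 * ?c + 3 / 4 * ?c"])
    have "growth (1 / 8 * ?c) (\<lambda>w. cmod (hm m w))"
      using zpoly_growth[OF zpoly_hm, of "1 / 8 * ?c" m] c1 by (auto elim!: growth_le)
    moreover have "growth (3 / 4 * ?c) (\<lambda>w :: complex ^ 'n::{finite,linorder}. exp (3 / 4 * ?c * (norm w)\<^sup>2))"
      unfolding growth_def by (rule exI[of _ 1]) simp
    ultimately show "growth (1 / 8 * ?c + 3 / 4 * ?c) a" unfolding a_def by (rule growth_mult)
    show "a \<in> borel_measurable borel" unfolding a_def by measurable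
  qed (use c1 in simp)
  have bI: "integrable gamma_n b"
  proof -
    have "(\<lambda>z :: complex ^ 'n::{finite,linorder}. complex_of_real (exp (1 / 3 * ?c * (norm z)\<^sup>2))) \<in> L2 gamma_n"
      by (rule growth_L2_gamma[where \<delta> = "1 / 3 * ?c"]) (use c1 in \<open>auto simp: growth_def intro!: exI[of _ 1]\<close>)
    from integrable_norm[OF L2_mult_integrable[OF FL this]] show ?thesis
      by (simp add: b_def[abs_def] norm_mult)
  qed
  have PI: "integrable (gamma_n \<Otimes>\<^sub>M gamma_n) (\<lambda>(w, z). F z * cnj (kern w z) * cnj (hm m w))"
  proof (rule pair.integrable_pair_bound[OF _ aI bI])
    show "(\<lambda>(w, z). F z * cnj (kern w z) * cnj (hm m w)) \<in> borel_measurable (gamma_n \<Otimes>\<^sub>M gamma_n)"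
      by measurable
    fix w z :: "complex ^ 'n::{finite,linorder}"
    have "0 \<le> (3 / 2 * norm w - norm z)\<^sup>2" by simp
    then have "norm w * norm z \<le> 3 / 4 * (norm w)\<^sup>2 + 1 / 3 * (norm z)\<^sup>2"
      by (simp add: power2_eq_square algebra_simps)
    then have "?c * (norm w * norm z) \<le> ?c * (3 / 4 * (norm w)\<^sup>2 + 1 / 3 * (norm z)\<^sup>2)" by (intro mult_left_mono) auto
    then have "exp ((?c * norm w) * norm z) \<le> exp (3 / 4 * ?c * (norm w)\<^sup>2) * exp (1 / 3 * ?c * (norm z)\<^sup>2)"
      unfolding exp_add[symmetric] by (simp add: algebra_simps)
    with norm_kern_le[of w z] have "cmod (kern w z) \<le> exp (3 / 4 * ?c * (norm w)\<^sup>2) * exp (1 / 3 * ?c * (norm z)\<^sup>2)"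
      by linarith
    from mult_left_mono[OF this, of "cmod (F z) * cmod (hm m w)"]
    show "norm (F z * cnj (kern w z) * cnj (hm m w)) \<le> a w * b z"
      by (simp add: norm_mult a_def b_def mult_ac)
  qed
  have sym: "cnj (kern w z) = kern z w" for w z :: "complex ^ 'n::{finite,linorder}"
    by (simp add: cnj_kern) (simp add: kern_def)
  have "L2_inner gamma_n F (hm m) = (\<integral>w. (\<integral>z. F z * cnj (kern w z) * cnj (hm m w) \<partial>gamma_n) \<partial>gamma_n)"
    unfolding L2_inner_def[of _ F "hm m"]
    by (subst holomorphic_reproducing[OF F, symmetric]) (simp add: L2_inner_def)
  also have "\<dots> = (\<integral>z. (\<integral>w. F z * cnj (kern w z) * cnj (hm m w) \<partial>gamma_n) \<partial>gamma_n)"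
    using pair.Fubini_integral[OF PI] by simp
  also have "\<dots> = (\<integral>z. F z * L2_inner gamma_n (kern z) (hm m) \<partial>gamma_n)"
    by (simp add: L2_inner_def sym mult.assoc)
  also have "\<dots> = 0" by (simp add: kern_orthogonal_hm[of m k, OF m])
  finally show ?thesis .
qed

interpretation hm: orthonormal_family "gamma_n :: (complex ^ 'n::{finite,linorder}) measure" hm
  by (rule orthonormal_hm)

section \<open>Hermite expansions\<close>

inductive ladder_comb :: "'n::{finite,linorder} cfun \<Rightarrow> bool" where
  ladder_comb_zero: "ladder_comb (\<lambda>z. 0)"
| ladder_comb_step: "ladder_comb F \<Longrightarrow> ladder_comb (\<lambda>z. a * ladder m z + F z)"

lemma ladder_comb_add: "ladder_comb F \<Longrightarrow> ladder_comb G \<Longrightarrow> ladder_comb (\<lambda>z. F z + G z)"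
proof (induction rule: ladder_comb.induct)
  case (ladder_comb_step F a m)
  from ladder_comb.ladder_comb_step[OF ladder_comb_step.IH[OF ladder_comb_step.prems], of a m]
  show ?case by (simp add: add.assoc)
qed simp

lemma ladder_comb_ladder: "ladder_comb (\<lambda>z. a * ladder m z)"
  using ladder_comb_step[OF ladder_comb_zero] by simp

lemma ladder_comb_cmult: "ladder_comb F \<Longrightarrow> ladder_comb (\<lambda>z. b * F z)"
proof (induction rule: ladder_comb.induct)
  case (ladder_comb_step F a m)
  from ladder_comb.ladder_comb_step[OF ladder_comb_step.IH, of "b * a" m]
  show ?case by (simp add: distrib_left mult.assoc)
qed (simp add: ladder_comb_zero)

text \<open>Multiplication by a coordinate is, up to the factor \<open>n\<close>, the sum of a raising and a lowering
  operator.\<close>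

lemma ladder_comb_coord: "ladder_comb F \<Longrightarrow> ladder_comb (\<lambda>z. coord i z * F z)"
proof (induction rule: ladder_comb.induct)
  case (ladder_comb_step F a m)
  have "coord i z * ladder m z = (1 / of_nat CARD('a)) * ladder (m(i := Suc (m i))) z
      + of_nat (m (flip i)) * ladder (m(flip i := m (flip i) - 1)) z" for z
  proof -
    have "ladder (m(i := Suc (m i))) z = of_nat CARD('a) * coord i z * ladder m z - wirt (flip i) (ladder m) z"
      unfolding ladder_Suc by (rule raise_def)
    then have "of_nat CARD('a) * (coord i z * ladder m z) = ladder (m(i := Suc (m i))) z
        + of_nat CARD('a) * (of_nat (m (flip i)) * ladder (m(flip i := m (flip i) - 1)) z)"
      unfolding wirt_ladder by (simp add: algebra_simps del: fun_upd_apply)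
    then show ?thesis by (simp add: field_simps del: fun_upd_apply)
  qed
  then have "coord i z * (a * ladder m z + F z) = (a / of_nat CARD('a)) * ladder (m(i := Suc (m i))) z
      + ((a * of_nat (m (flip i))) * ladder (m(flip i := m (flip i) - 1)) z + coord i z * F z)" for z
    by (simp add: algebra_simps del: fun_upd_apply)
  then show ?case
    by (simp only:) (intro ladder_comb.ladder_comb_step ladder_comb_step.IH)
qed (simp add: ladder_comb_zero)

text \<open>The span of the ladder functions is closed under multiplication by the coordinates, hence by all
polynomials.\<close>

lemma zpoly_mult_ladder_comb: "zpoly P \<Longrightarrow> ladder_comb F \<Longrightarrow> ladder_comb (\<lambda>z. P z * F z)"
proof (induction arbitrary: F rule: zpoly.induct)
  case (zpoly_add P Q)
  then show ?case using ladder_comb_add by (auto simp: distrib_right)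
next
  case (zpoly_mult P Q)
  then show ?case by (auto simp: mult.assoc)
qed (auto intro: ladder_comb_cmult ladder_comb_coord)

lemma zpoly_ladder_comb: "zpoly P \<Longrightarrow> ladder_comb P"
  using zpoly_mult_ladder_comb[OF _ ladder_comb_ladder[of 1 "\<lambda>_. 0"], of P] by (simp add: ladder_0)

lemma zpoly_ladder_comb_zpoly: "ladder_comb P \<Longrightarrow> zpoly P"
proof (induction rule: ladder_comb.induct)
  case (ladder_comb_step F a m)
  show ?case by (rule zpoly_add[OF zpoly_cmult[OF zpoly_ladder] ladder_comb_step.IH])
qed (rule zpoly_const)

lemma ladder_eq_hm: "ladder m = (\<lambda>z. complex_of_real (sqrt (idx_weight m)) * hm m z)"
  using idx_weight_pos[of m] by (simp add: hm_def fun_eq_iff)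

lemma orthogonal_hm_imp_orthogonal_zpoly:
  assumes u: "u \<in> L2 gamma_n" and orth: "\<And>m. hm.coef u m = 0" and P: "zpoly P"
  shows "L2_inner gamma_n P u = 0"
  using zpoly_ladder_comb[OF P]
proof (induction rule: ladder_comb.induct)
  case ladder_comb_zero
  show ?case by (simp add: L2_inner_def)
next
  case (ladder_comb_step F a m)
  have "L2_inner gamma_n (hm m) u = 0"
    using orth[of m] by (subst L2_inner_commute) (simp add: hm.coef_def)
  then have "L2_inner gamma_n (\<lambda>z. a * ladder m z) u = 0"
    unfolding L2_inner_cmult_left ladder_eq_hm by simp
  then show ?case
    using ladder_comb_step u by (subst L2_inner_add_left)
      (auto intro: zpoly_L2_gamma zpoly_cmult zpoly_ladder zpoly_ladder_comb_zpoly)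
qed

text \<open>The difference between \<open>g\<close> and its Fourier series is orthogonal to all polynomials; orthogonality to \<open>g\<close>
as well forces its norm to vanish.\<close>

lemma hm_cspan_UNIV_I:
  assumes g: "g \<in> L2 gamma_n"
    and complete: "\<And>u. u \<in> L2 gamma_n \<Longrightarrow> (\<And>P. zpoly P \<Longrightarrow> L2_inner gamma_n P u = 0) \<Longrightarrow> L2_inner gamma_n g u = 0"
  shows "g \<in> hm.cspan UNIV"
proof -
  obtain v where v: "v \<in> hm.cspan UNIV" "\<And>i. hm.coef v i = (if i \<in> UNIV then hm.coef g i else 0)"
    using hm.cspan_projection_ex[OF g] by blast
  have vL: "v \<in> L2 gamma_n" using v(1) by (rule hm.cspan_L2)
  define u where "u z = g z - v z" for z
  have uL: "u \<in> L2 gamma_n" unfolding u_def by (rule L2_minus[OF g vL])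
  have cu: "hm.coef u m = 0" for m unfolding u_def by (simp add: hm.coef_diff[OF g vL] v)
  have "L2_inner gamma_n g u = 0"
    by (rule complete[OF uL orthogonal_hm_imp_orthogonal_zpoly[OF uL cu]])
  moreover have "L2_inner gamma_n v u = 0"
    by (rule hm.cspan_inner_eq_0[OF v(1) uL])
       (use cu in \<open>simp add: hm.coef_def L2_inner_commute[of _ "hm _" u]\<close>)
  ultimately have "L2_inner gamma_n u u = 0"
    using L2_inner_diff_left[OF g vL uL] by (simp add: u_def[abs_def])
  then have "L2_norm gamma_n u = 0" by (simp add: L2_inner_self)
  then have "AE z in gamma_n. g z = v z"
    using L2_norm_eq_0_AE[OF uL] by (simp add: u_def)
  then have "L2_norm gamma_n g = L2_norm gamma_n v"
    by (rule L2_norm_cong_AE) (use g vL in \<open>auto simp: L2_def\<close>)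
  then show ?thesis
    using hm.Parseval[OF v(1)] by (intro hm.cspanI[OF g]) (simp add: v)
qed

lemma zpoly_cspan: "zpoly P \<Longrightarrow> P \<in> hm.cspan UNIV"
  by (rule hm_cspan_UNIV_I[OF zpoly_L2_gamma])

section \<open>The holomorphic part\<close>

text \<open>The degree \<open>|q|\<close> in the antiholomorphic raising operators, which grades the Hermite expansion.\<close>

definition bdeg :: "('n::finite \<times> bool \<Rightarrow> nat) \<Rightarrow> nat" where
  "bdeg m = (\<Sum>k\<in>UNIV. m (k, True))"

lemma bdeg_eq_0: "bdeg m = 0 \<longleftrightarrow> (\<forall>k. m (k, True) = 0)"
  by (simp add: bdeg_def)

lemma hermite_space_eq:
  "(hermite_space d :: 'n::{finite,linorder} cfun set) = hm.cspan {m. bdeg m = d}"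
proof -
  have "{hermite p q | p q :: nat ^ 'n::{finite,linorder}. mi_abs q = d} = hm ` {m. bdeg m = d}"
  proof (intro equalityI subsetI)
    fix F assume "F \<in> {hermite p q | p q :: nat ^ 'n::{finite,linorder}. mi_abs q = d}"
    then show "F \<in> hm ` {m. bdeg m = d}"
      by (auto simp: hermite_eq_hm bdeg_def join_idx_def mi_abs_def)
  next
    fix F :: "'n cfun" assume "F \<in> hm ` {m. bdeg m = d}"
    then obtain m where m: "F = hm m" "bdeg m = d" by auto
    have "m = join_idx (\<chi> k. m (k, False)) (\<chi> k. m (k, True))"
      by (rule ext) (auto simp: join_idx_def)
    then have "F = hermite (\<chi> k. m (k, False)) (\<chi> k. m (k, True))"
      using m(1) by (simp add: hermite_eq_hm)
    moreover have "mi_abs (\<chi> k. m (k, True)) = d" using m(2) by (simp add: mi_abs_def bdeg_def)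
    ultimately show "F \<in> {hermite p q | p q :: nat ^ 'n::{finite,linorder}. mi_abs q = d}" by blast
  qed
  then show ?thesis unfolding hermite_space_def hm.cspan_def by simp
qed

text \<open>The Cauchy--Riemann equations make the Frechet derivative complex linear.\<close>

lemma holomorphic_CnI:
  fixes F :: "'n::finite cfun"
  assumes d: "\<And>z. F differentiable at z" and cr: "\<And>z k. wirt (k, True) F z = 0"
  shows "holomorphic_Cn F"
  unfolding holomorphic_Cn_def
proof
  fix z
  define D where "D v = dir_deriv v F z" for v
  have D: "(F has_derivative D) (at z)" unfolding D_def by (rule has_dir_deriv[OF d])
  then have lin: "linear D" by (rule has_derivative_linear)
  have i: "D (axis k \<i>) = \<i> * D (axis k 1)" for k
  proof -
    have "D (axis k 1) + \<i> * D (axis k \<i>) = 0" using cr[of k z] by (simp add: wirt_def D_def)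
    then have "\<i> * (D (axis k 1) + \<i> * D (axis k \<i>)) = 0" by simp
    then show ?thesis by (simp add: algebra_simps)
  qed
  have ax: "D (axis k a) = a * D (axis k 1)" for k a
  proof -
    have "axis k a = Re a *\<^sub>R axis k 1 + Im a *\<^sub>R axis k \<i>"
      by (auto simp: vec_eq_iff axis_def complex_eq_iff)
    then have "D (axis k a) = Re a *\<^sub>R D (axis k 1) + Im a *\<^sub>R D (axis k \<i>)"
      by (simp add: linear_add[OF lin] linear_cmul[OF lin])
    also have "\<dots> = (complex_of_real (Re a) + \<i> * complex_of_real (Im a)) * D (axis k 1)"
      by (simp add: i scaleR_conv_of_real algebra_simps)
    also have "complex_of_real (Re a) + \<i> * complex_of_real (Im a) = a" by (simp add: complex_eq[symmetric])
    finally show ?thesis .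
  qed
  have sum: "D v = (\<Sum>k\<in>UNIV. v $ k * D (axis k 1))" for v
  proof -
    have e: "v = (\<Sum>k\<in>UNIV. axis k (v $ k))"
      by (simp add: vec_eq_iff axis_def if_distrib cong: if_cong)
    have "D v = D (\<Sum>k\<in>UNIV. axis k (v $ k))" by (rule arg_cong[OF e])
    also have "\<dots> = (\<Sum>k\<in>UNIV. D (axis k (v $ k)))" by (rule linear_sum[OF lin])
    also have "\<dots> = (\<Sum>k\<in>UNIV. v $ k * D (axis k 1))" by (intro sum.cong refl ax)
    finally show ?thesis .
  qed
  have "D (c *s v) = c * D v" for c v
    unfolding sum[of "c *s v"] sum[of v] by (simp add: sum_distrib_left mult.assoc)
  then show "\<exists>D. (F has_derivative D) (at z) \<and> (\<forall>c v. D (c *s v) = c * D v)" using D by blast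
qed

lemma hm_H_n:
  assumes "bdeg m = 0"
  shows "hm m \<in> H_n"
proof -
  have "holomorphic_Cn (hm m)"
  proof (rule holomorphic_CnI)
    fix k z
    show "wirt (k, True) (hm m) z = 0"
      using assms unfolding hm_def[abs_def]
      by (subst wirt_cmult) (simp_all add: zpoly_differentiable zpoly_ladder wirt_ladder bdeg_eq_0)
  qed (rule zpoly_differentiable[OF zpoly_hm])
  then show ?thesis by (simp add: H_n_def zpoly_L2_gamma zpoly_hm)
qed

lemma holomorphic_Cn_diff:
  assumes "holomorphic_Cn F" "holomorphic_Cn G"
  shows "holomorphic_Cn (\<lambda>z. F z - G z)"
  unfolding holomorphic_Cn_def
proof
  fix z
  obtain D where "(F has_derivative D) (at z)" "\<And>c v. D (c *s v) = c * D v"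
    using assms(1) unfolding holomorphic_Cn_def by blast
  moreover obtain E where "(G has_derivative E) (at z)" "\<And>c v. E (c *s v) = c * E v"
    using assms(2) unfolding holomorphic_Cn_def by blast
  ultimately show "\<exists>D. ((\<lambda>z. F z - G z) has_derivative D) (at z) \<and> (\<forall>c v. D (c *s v) = c * D v)"
    by (intro exI[of _ "\<lambda>v. D v - E v"]) (auto intro: has_derivative_diff simp: algebra_simps)
qed

lemma H_n_diff: "F \<in> H_n \<Longrightarrow> G \<in> H_n \<Longrightarrow> (\<lambda>z. F z - G z) \<in> H_n"
  by (simp add: H_n_def L2_minus holomorphic_Cn_diff)

text \<open>The kernel reproduces the holomorphic Hermite polynomials pointwise, hence also their limits in norm; the
transform is thus an entire representative of the limit.\<close>

lemma kern_transform_AE: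
  fixes g0 :: "'n::{finite,linorder} cfun"
  assumes g0: "g0 \<in> hm.cspan {m. bdeg m = 0}"
  shows "AE z in gamma_n. g0 z = L2_inner gamma_n g0 (kern z)"
proof -
  \<comment> \<open>partial sums converge to \<open>g0\<close> in norm, and pointwise to \<open>b\<close>, as the kernel reproduces them\<close>
  define b where "b z = L2_inner gamma_n g0 (kern z)" for z
  have gL: "g0 \<in> L2 gamma_n" using g0 by (rule hm.cspan_L2)
  have bm: "b \<in> borel_measurable borel"
    unfolding b_def by (rule holomorphic_Cn_measurable[OF holomorphic_kern_transform[OF gL]])
  have "\<exists>T. finite T \<and> T \<subseteq> {m. bdeg m = 0} \<and>
      L2_norm gamma_n (\<lambda>x. g0 x - (\<Sum>i\<in>T. hm.coef g0 i * hm i x)) < 1 / real (Suc N)" for N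
  proof -
    have "1 / real (Suc N) > 0" by simp
    then obtain T where "finite T" "T \<subseteq> {m. bdeg m = 0}"
      "L2_norm gamma_n (\<lambda>x. g0 x - (\<Sum>i\<in>T. hm.coef g0 i * hm i x)) < 1 / real (Suc N)"
      by (rule hm.cspan_approx[OF g0])
    then show ?thesis by (intro exI[of _ T] conjI)
  qed
  then have "\<forall>N. \<exists>T. finite T \<and> T \<subseteq> {m. bdeg m = 0} \<and>
      L2_norm gamma_n (\<lambda>x. g0 x - (\<Sum>i\<in>T. hm.coef g0 i * hm i x)) < 1 / real (Suc N)" ..
  from choice[OF this] obtain T where "\<forall>N. finite (T N) \<and> T N \<subseteq> {m. bdeg m = 0} \<and>
      L2_norm gamma_n (\<lambda>x. g0 x - (\<Sum>i\<in>T N. hm.coef g0 i * hm i x)) < 1 / real (Suc N)" ..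
  then have T: "\<And>N. finite (T N)" "\<And>N. T N \<subseteq> {m. bdeg m = 0}"
      "\<And>N. L2_norm gamma_n (\<lambda>x. g0 x - (\<Sum>i\<in>T N. hm.coef g0 i * hm i x)) < 1 / real (Suc N)"
    by simp_all
  define s where "s N x = (\<Sum>i\<in>T N. hm.coef g0 i * hm i x)" for N x
  have sL: "s N \<in> L2 gamma_n" for N unfolding s_def by (rule hm.comb_L2)
  have s_rep: "L2_inner gamma_n (s N) (kern z) = s N z" for N z
    unfolding s_def hm.inner_comb_left[OF kern_L2]
    using T(2) by (intro sum.cong refl) (subst holomorphic_reproducing[OF hm_H_n], auto)
  have lim0: "(\<lambda>N. 1 / real (Suc N)) \<longlonglongrightarrow> 0" by (rule LIMSEQ_Suc[OF lim_1_over_n])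
  have lim: "(\<lambda>N. g0 z - s N z) \<longlonglongrightarrow> g0 z - b z" for z
  proof -
    have "cmod (b z - s N z) \<le> 1 / real (Suc N) * L2_norm gamma_n (kern z)" for N
    proof -
      have "b z - s N z = L2_inner gamma_n (\<lambda>x. g0 x - s N x) (kern z)"
        using L2_inner_diff_left[OF gL sL kern_L2] by (simp add: b_def s_rep)
      also have "cmod \<dots> \<le> L2_norm gamma_n (\<lambda>x. g0 x - s N x) * L2_norm gamma_n (kern z)"
        by (rule L2_Cauchy_Schwarz[OF L2_minus[OF gL sL] kern_L2])
      also have "\<dots> \<le> 1 / real (Suc N) * L2_norm gamma_n (kern z)"
        using T(3)[of N] by (intro mult_right_mono L2_norm_nonneg) (simp add: s_def)
      finally show ?thesis .
    qed
    moreover have "(\<lambda>N. 1 / real (Suc N) * L2_norm gamma_n (kern z)) \<longlonglongrightarrow> 0 * L2_norm gamma_n (kern z)"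
      by (intro tendsto_mult lim0 tendsto_const)
    ultimately have "(\<lambda>N. b z - s N z) \<longlonglongrightarrow> 0"
      by (intro Lim_null_comparison[OF always_eventually, OF allI, of "\<lambda>N. b z - s N z"
            "\<lambda>N. 1 / real (Suc N) * L2_norm gamma_n (kern z)" sequentially]) (simp_all only: mult_zero_left)
    from tendsto_diff[OF tendsto_const[of "b z"] this] have "(\<lambda>N. s N z) \<longlonglongrightarrow> b z" by simp
    then show ?thesis by (intro tendsto_intros)
  qed
  have "L2_norm gamma_n (\<lambda>z. g0 z - b z) \<le> 1 / real (Suc K) \<and> (\<lambda>z. g0 z - b z) \<in> L2 gamma_n" for K
  proof -
    have a: "(\<lambda>z. g0 z - s (N + K) z) \<in> L2 gamma_n" for N by (rule L2_minus[OF gL sL])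
    have "g0 \<in> borel_measurable borel" using gL by (simp add: L2_def)
    then have m: "(\<lambda>z. g0 z - b z) \<in> borel_measurable gamma_n"
      unfolding measurable_gamma_n using bm by (rule borel_measurable_diff)
    have l: "AE z in gamma_n. (\<lambda>N. g0 z - s (N + K) z) \<longlonglongrightarrow> g0 z - b z"
      by (intro AE_I2 LIMSEQ_ignore_initial_segment lim)
    have "L2_norm gamma_n (\<lambda>z. g0 z - s (N + K) z) \<le> 1 / real (Suc K)" for N
    proof -
      have "L2_norm gamma_n (\<lambda>z. g0 z - s (N + K) z) \<le> 1 / real (Suc (N + K))"
        using T(3)[of "N + K"] by (simp add: s_def less_imp_le)
      also have "\<dots> \<le> 1 / real (Suc K)" by (simp add: frac_le)
      finally show ?thesis .
    qed
    from L2_AE_limit[OF a m l this] show ?thesis by blast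
  qed
  then have "L2_norm gamma_n (\<lambda>z. g0 z - b z) \<le> 0" and dL: "(\<lambda>z. g0 z - b z) \<in> L2 gamma_n"
    using LIMSEQ_le_const[OF lim0, of "L2_norm gamma_n (\<lambda>z. g0 z - b z)"] by blast+
  then have "L2_norm gamma_n (\<lambda>z. g0 z - b z) = 0" using L2_norm_nonneg by (metis antisym)
  from L2_norm_eq_0_AE[OF dL this] show ?thesis by (simp add: b_def)
qed

text \<open>Both spaces contain a representative of the same class: the kernel transform of the degree \<open>0\<close> component is
entire, and the remaining components are orthogonal to every holomorphic function.\<close>

lemma L2_proj_H_n_AE:
  fixes g :: "'n::{finite,linorder} cfun"
  assumes g: "g \<in> hm.cspan UNIV"
  shows "AE z in gamma_n. L2_proj gamma_n (hermite_space 0) g z = L2_proj gamma_n H_n g z"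
    and "L2_proj gamma_n H_n g \<in> L2 gamma_n"
proof -
  define g0 where "g0 = L2_proj gamma_n (hermite_space 0) g"
  define u where "u = L2_proj gamma_n H_n g"
  have gL: "g \<in> L2 gamma_n" using g by (rule hm.cspan_L2)
  have g0: "g0 \<in> hm.cspan {m. bdeg m = 0}" and cg0: "\<And>m. hm.coef g0 m = (if bdeg m = 0 then hm.coef g m else 0)"
    using hm.L2_proj_cspan[OF gL, of "{m. bdeg m = 0}"] by (simp_all add: g0_def hermite_space_eq)
  have g0L: "g0 \<in> L2 gamma_n" using g0 by (rule hm.cspan_L2)
  define b where "b z = L2_inner gamma_n g0 (kern z)" for z
  have ae: "AE z in gamma_n. g0 z = b z" unfolding b_def by (rule kern_transform_AE[OF g0])
  have hb: "holomorphic_Cn b" unfolding b_def by (rule holomorphic_kern_transform[OF g0L])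
  have bm: "b \<in> borel_measurable borel" by (rule holomorphic_Cn_measurable[OF hb])
  have bL: "b \<in> L2 gamma_n"
    by (rule L2_bound[OF _ L2_integrable[OF g0L]]) (use bm ae in \<open>auto elim: eventually_mono\<close>)
  have bH: "b \<in> H_n" using hb bL by (simp add: H_n_def)
  have dU: "(\<lambda>z. g z - g0 z) \<in> hm.cspan UNIV"
    using g hm.cspan_mono[of "{m. bdeg m = 0}" UNIV] g0 by (intro hm.cspan_diff) auto
  have orth: "L2_inner gamma_n (\<lambda>z. g z - b z) F = 0" if F: "F \<in> H_n" for F
  proof -
    have FL: "F \<in> L2 gamma_n" using F by (simp add: H_n_def)
    have "L2_inner gamma_n (\<lambda>z. g z - b z) F = L2_inner gamma_n (\<lambda>z. g z - g0 z) F"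
      by (rule L2_inner_cong_AE) (use ae gL g0L bm FL in \<open>auto simp: L2_def elim: eventually_mono\<close>)
    also have "\<dots> = 0"
    proof (rule hm.cspan_inner_eq_0[OF dU FL])
      fix m :: "'n \<times> bool \<Rightarrow> nat"
      show "hm.coef (\<lambda>z. g z - g0 z) m * L2_inner gamma_n (hm m) F = 0"
      proof (cases "bdeg m = 0")
        case True
        then show ?thesis by (simp add: hm.coef_diff[OF gL g0L] cg0)
      next
        case False
        then obtain k where "m (k, True) \<noteq> 0" by (auto simp: bdeg_eq_0)
        from H_n_orthogonal_hm[of F m k, OF F this] show ?thesis by (subst L2_inner_commute[of _ "hm m"]) simp
      qed
    qed
    finally show ?thesis .
  qed
  then have "\<exists>v. v \<in> H_n \<and> (\<forall>F\<in>H_n. L2_inner gamma_n (\<lambda>z. g z - v z) F = 0)" using bH by blast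
  from someI_ex[OF this] have u: "u \<in> H_n" "\<And>F. F \<in> H_n \<Longrightarrow> L2_inner gamma_n (\<lambda>z. g z - u z) F = 0"
    unfolding u_def L2_proj_def by blast+
  have uL: "u \<in> L2 gamma_n" using u(1) by (simp add: H_n_def)
  then show "L2_proj gamma_n H_n g \<in> L2 gamma_n" by (simp add: u_def)
  have w: "(\<lambda>z. u z - b z) \<in> H_n" by (rule H_n_diff[OF u(1) bH])
  have wL: "(\<lambda>z. u z - b z) \<in> L2 gamma_n" by (rule L2_minus[OF uL bL])
  have "L2_inner gamma_n (\<lambda>z. u z - b z) (\<lambda>z. u z - b z)
     = L2_inner gamma_n (\<lambda>z. (g z - b z) - (g z - u z)) (\<lambda>z. u z - b z)" by simp
  also have "\<dots> = 0"
    by (subst L2_inner_diff_left[OF L2_minus[OF gL bL] L2_minus[OF gL uL] wL]) (simp add: orth[OF w] u(2)[OF w])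
  finally have "L2_norm gamma_n (\<lambda>z. u z - b z) = 0" by (simp add: L2_inner_self)
  from L2_norm_eq_0_AE[OF wL this] ae show "AE z in gamma_n. L2_proj gamma_n (hermite_space 0) g z = L2_proj gamma_n H_n g z"
    unfolding g0_def[symmetric] u_def[symmetric] by eventually_elim simp
qed

section \<open>The Vandermonde polynomial\<close>

definition pairs :: "('n::{finite,linorder} \<times> 'n) set" where
  "pairs = {(j, k). j < k}"

definition permute_coords :: "('n \<Rightarrow> 'n) \<Rightarrow> complex ^ 'n::finite \<Rightarrow> complex ^ 'n" where
  "permute_coords \<pi> z = (\<chi> j. z $ \<pi> j)"

text \<open>The sign of \<open>\<pi>\<close> in terms of its inversions; this is the form that arises from reordering the factors of the
Vandermonde product.\<close>

definition inv_sign :: "('n::{finite,linorder} \<Rightarrow> 'n) \<Rightarrow> complex" where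
  "inv_sign \<pi> = (\<Prod>(j, k)\<in>pairs. if \<pi> j < \<pi> k then 1 else -1)"

lemma vandermonde_pairs: "vandermonde z = (\<Prod>(j, k)\<in>pairs. z $ k - z $ j)"
  by (simp add: vandermonde_def pairs_def)

lemma zpoly_vandermonde: "zpoly vandermonde"
  unfolding vandermonde_pairs[abs_def] case_prod_unfold
  by (intro zpoly_prod zpoly_diff zpoly_nth)

lemma inv_sign_sq: "inv_sign \<pi> * inv_sign \<pi> = 1"
  unfolding inv_sign_def prod.distrib[symmetric] by (rule prod.neutral) auto

lemma inv_sign_cases: "inv_sign \<pi> = 1 \<or> inv_sign \<pi> = -1"
  using inv_sign_sq[of \<pi>] by (simp add: square_eq_1_iff)

text \<open>A permutation of the coordinates permutes the factors, which are indexed by unordered pairs, and changes the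
sign of those whose order is reversed.\<close>

lemma vandermonde_permute:
  fixes z :: "complex ^ 'n::{finite,linorder}"
  assumes \<pi>: "inj \<pi>"
  shows "vandermonde (permute_coords \<pi> z) = inv_sign \<pi> * vandermonde z"
proof -
  define \<sigma> where "\<sigma> = (\<lambda>(j, k). (min (\<pi> j) (\<pi> k), max (\<pi> j) (\<pi> k)))"
  have ne: "\<pi> j \<noteq> \<pi> k" if "j < k" for j k using \<pi> that by (auto simp: inj_eq)
  have inj: "inj_on \<sigma> pairs"
  proof (rule inj_onI, clarify)
    fix j k j' k' :: 'n
    assume p: "(j, k) \<in> pairs" "(j', k') \<in> pairs" and eq: "\<sigma> (j, k) = \<sigma> (j', k')"
    have "{\<pi> j, \<pi> k} = {\<pi> j', \<pi> k'}"
      using eq by (auto simp: \<sigma>_def min_def max_def split: if_splits)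
    then have "\<pi> ` {j, k} = \<pi> ` {j', k'}" by simp
    then have "{j, k} = {j', k'}" using \<pi> by (simp only: inj_image_eq_iff)
    then show "j = j' \<and> k = k'" using p by (auto simp: pairs_def doubleton_eq_iff)
  qed
  have sub: "\<sigma> ` pairs \<subseteq> pairs"
  proof
    fix x assume "x \<in> \<sigma> ` pairs"
    then obtain j k where jk: "(j, k) \<in> pairs" "x = \<sigma> (j, k)" by auto
    then have "\<pi> j \<noteq> \<pi> k" using ne by (simp add: pairs_def)
    then show "x \<in> pairs" unfolding jk(2) by (cases "\<pi> j < \<pi> k") (auto simp: \<sigma>_def pairs_def)
  qed
  have im: "\<sigma> ` pairs = pairs" by (rule endo_inj_surj[OF _ sub inj]) simp
  have "vandermonde (permute_coords \<pi> z)
     = (\<Prod>p\<in>pairs. (case p of (j, k) \<Rightarrow> if \<pi> j < \<pi> k then 1 else -1) * (case \<sigma> p of (j, k) \<Rightarrow> z $ k - z $ j))"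
    unfolding vandermonde_pairs by (rule prod.cong) (auto simp: permute_coords_def \<sigma>_def min_def max_def)
  also have "\<dots> = inv_sign \<pi> * (\<Prod>p\<in>pairs. case \<sigma> p of (j, k) \<Rightarrow> z $ k - z $ j)"
    unfolding prod.distrib inv_sign_def ..
  also have "(\<Prod>p\<in>pairs. case \<sigma> p of (j, k) \<Rightarrow> z $ k - z $ j) = (\<Prod>p\<in>\<sigma> ` pairs. case p of (j, k) \<Rightarrow> z $ k - z $ j)"
    by (subst prod.reindex[OF inj]) (simp add: o_def)
  finally show ?thesis by (simp only: im vandermonde_pairs)
qed

text \<open>The transposition negates the factor \<open>z_b - z_a\<close> of \<open>V\<close>, so that it multiplies the product of all other factors by
\<open>- inv_sign\<close>, at first where \<open>z_a \<noteq> z_b\<close> and then everywhere by continuity. At a point whose only collision is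
\<open>z_a = z_b\<close> that product is non-zero and the transposition has no effect, hence \<open>- inv_sign = 1\<close>.\<close>

lemma inv_sign_transpose:
  fixes a b :: "'n::{finite,linorder}"
  assumes ab: "a < b"
  shows "inv_sign (Transposition.transpose a b) = -1"
proof -
  define R where "R z = (\<Prod>(j, k)\<in>pairs - {(a, b)}. z $ k - z $ j)" for z :: "complex ^ 'n::{finite,linorder}"
  have VR: "vandermonde z = (z $ b - z $ a) * R z" for z :: "complex ^ 'n::{finite,linorder}"
    unfolding vandermonde_pairs R_def by (subst prod.remove[of _ "(a, b)"]) (use ab in \<open>auto simp: pairs_def\<close>)
  let ?T = "permute_coords (Transposition.transpose a b) :: complex ^ 'n::{finite,linorder} \<Rightarrow> _"
  have anti: "R (?T z) = - inv_sign (Transposition.transpose a b) * R z" if "z $ a \<noteq> z $ b" for z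
  proof -
    have "(z $ a - z $ b) * R (?T z) = inv_sign (Transposition.transpose a b) * ((z $ b - z $ a) * R z)"
      using vandermonde_permute[of "Transposition.transpose a b" z] by (simp add: VR permute_coords_def)
    then have "(z $ a - z $ b) * R (?T z) = (z $ a - z $ b) * (- inv_sign (Transposition.transpose a b) * R z)"
      by (simp add: algebra_simps)
    then show ?thesis using that by (subst (asm) mult_cancel_left) auto
  qed
  obtain f :: "'n \<Rightarrow> nat" where f: "inj f"
    using finite_imp_inj_to_nat_seg[of "UNIV :: 'n set"] by auto
  \<comment> \<open>coordinates \<open>a\<close> and \<open>b\<close> collide at \<open>t = 0\<close>, all others stay apart\<close>
  define w where "w t = (\<chi> j. if j = b then of_nat (f a) + complex_of_real t else of_nat (f j))" for t
  have wc: "continuous_on UNIV (\<lambda>t. w t $ j)" for j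
    by (cases "j = b") (auto simp: w_def intro!: continuous_intros)
  have "continuous_on UNIV (\<lambda>t. R (w t))" "continuous_on UNIV (\<lambda>t. R (?T (w t)))"
    unfolding R_def permute_coords_def case_prod_unfold by (auto intro!: continuous_intros wc)
  then have lim: "(\<lambda>m. R (w (1 / real (Suc m)))) \<longlonglongrightarrow> R (w 0)"
      "(\<lambda>m. R (?T (w (1 / real (Suc m))))) \<longlonglongrightarrow> R (?T (w 0))"
    using LIMSEQ_Suc[OF lim_1_over_n[where 'a = real]]
    by (auto intro!: isCont_tendsto_compose[of 0 "\<lambda>t. R (w t)"] isCont_tendsto_compose[of 0 "\<lambda>t. R (?T (w t))"]
        simp: continuous_on_eq_continuous_at)
  have "R (?T (w (1 / real (Suc m)))) = - inv_sign (Transposition.transpose a b) * R (w (1 / real (Suc m)))" for m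
  proof (rule anti)
    have "complex_of_real (1 / real (Suc m)) \<noteq> 0" unfolding of_real_eq_0_iff by simp
    then show "w (1 / real (Suc m)) $ a \<noteq> w (1 / real (Suc m)) $ b"
      using less_imp_neq[OF ab] by (simp add: w_def del: of_nat_Suc of_real_divide)
  qed
  with lim(2) have "(\<lambda>m. - inv_sign (Transposition.transpose a b) * R (w (1 / real (Suc m)))) \<longlonglongrightarrow> R (?T (w 0))" by simp
  moreover have "(\<lambda>m. - inv_sign (Transposition.transpose a b) * R (w (1 / real (Suc m)))) \<longlonglongrightarrow> - inv_sign (Transposition.transpose a b) * R (w 0)"
    by (intro tendsto_mult tendsto_const lim(1))
  ultimately have "R (?T (w 0)) = - inv_sign (Transposition.transpose a b) * R (w 0)" by (rule LIMSEQ_unique)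
  moreover have "?T (w 0) = w 0" using ab by (auto simp: vec_eq_iff permute_coords_def w_def Transposition.transpose_def)
  moreover have "R (w 0) \<noteq> 0"
    unfolding R_def using f ab
    by (auto simp: pairs_def w_def inj_eq prod_zero_iff split: if_splits)
  ultimately show ?thesis using inv_sign_cases[of "Transposition.transpose a b"] by auto
qed

lemma wirt_vandermonde: "wirt (k, True) (vandermonde :: 'n::{finite,linorder} cfun) z = 0"
proof -
  have "wirt (k, True) (\<lambda>z. \<Prod>p\<in>A. z $ snd p - z $ fst p) z = 0" if "finite A" for A :: "('n \<times> 'n) set"
    using that
  proof (induction A)
    case (insert p A)
    have nth: "wirt (k, True) (\<lambda>z. z $ j) z = 0" for j
      using wirt_coord[of "(k, True)" "(j, False)" z] by (simp add: coord_def[abs_def])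
    have "wirt (k, True) (\<lambda>z. z $ snd p - z $ fst p) z = 0"
      by (subst wirt_diff) (simp_all add: nth zpoly_differentiable zpoly_nth)
    then show ?case
      using insert by (simp add: wirt_mult zpoly_differentiable zpoly_diff zpoly_nth zpoly_prod)
  qed (simp add: wirt_const)
  then show ?thesis unfolding vandermonde_pairs[abs_def] case_prod_unfold by simp
qed

lemma vandermonde_smult: "vandermonde (a *s z) = a ^ card (pairs :: ('n::{finite,linorder} \<times> 'n) set) * vandermonde z"
  for z :: "complex ^ 'n::{finite,linorder}"
  by (simp add: vandermonde_pairs case_prod_unfold right_diff_distrib[symmetric] prod.distrib)

text \<open>The zero set lies in a finite union of real hyperplanes: already the vanishing of the real part of
\<open>z_k - z_j\<close> is a null condition.\<close>

lemma AE_vandermonde_nonzero: "AE z in lborel. vandermonde (z :: complex ^ 'n::{finite,linorder}) \<noteq> 0"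
proof -
  have "AE z :: complex ^ 'n::{finite,linorder} in lborel. z $ k - z $ j \<noteq> 0" if jk: "j < k" for j k :: 'n
  proof -
    define v :: "complex ^ 'n::{finite,linorder}" where "v = axis k 1 - axis j 1"
    have v: "v \<noteq> 0" using jk by (auto simp: v_def vec_eq_iff axis_def)
    have "negligible {z. v \<bullet> z = 0}" using v by (intro negligible_hyperplane) auto
    then have "{z. v \<bullet> z = 0} \<in> null_sets lebesgue" by (simp add: negligible_iff_null_sets)
    moreover have "{z. v \<bullet> z = 0} \<in> sets borel" by (intro borel_closed closed_hyperplane)
    ultimately have "{z. v \<bullet> z = 0} \<in> null_sets lborel" by (simp add: null_sets_def)
    then have "AE z in lborel. z \<notin> {z. v \<bullet> z = 0}" by (rule AE_not_in)
    then show ?thesis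
    proof eventually_elim
      case (elim z)
      then show ?case by (auto simp: v_def inner_diff_left inner_axis' inner_complex_def)
    qed
  qed
  then have "AE z :: complex ^ 'n::{finite,linorder} in lborel. \<forall>p\<in>pairs. z $ snd p - z $ fst p \<noteq> 0"
    by (intro AE_finite_allI) (auto simp: pairs_def)
  then show ?thesis
    by eventually_elim (auto simp: vandermonde_pairs case_prod_unfold prod_zero_iff)
qed

lemma AE_gamma_vandermonde: "AE z in gamma_n. vandermonde (z :: complex ^ 'n::{finite,linorder}) \<noteq> 0"
  unfolding AE_gamma_n by (rule AE_vandermonde_nonzero)

lemma vandermonde_L2: "vandermonde \<in> L2 gamma_n"
  by (rule zpoly_L2_gamma[OF zpoly_vandermonde])

lemma norm_const_eq: "norm_const TYPE('n::{finite,linorder}) = (L2_norm gamma_n (vandermonde :: complex ^ 'n::{finite,linorder} \<Rightarrow> complex))\<^sup>2"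
  by (simp add: norm_const_def L2_norm_sq)

lemma norm_const_pos: "norm_const TYPE('n::{finite,linorder}) > 0"
proof -
  interpret prob_space "gamma_n :: (complex ^ 'n::{finite,linorder}) measure" by (rule prob_space_gamma_n)
  have "L2_norm gamma_n (vandermonde :: complex ^ 'n::{finite,linorder} \<Rightarrow> complex) \<noteq> 0"
  proof
    assume "L2_norm gamma_n (vandermonde :: complex ^ 'n::{finite,linorder} \<Rightarrow> complex) = 0"
    from L2_norm_eq_0_AE[OF vandermonde_L2 this] AE_gamma_vandermonde
    have "AE z in (gamma_n :: (complex ^ 'n::{finite,linorder}) measure). False" by eventually_elim simp
    then show False by simp
  qed
  then show ?thesis by (simp add: norm_const_eq)
qed

section \<open>Holomorphic Hermite polynomials are monomials\<close>

text \<open>The multi-index of a holomorphic monomial.\<close>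

definition hol_idx :: "('n \<Rightarrow> nat) \<Rightarrow> 'n \<times> bool \<Rightarrow> nat" where
  "hol_idx p i = (if snd i then 0 else p (fst i))"

lemma hol_idx_surj: "bdeg m = 0 \<Longrightarrow> \<exists>p. m = hol_idx p"
  by (rule exI[of _ "\<lambda>k. m (k, False)"]) (auto simp: hol_idx_def fun_eq_iff bdeg_eq_0)

lemma bdeg_hol_idx [simp]: "bdeg (hol_idx p) = 0"
  by (simp add: bdeg_def hol_idx_def)

lemma hol_idx_Suc: "hol_idx (p(k := Suc (p k))) = (hol_idx p)((k, False) := Suc (hol_idx p (k, False)))"
  by (auto simp: hol_idx_def fun_eq_iff)

text \<open>On a holomorphic function \<open>raise (k, False)\<close> is multiplication by \<open>n z_k\<close>, as its derivative part
vanishes.\<close>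

lemma ladder_hol:
  fixes p :: "'n::{finite,linorder} \<Rightarrow> nat"
  shows "ladder (hol_idx p) z = (\<Prod>k\<in>UNIV. (of_nat CARD('n) * z $ k) ^ p k)"
proof (induction p rule: multi_index_induct)
  case zero
  have "hol_idx (\<lambda>_. 0) = (\<lambda>_ :: 'n \<times> bool. 0)" by (auto simp: hol_idx_def)
  then show ?case by (simp add: ladder_0)
next
  case (Suc p k)
  have "ladder (hol_idx (p(k := Suc (p k)))) z = raise (k, False) (ladder (hol_idx p)) z"
    unfolding hol_idx_Suc ladder_Suc ..
  also have "\<dots> = of_nat CARD('n) * z $ k * ladder (hol_idx p) z"
    by (simp add: raise_def flip_def wirt_ladder coord_def hol_idx_def)
  also have "\<dots> = of_nat CARD('n) * z $ k * (\<Prod>k\<in>UNIV. (of_nat CARD('n) * z $ k) ^ p k)"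
    by (simp only: Suc.IH)
  also have "\<dots> = (\<Prod>i\<in>UNIV. (of_nat CARD('n) * z $ i) ^ (p(k := Suc (p k))) i)"
    by (subst (1 2) prod.remove[of UNIV k]) auto
  finally show ?case .
qed

definition tdeg :: "('n::finite \<Rightarrow> nat) \<Rightarrow> nat" where
  "tdeg p = (\<Sum>k\<in>UNIV. p k)"

lemma hm_hol_smult: "hm (hol_idx p) (a *s z) = a ^ tdeg p * hm (hol_idx p) z"
  by (simp add: hm_def ladder_hol tdeg_def power_sum mult.left_commute power_mult_distrib prod.distrib)

lemma hm_hol_permute:
  fixes p :: "'n::{finite,linorder} \<Rightarrow> nat"
  assumes \<pi>: "bij \<pi>"
  shows "hm (hol_idx (p \<circ> \<pi>)) (permute_coords \<pi> z) = hm (hol_idx p) z"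
proof -
  have 1: "ladder (hol_idx (p \<circ> \<pi>)) (permute_coords \<pi> z) = ladder (hol_idx p) z"
    using prod.reindex_bij_betw[OF \<pi>, of "\<lambda>k. (of_nat CARD('n) * z $ k) ^ p k"]
    by (simp add: ladder_hol permute_coords_def)
  have w: "idx_weight (hol_idx q) = (\<Prod>k\<in>UNIV. fact (q k) * real CARD('n) ^ q k)" for q :: "'n \<Rightarrow> nat"
    by (simp add: idx_weight_def UNIV_idx_prod hol_idx_def)
  have "idx_weight (hol_idx (p \<circ> \<pi>)) = idx_weight (hol_idx p)"
    using prod.reindex_bij_betw[OF \<pi>, of "\<lambda>k. fact (p k) * real CARD('n) ^ p k"] by (simp add: w)
  then show ?thesis by (simp add: hm_def 1)
qed

lemma permute_coords_isometry:
  fixes \<pi> :: "'n::finite \<Rightarrow> 'n"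
  assumes "bij \<pi>"
  shows "linear (permute_coords \<pi>)" "norm (permute_coords \<pi> x) = norm x"
    "permute_coords \<pi> (permute_coords (inv \<pi>) x) = x"
proof -
  show "linear (permute_coords \<pi>)" by (rule linearI) (simp_all add: permute_coords_def vec_eq_iff)
  show "norm (permute_coords \<pi> x) = norm x"
    using sum.reindex_bij_betw[OF assms, of "\<lambda>k. (cmod (x $ k))\<^sup>2"]
    by (simp add: norm_vec_def L2_set_def permute_coords_def)
  show "permute_coords \<pi> (permute_coords (inv \<pi>) x) = x"
    using assms by (simp add: permute_coords_def vec_eq_iff inv_f_f bij_is_inj)
qed

text \<open>The change of variables \<open>z \<mapsto> permute_coords \<pi> z\<close> preserves \<open>gamma_n\<close>.\<close>

lemma coef_permute:
  fixes g :: "'n::{finite,linorder} cfun"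
  assumes g: "g \<in> L2 gamma_n" and anti: "\<And>z. g (permute_coords \<pi> z) = inv_sign \<pi> * g z" and \<pi>: "bij \<pi>"
  shows "hm.coef g (hol_idx (p \<circ> \<pi>)) = inv_sign \<pi> * hm.coef g (hol_idx p)"
proof -
  have m: "(\<lambda>z. g z * cnj (hm (hol_idx (p \<circ> \<pi>)) z)) \<in> borel_measurable borel"
  proof -
    have [measurable]: "g \<in> borel_measurable borel" "hm (hol_idx (p \<circ> \<pi>)) \<in> borel_measurable borel"
      using g zpoly_measurable[OF zpoly_hm] by (auto simp: L2_def)
    show ?thesis by measurable
  qed
  note iso = integral_gamma_n_isometry(1)[OF permute_coords_isometry(1)[OF \<pi>] permute_coords_isometry(2)[OF \<pi>]
      permute_coords_isometry(3)[OF \<pi>] m]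
  have "hm.coef g (hol_idx (p \<circ> \<pi>)) = (\<integral>z. g z * cnj (hm (hol_idx (p \<circ> \<pi>)) z) \<partial>gamma_n)"
    by (simp add: hm.coef_def L2_inner_def)
  also have "\<dots> = (\<integral>z. inv_sign \<pi> * (g z * cnj (hm (hol_idx p) z)) \<partial>gamma_n)"
    unfolding iso[symmetric] anti hm_hol_permute[OF \<pi>] by (simp add: mult.assoc)
  also have "\<dots> = inv_sign \<pi> * hm.coef g (hol_idx p)" by (simp add: hm.coef_def L2_inner_def)
  finally show ?thesis .
qed

lemma unimodular_power:
  assumes "a \<noteq> (b :: nat)"
  obtains \<omega> :: complex where "cmod \<omega> = 1" "\<omega> ^ a * cnj (\<omega> ^ b) = -1"
proof
  let ?\<omega> = "cis (pi / (real a - real b))"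
  show "cmod ?\<omega> = 1" by simp
  have "?\<omega> ^ a * cnj (?\<omega> ^ b) = cis (real a * (pi / (real a - real b)) - real b * (pi / (real a - real b)))"
    unfolding complex_cnj_power cis_cnj Complex.DeMoivre cis_mult by simp
  also have "real a * (pi / (real a - real b)) - real b * (pi / (real a - real b)) = pi"
    unfolding left_diff_distrib[symmetric] using assms by simp
  finally show "?\<omega> ^ a * cnj (?\<omega> ^ b) = -1" by simp
qed

text \<open>Some rotation acts on \<open>G\<close> as multiplication by \<open>-1\<close>.\<close>

lemma integral_rotate_eq_0:
  fixes G :: "'n::finite cfun"
  assumes "G \<in> borel_measurable borel" "a \<noteq> b"
    and rot: "\<And>\<omega> z. cmod \<omega> = 1 \<Longrightarrow> G (\<omega> *s z) = \<omega> ^ a * cnj (\<omega> ^ b) * G z"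
  shows "(\<integral>z. G z \<partial>gamma_n) = 0"
proof -
  obtain \<omega> :: complex where \<omega>: "cmod \<omega> = 1" "\<omega> ^ a * cnj (\<omega> ^ b) = -1"
    using unimodular_power[OF assms(2)] by blast
  have "(\<integral>z. G z \<partial>gamma_n) = (\<integral>z. G (\<omega> *s z) \<partial>gamma_n)"
    by (rule integral_gamma_n_rotate(1)[OF \<omega>(1) assms(1), symmetric])
  also have "\<dots> = - (\<integral>z. G z \<partial>gamma_n)" by (simp add: rot[OF \<omega>(1)] \<omega>(2) del: complex_cnj_power)
  finally show ?thesis by simp
qed

text \<open>Rotation acts on \<open>g\<close> and on the monomial with different characters.\<close>

lemma coef_homogeneous:
  fixes g :: "'n::{finite,linorder} cfun"
  assumes g: "g \<in> L2 gamma_n" and hom: "\<And>\<omega> z. g (\<omega> *s z) = \<omega> ^ d * g z" and p: "tdeg p \<noteq> d"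
  shows "hm.coef g (hol_idx p) = 0"
proof -
  have [measurable]: "g \<in> borel_measurable borel" "hm (hol_idx p) \<in> borel_measurable borel"
    using g zpoly_measurable[OF zpoly_hm] by (auto simp: L2_def)
  have "(\<integral>z. g z * cnj (hm (hol_idx p) z) \<partial>gamma_n) = 0"
    by (rule integral_rotate_eq_0[of _ d "tdeg p"]) (use p in \<open>auto simp: hom hm_hol_smult mult_ac\<close>)
  then show ?thesis by (simp add: hm.coef_def L2_inner_def)
qed

section \<open>Exponents of antisymmetric functions\<close>

text \<open>The pairs with distinct entries split into two halves of equal size, whichever order is used.\<close>

lemma card_inj_less:
  fixes p :: "'n::{finite,linorder} \<Rightarrow> 'a::linorder"
  assumes "inj p"
  shows "card {(j, k). p j < p k} = card (pairs :: ('n \<times> 'n) set)"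
proof -
  have *: "2 * card {(j, k). q j < q k} = card {(j, k). j \<noteq> (k :: 'n)}" if q: "inj q" for q :: "'n \<Rightarrow> 'b::linorder"
  proof -
    have "j \<noteq> k \<longleftrightarrow> q j < q k \<or> q k < q j" for j k
      using inj_eq[OF q, of j k] neq_iff[of "q j" "q k"] by blast
    then have "{(j, k). j \<noteq> k} = {(j, k). q j < q k} \<union> {(j, k). q k < q j}" by auto
    then have "card {(j, k). j \<noteq> (k :: 'n)} = card {(j, k). q j < q k} + card {(j, k). q k < q j}"
      by (simp only:) (rule card_Un_disjoint, auto)
    moreover have "card {(j, k). q k < q j} = card {(j, k). q j < q k}"
      by (rule bij_betw_same_card[of prod.swap]) (auto simp: bij_betw_def inj_on_def image_iff)
    ultimately show ?thesis by simp
  qed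
  from *[OF assms] *[of id] show ?thesis by (simp add: pairs_def)
qed

text \<open>For injective \<open>p\<close> the value \<open>p k\<close> is at least the rank of \<open>k\<close> in the order that \<open>p\<close> induces, and the
ranks add up to the number of pairs. Equality forces \<open>p\<close> to be its own rank function.\<close>

lemma inj_tdeg:
  fixes p :: "'n::{finite,linorder} \<Rightarrow> nat"
  assumes inj: "inj p"
  shows "card (pairs :: ('n \<times> 'n) set) \<le> tdeg p"
    and "tdeg p \<le> card (pairs :: ('n \<times> 'n) set) \<Longrightarrow> range p = {..<CARD('n)}"
proof -
  define rk where "rk k = card {j. p j < p k}" for k
  have le: "rk k \<le> p k" for k
  proof -
    have "rk k = card (p ` {j. p j < p k})"
      unfolding rk_def by (rule card_image[symmetric]) (rule inj_on_subset[OF inj], simp)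
    also have "\<dots> \<le> card {..<p k}" by (rule card_mono) auto
    finally show ?thesis by simp
  qed
  have "{(j, k). p j < p k} = (\<lambda>(k, j). (j, k)) ` (SIGMA k:UNIV. {j. p j < p k})" by auto
  then have "card {(j, k). p j < p k} = card (SIGMA k:UNIV. {j. p j < p k})"
    by (simp add: card_image inj_on_def)
  also have "\<dots> = (\<Sum>k\<in>UNIV. rk k)" by (simp add: rk_def)
  finally have sum: "(\<Sum>k\<in>UNIV. rk k) = card (pairs :: ('n \<times> 'n) set)"
    using card_inj_less[OF inj] by simp
  show "card (pairs :: ('n \<times> 'n) set) \<le> tdeg p"
    unfolding sum[symmetric] tdeg_def by (rule sum_mono[OF le])
  assume "tdeg p \<le> card (pairs :: ('n \<times> 'n) set)"
  then have "(\<Sum>k\<in>UNIV. p k) \<le> (\<Sum>k\<in>UNIV. rk k)" by (simp add: sum tdeg_def)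
  then have "p k = rk k" for k
  proof -
    assume s: "(\<Sum>k\<in>UNIV. p k) \<le> (\<Sum>k\<in>UNIV. rk k)"
    show "p k = rk k"
    proof (rule ccontr)
      assume "p k \<noteq> rk k"
      then have "rk k < p k" using le[of k] by simp
      then have "(\<Sum>k\<in>UNIV. rk k) < (\<Sum>k\<in>UNIV. p k)"
        by (intro sum_strict_mono_ex1) (use le in auto)
      then show False using s by simp
    qed
  qed
  moreover have "rk k < CARD('n)" for k
    unfolding rk_def by (rule psubset_card_mono) auto
  ultimately have "range p \<subseteq> {..<CARD('n)}" by auto
  then show "range p = {..<CARD('n)}"
    by (rule card_subset_eq[rotated]) (simp_all add: card_image inj)
qed

lemma same_range_permutation:
  fixes p q :: "'n::finite \<Rightarrow> nat"
  assumes "inj p" "inj q" "range p = range q"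
  obtains \<pi> where "bij \<pi>" "q = p \<circ> \<pi>"
proof
  define \<pi> where "\<pi> k = inv p (q k)" for k
  have *: "p (\<pi> k) = q k" for k
    unfolding \<pi>_def using assms(3) by (intro f_inv_into_f) auto
  then show "q = p \<circ> \<pi>" by auto
  have "inj \<pi>"
  proof (rule injI)
    fix x y assume "\<pi> x = \<pi> y"
    then have "q x = q y" using * by metis
    then show "x = y" using assms(2) by (simp add: inj_eq)
  qed
  then show "bij \<pi>" by (simp add: bij_def finite_UNIV_inj_surj)
qed

text \<open>The exponents with non-zero coefficient are injective, so that their total degree is at least
  that of the Vandermonde polynomial, with equality only for permutations of \<open>0, \<dots>, n - 1\<close>. On
  those the antisymmetry leaves one free coefficient, which the Vandermonde polynomial detects.\<close>

lemma antisymmetric_coef_eq_0: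
  fixes g :: "'n::{finite,linorder} cfun"
  assumes g: "g \<in> L2 gamma_n"
    and anti: "\<And>\<pi> z. bij \<pi> \<Longrightarrow> g (permute_coords \<pi> z) = inv_sign \<pi> * g z"
    and orth: "L2_inner gamma_n g vandermonde = 0"
    and deg: "tdeg p \<le> card (pairs :: ('n \<times> 'n) set)"
  shows "hm.coef g (hol_idx p) = 0"
proof -
  let ?V = "vandermonde :: 'n cfun" and ?d = "card (pairs :: ('n \<times> 'n) set)"
  have noninj: "hm.coef F (hol_idx q) = 0"
    if F: "F \<in> L2 gamma_n" "\<And>\<pi> z. bij \<pi> \<Longrightarrow> F (permute_coords \<pi> z) = inv_sign \<pi> * F z"
      and q: "\<not> inj q" for F q
  proof -
    obtain a b where "q a = q b" "a \<noteq> b" using q by (auto simp: inj_def)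
    then obtain a b where ab: "q a = q b" "a < b" by (metis neq_iff)
    have b: "bij (Transposition.transpose a b)" by simp
    have "q \<circ> Transposition.transpose a b = q" using ab by (auto simp: fun_eq_iff Transposition.transpose_def)
    then have "hm.coef F (hol_idx q) = - hm.coef F (hol_idx q)"
      using coef_permute[OF F(1) F(2)[OF b] b, of q] inv_sign_transpose[OF ab(2)] by simp
    then show ?thesis by simp
  qed
  have Vanti: "?V (permute_coords \<pi> z) = inv_sign \<pi> * ?V z" if "bij \<pi>" for \<pi> z
    using vandermonde_permute bij_is_inj[OF that] by blast
  show ?thesis
  proof (cases "inj p")
    case False
    then show ?thesis using noninj[OF g anti] by blast
  next
    case inj: True
    define v where "v = hm.coef ?V (hol_idx p)"
    define \<alpha> where "\<alpha> = hm.coef g (hol_idx p)"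
    \<comment> \<open>the combination whose coefficients vanish on the whole orbit of \<open>p\<close>; being orthogonal to \<open>V\<close>, it shows that
      \<open>\<alpha> \<parallel>V\<parallel>^2 = 0\<close>\<close>
    define x where "x = (\<lambda>z. v * g z - \<alpha> * ?V z)"
    have xL: "x \<in> L2 gamma_n" unfolding x_def by (intro L2_minus L2_cmult g vandermonde_L2)
    have cx: "hm.coef x m = v * hm.coef g m - \<alpha> * hm.coef ?V m" for m
      unfolding x_def by (subst hm.coef_diff[OF L2_cmult[OF g] L2_cmult[OF vandermonde_L2]])
        (simp add: hm.coef_def L2_inner_cmult_left)
    have "hm.coef ?V m = 0 \<or> hm.coef x m = 0" for m
    proof (cases "bdeg m = 0")
      case False
      have "?V \<in> H_n"
      proof -
        have "wirt (k, True) ?V z = 0" for k z by (rule wirt_vandermonde)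
        then have "holomorphic_Cn ?V"
          by (intro holomorphic_CnI zpoly_differentiable zpoly_vandermonde)
        then show ?thesis by (simp add: H_n_def vandermonde_L2)
      qed
      moreover obtain k where "m (k, True) \<noteq> 0" using False by (auto simp: bdeg_eq_0)
      ultimately show ?thesis using H_n_orthogonal_hm[of ?V m k] by (simp add: hm.coef_def)
    next
      case True
      then obtain q where q: "m = hol_idx q" using hol_idx_surj by blast
      show ?thesis
      proof (cases "inj q \<and> tdeg q = ?d")
        case True
        have "range p = range q" using inj_tdeg(2)[OF inj deg] inj_tdeg(2)[of q] True by simp
        then obtain \<pi> where \<pi>: "bij \<pi>" "q = p \<circ> \<pi>"
          using same_range_permutation[OF inj, of q] True by blast
        have "hm.coef x m = v * (inv_sign \<pi> * \<alpha>) - \<alpha> * (inv_sign \<pi> * v)"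
          unfolding cx q \<pi>(2) coef_permute[OF g anti[OF \<pi>(1)] \<pi>(1)]
            coef_permute[OF vandermonde_L2 Vanti[OF \<pi>(1)] \<pi>(1)] \<alpha>_def v_def ..
        then show ?thesis by simp
      next
        case False
        then show ?thesis
          using noninj[OF vandermonde_L2 Vanti] coef_homogeneous[OF vandermonde_L2 vandermonde_smult]
          unfolding q by blast
      qed
    qed
    then have "L2_inner gamma_n ?V x = 0"
      by (intro hm.cspan_inner_eq_0[OF zpoly_cspan[OF zpoly_vandermonde] xL])
         (force simp: hm.coef_def L2_inner_commute[of _ "hm _" x])
    then have "L2_inner gamma_n x ?V = 0" by (subst L2_inner_commute) simp
    then have "v * L2_inner gamma_n g ?V - \<alpha> * L2_inner gamma_n ?V ?V = 0"
      unfolding x_def L2_inner_diff_left[OF L2_cmult[OF g] L2_cmult[OF vandermonde_L2] vandermonde_L2]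
        L2_inner_cmult_left .
    then have "\<alpha> * complex_of_real (norm_const TYPE('n)) = 0"
      by (simp add: orth L2_inner_self norm_const_eq)
    then show ?thesis using norm_const_pos[where 'n = 'n] by (simp add: \<alpha>_def)
  qed
qed

section \<open>The square of the holomorphic part has mean zero\<close>

text \<open>In the bilinear form \<open>(u, v) \<mapsto> \<integral> u v cnj V / V\<close> two monomials whose degrees add up to more than
  twice the degree of \<open>V\<close> are orthogonal, because the circle acts on the integrand with positive
  weight.\<close>

lemma integral_square_eq_0:
  fixes g0 :: "'n::{finite,linorder} cfun"
  assumes g0: "g0 \<in> hm.cspan {m. bdeg m = 0}"
    and low: "\<And>p. tdeg p \<le> card (pairs :: ('n \<times> 'n) set) \<Longrightarrow> hm.coef g0 (hol_idx p) = 0"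
  shows "(\<integral>z. g0 z * g0 z * (cnj (vandermonde z) / vandermonde z) \<partial>gamma_n) = 0"
proof -
  let ?V = "vandermonde :: 'n cfun" and ?d = "card (pairs :: ('n \<times> 'n) set)"
  define \<tau> where "\<tau> z = cnj (?V z) / ?V z" for z
  have [measurable]: "?V \<in> borel_measurable borel" by (rule zpoly_measurable[OF zpoly_vandermonde])
  have \<tau>m [measurable]: "\<tau> \<in> borel_measurable borel" unfolding \<tau>_def by measurable
  have \<tau>1: "cmod (\<tau> z) \<le> 1" for z by (simp add: \<tau>_def norm_divide)
  have gL: "g0 \<in> L2 gamma_n" using g0 by (rule hm.cspan_L2)
  have xL: "(\<lambda>z. cnj (u z * \<tau> z)) \<in> L2 gamma_n" if "u \<in> L2 gamma_n" for u
  proof (rule L2_bound[OF _ L2_integrable[OF that]])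
    have [measurable]: "u \<in> borel_measurable borel" using that by (simp add: L2_def)
    show "(\<lambda>z. cnj (u z * \<tau> z)) \<in> borel_measurable gamma_n" by measurable
    show "AE z in gamma_n. (cmod (cnj (u z * \<tau> z)))\<^sup>2 \<le> (cmod (u z))\<^sup>2"
    proof (rule AE_I2)
      fix z
      have "cmod (cnj (u z * \<tau> z)) \<le> cmod (u z)" using \<tau>1[of z] by (simp add: norm_mult mult_left_le)
      then show "(cmod (cnj (u z * \<tau> z)))\<^sup>2 \<le> (cmod (u z))\<^sup>2" by (rule power_mono) simp
    qed
  qed
  \<comment> \<open>vanishing is passed from pairs of monomials to \<open>g0\<close> in one argument at a time\<close>
  define B where "B u v = L2_inner gamma_n u (\<lambda>z. cnj (v z * \<tau> z))" for u v :: "'n cfun"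
  have B_sym: "B u v = B v u" for u v by (simp add: B_def L2_inner_def mult_ac)
  have B0: "B (hm (hol_idx p)) (hm (hol_idx q)) = 0" if "tdeg p > ?d" "tdeg q > ?d" for p q
  proof -
    have [measurable]: "hm m \<in> borel_measurable borel" for m :: "'n \<times> bool \<Rightarrow> nat"
      by (rule zpoly_measurable[OF zpoly_hm])
    have "(\<integral>z. hm (hol_idx p) z * (hm (hol_idx q) z * \<tau> z) \<partial>gamma_n) = 0"
    proof (rule integral_rotate_eq_0[of _ "tdeg p + tdeg q" "2 * ?d"])
      show "(\<lambda>z. hm (hol_idx p) z * (hm (hol_idx q) z * \<tau> z)) \<in> borel_measurable borel" by measurable
      show "tdeg p + tdeg q \<noteq> 2 * ?d" using that by simp
      fix \<omega> :: complex and z :: "complex ^ 'n::{finite,linorder}"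
      assume \<omega>: "cmod \<omega> = 1"
      have "\<omega> * cnj \<omega> = 1" using \<omega> complex_norm_square[of \<omega>] by simp
      then have i: "inverse \<omega> = cnj \<omega>" by (rule inverse_unique)
      have "\<tau> (\<omega> *s z) = cnj (\<omega> ^ ?d) * inverse (\<omega> ^ ?d) * \<tau> z"
        by (simp add: \<tau>_def vandermonde_smult divide_inverse mult_ac)
      also have "inverse (\<omega> ^ ?d) = cnj (\<omega> ^ ?d)" by (simp add: power_inverse[symmetric] i)
      finally have "\<tau> (\<omega> *s z) = cnj (\<omega> ^ (2 * ?d)) * \<tau> z" by (simp add: power_add mult_2)
      then show "hm (hol_idx p) (\<omega> *s z) * (hm (hol_idx q) (\<omega> *s z) * \<tau> (\<omega> *s z))
          = \<omega> ^ (tdeg p + tdeg q) * cnj (\<omega> ^ (2 * ?d)) * (hm (hol_idx p) z * (hm (hol_idx q) z * \<tau> z))"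
        by (simp add: hm_hol_smult power_add mult_ac)
    qed
    then show ?thesis by (simp add: B_def L2_inner_def)
  qed
  have idx: "hm.coef g0 m = 0 \<or> (\<exists>p. m = hol_idx p \<and> tdeg p > ?d)" if m: "m \<in> {m. bdeg m = 0}" for m
  proof -
    obtain p where "m = hol_idx p" using m hol_idx_surj by blast
    then show ?thesis using low[of p] by (cases "tdeg p > ?d") auto
  qed
  have B1: "B g0 (hm (hol_idx q)) = 0" if q: "tdeg q > ?d" for q
    unfolding B_def
  proof (rule hm.cspan_inner_eq_0[OF g0 xL[OF hm.e_L2]])
    fix m :: "'n \<times> bool \<Rightarrow> nat" assume "m \<in> {m. bdeg m = 0}"
    from idx[OF this] show "hm.coef g0 m * L2_inner gamma_n (hm m) (\<lambda>z. cnj (hm (hol_idx q) z * \<tau> z)) = 0"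
      using B0[OF _ q] by (auto simp: B_def)
  qed
  have "B g0 g0 = 0"
    unfolding B_def
  proof (rule hm.cspan_inner_eq_0[OF g0 xL[OF gL]])
    fix m :: "'n \<times> bool \<Rightarrow> nat" assume "m \<in> {m. bdeg m = 0}"
    from idx[OF this] show "hm.coef g0 m * L2_inner gamma_n (hm m) (\<lambda>z. cnj (g0 z * \<tau> z)) = 0"
      using B1 B_sym[of g0] by (auto simp: B_def)
  qed
  then show ?thesis by (simp add: B_def L2_inner_def \<tau>_def mult.assoc)
qed

section \<open>The measure \<open>mu_n\<close> and the unitary map\<close>

text \<open>The density of \<open>mu_n\<close> with respect to \<open>gamma_n\<close>.\<close>

definition mdens :: "complex ^ 'n::{finite,linorder} \<Rightarrow> real" where
  "mdens z = (cmod (vandermonde z))\<^sup>2 / norm_const TYPE('n)"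

lemma mdens_nonneg: "mdens (z :: complex ^ 'n::{finite,linorder}) \<ge> 0"
  using norm_const_pos[where 'n = 'n] by (simp add: mdens_def)

lemma vandermonde_measurable [measurable]: "vandermonde \<in> borel_measurable borel"
  by (rule zpoly_measurable[OF zpoly_vandermonde])

lemma mdens_measurable [measurable]: "mdens \<in> borel_measurable borel"
  unfolding mdens_def[abs_def] by measurable

lemma mu_n_density: "mu_n = density gamma_n (\<lambda>z. ennreal (mdens z))"
  by (simp add: mu_n_def mdens_def)

lemma sets_mu_n [measurable_cong, simp]: "sets mu_n = sets borel"
  by (simp add: mu_n_density)

lemma space_mu_n [simp]: "space mu_n = UNIV"
  by (simp add: mu_n_density)

lemma measurable_mu_n [simp]: "borel_measurable mu_n = borel_measurable borel"
  by (rule measurable_cong_sets) auto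

lemma integrable_mu_n:
  fixes F :: "complex ^ 'n::{finite,linorder} \<Rightarrow> 'b::{banach, second_countable_topology}"
  assumes [measurable]: "F \<in> borel_measurable borel"
  shows "integrable mu_n F \<longleftrightarrow> integrable gamma_n (\<lambda>z. mdens z *\<^sub>R F z)"
  unfolding mu_n_density by (subst integrable_density) (auto simp: mdens_nonneg)

lemma integral_mu_n:
  fixes F :: "complex ^ 'n::{finite,linorder} \<Rightarrow> 'b::{banach, second_countable_topology}"
  assumes [measurable]: "F \<in> borel_measurable borel"
  shows "(\<integral>z. F z \<partial>mu_n) = (\<integral>z. mdens z *\<^sub>R F z \<partial>gamma_n)"
  unfolding mu_n_density by (subst integral_density) (auto simp: mdens_nonneg)

lemma prob_space_mu_n: "prob_space (mu_n :: (complex ^ 'n::{finite,linorder}) measure)"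
proof
  let ?N = "norm_const TYPE('n)"
  have I: "integrable gamma_n (mdens :: complex ^ 'n::{finite,linorder} \<Rightarrow> real)"
  proof -
    have "integrable gamma_n (\<lambda>z :: complex ^ 'n::{finite,linorder}. (cmod (vandermonde z))\<^sup>2)"
      by (rule L2_integrable[OF vandermonde_L2])
    then show ?thesis by (simp add: mdens_def[abs_def])
  qed
  have "emeasure (mu_n :: (complex ^ 'n::{finite,linorder}) measure) UNIV = (\<integral>\<^sup>+z. ennreal (mdens (z :: complex ^ 'n::{finite,linorder})) \<partial>gamma_n)"
    unfolding mu_n_density by (subst emeasure_density) auto
  also have "\<dots> = ennreal (\<integral>z. mdens (z :: complex ^ 'n::{finite,linorder}) \<partial>gamma_n)"
    by (rule nn_integral_eq_integral[OF I]) (simp add: mdens_nonneg)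
  also have "(\<integral>z. mdens (z :: complex ^ 'n::{finite,linorder}) \<partial>gamma_n) = 1"
    using norm_const_pos[where 'n = 'n] by (simp add: mdens_def norm_const_def)
  finally show "emeasure mu_n (space (mu_n :: (complex ^ 'n::{finite,linorder}) measure)) = 1" by simp
qed

lemma U_map_mult:
  fixes z :: "complex ^ 'n::{finite,linorder}"
  shows "U_map F z * cnj (U_map G z) = mdens z *\<^sub>R (F z * cnj (G z))"
proof -
  let ?N = "norm_const TYPE('n)"
  have N: "complex_of_real (1 / sqrt ?N) * complex_of_real (1 / sqrt ?N) = complex_of_real (1 / ?N)"
    using norm_const_pos[where 'n = 'n] by (simp flip: of_real_mult)
  have "U_map F z * cnj (U_map G z)
      = (complex_of_real (1 / sqrt ?N) * complex_of_real (1 / sqrt ?N)) * (vandermonde z * cnj (vandermonde z)) * (F z * cnj (G z))"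
    by (simp add: U_map_def)
  also have "\<dots> = complex_of_real (mdens z) * (F z * cnj (G z))"
    unfolding N complex_norm_square[symmetric] by (simp add: mdens_def)
  finally show ?thesis by (simp add: scaleR_conv_of_real)
qed

lemma U_map_norm_sq: "(cmod (U_map F z))\<^sup>2 = mdens z * (cmod (F z))\<^sup>2"
proof -
  have "complex_of_real ((cmod (U_map F z))\<^sup>2) = complex_of_real (mdens z * (cmod (F z))\<^sup>2)"
    unfolding complex_norm_square U_map_mult of_real_mult scaleR_conv_of_real ..
  then show ?thesis by (simp only: of_real_eq_iff)
qed

lemma U_map_measurable:
  assumes [measurable]: "F \<in> borel_measurable borel"
  shows "U_map F \<in> borel_measurable borel"
  unfolding U_map_def[abs_def] by measurable

lemma L2_inner_U_map:
  assumes "F \<in> borel_measurable borel" "G \<in> borel_measurable borel"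
  shows "L2_inner gamma_n (U_map F) (U_map G) = L2_inner mu_n F G"
  unfolding L2_inner_def U_map_mult by (subst integral_mu_n) (use assms in measurable)

lemma L2_norm_U_map:
  assumes [measurable]: "F \<in> borel_measurable borel"
  shows "L2_norm gamma_n (U_map F) = L2_norm mu_n F"
  unfolding L2_norm_def U_map_norm_sq by (subst integral_mu_n) simp_all

text \<open>The quotient by \<open>V\<close>, which is defined outside a null set, is a preimage.\<close>

lemma U_inv_L2:
  fixes G :: "complex ^ 'n::{finite,linorder} \<Rightarrow> complex"
  assumes G: "G \<in> L2 gamma_n"
  shows "U_inv G \<in> L2 mu_n" "AE z in gamma_n. U_map (U_inv G) z = G z"
proof -
  let ?N = "norm_const TYPE('n)"
  define H where "H z = complex_of_real (sqrt ?N) * G z / vandermonde z" for z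
  have [measurable]: "G \<in> borel_measurable borel" using G by (simp add: L2_def)
  have Hm [measurable]: "H \<in> borel_measurable borel" unfolding H_def by measurable
  have UH: "U_map H z = G z" if "vandermonde z \<noteq> 0" for z
    using that norm_const_pos[where 'n = 'n] by (simp add: U_map_def H_def)
  have "U_map H \<in> L2 gamma_n"
  proof (rule L2_bound[OF _ L2_integrable[OF G]])
    show "AE z in gamma_n. (cmod (U_map H z))\<^sup>2 \<le> (cmod (G z))\<^sup>2"
      using AE_gamma_vandermonde by eventually_elim (simp add: UH)
  qed (simp add: U_map_measurable[OF Hm])
  then have "integrable gamma_n (\<lambda>z. mdens z * (cmod (H z))\<^sup>2)" by (simp add: L2_def U_map_norm_sq)
  then have "H \<in> L2 mu_n" using integrable_mu_n[of "\<lambda>z. (cmod (H z))\<^sup>2"] by (simp add: L2_def)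
  moreover have "AE z in gamma_n. U_map H z = G z"
    using AE_gamma_vandermonde by eventually_elim (rule UH)
  ultimately have "\<exists>h. h \<in> L2 mu_n \<and> (AE z in gamma_n. U_map h z = G z)" by blast
  from someI_ex[OF this] show "U_inv G \<in> L2 mu_n" "AE z in gamma_n. U_map (U_inv G) z = G z"
    unfolding U_inv_def by blast+
qed

lemma U_inv_cong_AE:
  assumes "AE z in gamma_n. G z = G' z"
  shows "U_inv G = U_inv G'"
proof -
  have "(AE z in gamma_n. U_map h z = G z) \<longleftrightarrow> (AE z in gamma_n. U_map h z = G' z)" for h
  proof
    assume "AE z in gamma_n. U_map h z = G z"
    with assms show "AE z in gamma_n. U_map h z = G' z" by eventually_elim simp
  next
    assume "AE z in gamma_n. U_map h z = G' z"
    with assms show "AE z in gamma_n. U_map h z = G z" by eventually_elim simp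
  qed
  then show ?thesis unfolding U_inv_def by simp
qed

section \<open>Gradients\<close>

lemma sum_Basis_cvec:
  fixes \<phi> :: "complex ^ 'n::finite \<Rightarrow> 'b::comm_monoid_add"
  shows "(\<Sum>b\<in>Basis. \<phi> b) = (\<Sum>k\<in>UNIV. \<phi> (axis k 1) + \<phi> (axis k \<i>))"
proof -
  have B: "(Basis :: (complex ^ 'n) set) = (\<lambda>(k, u). axis k u) ` (UNIV \<times> {1, \<i>})"
    by (auto simp: Basis_vec_def Basis_complex_def)
  have inj: "inj_on (\<lambda>(k, u). axis k u :: complex ^ 'n) (UNIV \<times> {1, \<i>})"
    by (auto simp: inj_on_def axis_eq_axis)
  have "(\<Sum>b\<in>Basis. \<phi> b) = (\<Sum>(k, u)\<in>UNIV \<times> {1, \<i>}. \<phi> (axis k u))"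
    unfolding B by (subst sum.reindex[OF inj]) (simp add: case_prod_unfold)
  also have "\<dots> = (\<Sum>k\<in>UNIV. \<Sum>u\<in>{1, \<i>}. \<phi> (axis k u))" by (rule sum.cartesian_product[symmetric])
  also have "\<dots> = (\<Sum>k\<in>UNIV. \<phi> (axis k 1) + \<phi> (axis k \<i>))"
    by (rule sum.cong) (auto simp: complex_eq_iff)
  finally show ?thesis .
qed

lemma grad_inner_Basis: "b \<in> Basis \<Longrightarrow> grad f z \<bullet> b = dir_deriv b f z"
  unfolding grad_def by (rule inner_sum_left_Basis)

lemma grad_inner: "grad f z \<bullet> grad h z = (\<Sum>b\<in>Basis. dir_deriv b f z * dir_deriv b h z)"
  by (subst euclidean_inner) (simp add: grad_inner_Basis)

lemma norm_grad_sq: "(norm (grad f z))\<^sup>2 = (\<Sum>b\<in>Basis. (dir_deriv b f z)\<^sup>2)"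
  unfolding power2_norm_eq_inner grad_inner by (simp add: power2_eq_square)

lemma dir_deriv_complex_of_real:
  assumes "f differentiable at z"
  shows "dir_deriv v (\<lambda>z. complex_of_real (f z)) z = complex_of_real (dir_deriv v f z)"
  by (rule dir_deriv_eq) (intro has_derivative_of_real has_dir_deriv assms)

lemma smooth_differentiable: "smooth f \<Longrightarrow> f differentiable at z"
  unfolding smooth_def using C_k.simps(2)[of 0 f] by blast

lemma smooth_continuous: "smooth f \<Longrightarrow> continuous_on UNIV f"
  unfolding smooth_def using C_k.simps(1)[of f] by blast

lemma smooth_dir_deriv: "smooth f \<Longrightarrow> smooth (dir_deriv v f)"
  unfolding smooth_def using C_k.simps(2)[of _ f] by blast

lemma dir_deriv_eq_0_outside:
  assumes "closed K" "\<And>z. z \<notin> K \<Longrightarrow> f z = 0" "z \<notin> K"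
  shows "dir_deriv v f z = 0"
proof -
  have "((\<lambda>z. 0) has_derivative (\<lambda>v. 0)) (at z)" by simp
  then have "(f has_derivative (\<lambda>v. 0)) (at z)"
    by (rule has_derivative_transform_within_open[where s = "- K"]) (use assms in auto)
  then show ?thesis by (simp add: dir_deriv_eq)
qed

lemma continuous_compact_support_bounded:
  fixes F :: "'a::euclidean_space \<Rightarrow> 'b::real_normed_vector"
  assumes "continuous_on UNIV F" "compact K" "\<And>z. z \<notin> K \<Longrightarrow> F z = 0"
  shows "\<exists>B. \<forall>z. norm (F z) \<le> B"
proof -
  have "compact (F ` K)" by (rule compact_continuous_image[OF continuous_on_subset[OF assms(1)] assms(2)]) auto
  then obtain B where B: "\<forall>y\<in>F ` K. norm y \<le> B" using compact_imp_bounded bounded_iff by metis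
  have "norm (F z) \<le> max B 0" for z
    using B assms(3)[of z] by (cases "z \<in> K") (auto simp: le_max_iff_disj)
  then show ?thesis by blast
qed

lemma C_neq_vandermonde: "C_neq = {z :: complex ^ 'n::{finite,linorder}. vandermonde z \<noteq> 0}"
proof -
  have "z \<in> C_neq \<longleftrightarrow> vandermonde z \<noteq> 0" for z :: "complex ^ 'n::{finite,linorder}"
  proof
    assume "z \<in> C_neq"
    then show "vandermonde z \<noteq> 0"
      by (force simp: C_neq_def vandermonde_pairs pairs_def prod_zero_iff)
  next
    assume "vandermonde z \<noteq> 0"
    then have "z $ k \<noteq> z $ j" if "j < k" for j k
      using that by (auto simp: vandermonde_pairs pairs_def prod_zero_iff)
    then show "z \<in> C_neq" unfolding C_neq_def mem_Collect_eq by (metis neq_iff)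
  qed
  then show ?thesis by blast
qed

lemma open_C_neq: "open (C_neq :: (complex ^ 'n::{finite,linorder}) set)"
  unfolding C_neq_vandermonde
  by (intro open_Collect_neq zpoly_continuous[OF zpoly_vandermonde] continuous_on_const)

section \<open>The Dirichlet form on the Hermite side\<close>

lemma has_sum_finite_sum:
  fixes F :: "'i \<Rightarrow> 'a \<Rightarrow> 'b::topological_comm_monoid_add"
  assumes "finite I" "\<And>i. i \<in> I \<Longrightarrow> (F i has_sum s i) A"
  shows "((\<lambda>x. \<Sum>i\<in>I. F i x) has_sum (\<Sum>i\<in>I. s i)) A"
  using assms by (induction I rule: finite_induct) (auto intro: has_sum_add)

locale test_function =
  fixes f :: "complex ^ 'n::{finite,linorder} \<Rightarrow> real"
  assumes f: "f \<in> Cc_inf_neq"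
begin

definition K :: "(complex ^ 'n::{finite,linorder}) set" where
  "K = closure {z. f z \<noteq> 0}"

definition f0 :: "complex ^ 'n::{finite,linorder} \<Rightarrow> real" where
  "f0 z = f z - (\<integral>w. f w \<partial>mu_n)"

definition g :: "complex ^ 'n::{finite,linorder} \<Rightarrow> complex" where
  "g = U_map (\<lambda>z. complex_of_real (f0 z))"

lemma smooth_f: "smooth f" and compact_K: "compact K" and K_sub: "K \<subseteq> C_neq"
  using f by (auto simp: Cc_inf_neq_def K_def)

lemma closed_K: "closed K" by (rule compact_imp_closed[OF compact_K])

lemma f_outside: "z \<notin> K \<Longrightarrow> f z = 0"
  using closure_subset[of "{z. f z \<noteq> 0}"] by (auto simp: K_def)

lemma K_bounded: "\<exists>R. \<forall>z. norm z > R \<longrightarrow> z \<notin> K"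
  using compact_imp_bounded[OF compact_K] unfolding bounded_iff by (meson not_le)

lemma df_outside: "z \<notin> K \<Longrightarrow> dir_deriv v f z = 0"
  by (rule dir_deriv_eq_0_outside[OF closed_K f_outside])

lemma ddf_outside: "z \<notin> K \<Longrightarrow> dir_deriv w (dir_deriv v f) z = 0"
  by (rule dir_deriv_eq_0_outside[OF closed_K df_outside])

lemma f_cont: "continuous_on UNIV f"
  and df_cont: "continuous_on UNIV (dir_deriv v f)"
  and ddf_cont: "continuous_on UNIV (dir_deriv w (dir_deriv v f))"
  by (intro smooth_continuous smooth_dir_deriv smooth_f)+

lemma f0_cont: "continuous_on UNIV f0"
  unfolding f0_def[abs_def] by (intro continuous_intros f_cont)

abbreviation fc :: "complex ^ 'n::{finite,linorder} \<Rightarrow> complex" where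
  "fc z \<equiv> complex_of_real (f z)"

lemma fc_differentiable: "fc differentiable at z"
  using has_derivative_of_real[OF has_dir_deriv[OF smooth_differentiable[OF smooth_f]]] differentiableI by blast

lemma dfc: "dir_deriv v fc = (\<lambda>z. complex_of_real (dir_deriv v f z))"
  by (rule ext) (intro dir_deriv_complex_of_real smooth_differentiable smooth_f)

lemma tame_fc:
  assumes "\<delta> \<ge> 0"
  shows "tame \<delta> fc"
proof -
  obtain B where B: "\<And>z. norm (f z) \<le> B"
    using continuous_compact_support_bounded[OF f_cont compact_K f_outside] by blast
  have "growth \<delta> (dir_deriv v fc)" for v
  proof -
    obtain C where "\<And>z. norm (dir_deriv v f z) \<le> C"
      using continuous_compact_support_bounded[OF df_cont compact_K df_outside] by blast
    then show ?thesis unfolding dfc by (intro growth_bounded[of _ C] assms) simp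
  qed
  moreover have "growth \<delta> fc" using B by (intro growth_bounded[of _ B] assms) simp
  moreover have "continuous_on UNIV (dir_deriv v fc)" for v
    unfolding dfc by (intro continuous_intros df_cont)
  ultimately show ?thesis using fc_differentiable by (simp add: tame_def)
qed

lemma g_eq: "g z = complex_of_real (1 / sqrt (norm_const TYPE('n))) *
    (vandermonde z * fc z + (- complex_of_real (\<integral>w. f w \<partial>mu_n)) * vandermonde z)"
  by (simp add: g_def U_map_def f0_def algebra_simps)

lemma tame_g: "tame (1 / 4) g"
proof -
  have 1: "tame (1 / 4 + 0) (\<lambda>z. vandermonde z * fc z)"
    by (intro tame_mult tame_fc zpoly_tame zpoly_vandermonde) auto
  have 2: "tame (1 / 4) (\<lambda>z. (- complex_of_real (\<integral>w. f w \<partial>mu_n)) * vandermonde z)"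
    by (intro tame_cmult zpoly_tame zpoly_vandermonde) auto
  have "g = (\<lambda>z. complex_of_real (1 / sqrt (norm_const TYPE('n))) *
    (vandermonde z * fc z + (- complex_of_real (\<integral>w. f w \<partial>mu_n)) * vandermonde z))"
    by (rule ext) (rule g_eq)
  moreover have "tame (1 / 4) (\<lambda>z. complex_of_real (1 / sqrt (norm_const TYPE('n))) *
    (vandermonde z * fc z + (- complex_of_real (\<integral>w. f w \<partial>mu_n)) * vandermonde z))"
    using 1 by (intro tame_cmult tame_add 2) simp
  ultimately show ?thesis by simp
qed

lemma card_ge_1: "real CARD('n) \<ge> 1"
  by (simp add: Suc_leI)

lemma g_L2: "g \<in> L2 gamma_n"
  by (rule growth_L2_gamma[OF tame_measurable[OF tame_g] tame_growth[OF tame_g]]) (use card_ge_1 in linarith)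

lemma Cc_cspan:
  fixes F :: "complex ^ 'n::{finite,linorder} \<Rightarrow> complex"
  assumes F: "continuous_on UNIV F" and 0: "\<And>z. z \<notin> K \<Longrightarrow> F z = 0"
  shows "F \<in> hm.cspan UNIV" "\<And>u. u \<in> L2 gamma_n \<Longrightarrow> (\<And>P. zpoly P \<Longrightarrow> L2_inner gamma_n P u = 0) \<Longrightarrow> L2_inner gamma_n F u = 0"
    "F \<in> L2 gamma_n"
proof -
  obtain R where R: "\<And>z. norm z > R \<Longrightarrow> F z = 0" using K_bounded 0 by blast
  show *: "L2_inner gamma_n F u = 0" if "u \<in> L2 gamma_n" "\<And>P. zpoly P \<Longrightarrow> L2_inner gamma_n P u = 0" for u
    using orthogonal_zpoly_imp_orthogonal_Cc[OF that F R] by blast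
  obtain B where "\<And>z. norm (F z) \<le> B"
    using continuous_compact_support_bounded[OF F compact_K 0] by blast
  then have "growth 0 F" by (rule growth_bounded) simp
  then show FL: "F \<in> L2 gamma_n"
    by (rule growth_L2_gamma[OF borel_measurable_continuous_onI[OF F]]) simp
  show "F \<in> hm.cspan UNIV" by (rule hm_cspan_UNIV_I[OF FL *])
qed

lemma Vfc_cont: "continuous_on UNIV (\<lambda>z. vandermonde z * fc z)"
  by (intro continuous_intros zpoly_continuous[OF zpoly_vandermonde] f_cont)

text \<open>Here \<open>g\<close> is not of compact support, but it differs from the compactly supported \<open>V f\<close> by a multiple of
\<open>V\<close>.\<close>

lemma g_cspan: "g \<in> hm.cspan UNIV"
proof (rule hm_cspan_UNIV_I[OF g_L2])
  fix u :: "complex ^ 'n::{finite,linorder} \<Rightarrow> complex"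
  assume u: "u \<in> L2 gamma_n" and orth: "\<And>P. zpoly P \<Longrightarrow> L2_inner gamma_n P u = 0"
  have 1: "L2_inner gamma_n (\<lambda>z. vandermonde z * fc z) u = 0"
    by (rule Cc_cspan(2)[OF Vfc_cont _ u orth]) (simp_all add: f_outside)
  have L: "(\<lambda>z. vandermonde z * fc z) \<in> L2 gamma_n"
    by (rule Cc_cspan(3)[OF Vfc_cont]) (simp add: f_outside)
  show "L2_inner gamma_n g u = 0"
    unfolding g_eq[abs_def]
    by (subst L2_inner_cmult_left, subst L2_inner_add_left[OF L L2_cmult[OF vandermonde_L2] u],
        subst L2_inner_cmult_left) (simp add: 1 orth[OF zpoly_vandermonde])
qed

lemma wirt_g: "wirt (k, True) g z = complex_of_real (1 / sqrt (norm_const TYPE('n))) * (vandermonde z * wirt (k, True) fc z)"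
proof -
  note d = zpoly_differentiable[OF zpoly_vandermonde] fc_differentiable
  have "wirt (k, True) g z = complex_of_real (1 / sqrt (norm_const TYPE('n))) *
     wirt (k, True) (\<lambda>z. vandermonde z * fc z + (- complex_of_real (\<integral>w. f w \<partial>mu_n)) * vandermonde z) z"
    unfolding g_eq[abs_def] by (rule wirt_cmult) (intro differentiable_add differentiable_mult d differentiable_const)
  also have "wirt (k, True) (\<lambda>z. vandermonde z * fc z + (- complex_of_real (\<integral>w. f w \<partial>mu_n)) * vandermonde z) z
     = wirt (k, True) (\<lambda>z. vandermonde z * fc z) z + wirt (k, True) (\<lambda>z. (- complex_of_real (\<integral>w. f w \<partial>mu_n)) * vandermonde z) z"
    by (rule wirt_add) (intro differentiable_mult d differentiable_const)+
  also have "wirt (k, True) (\<lambda>z. (- complex_of_real (\<integral>w. f w \<partial>mu_n)) * vandermonde z) z = 0"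
    by (subst wirt_cmult) (auto simp: wirt_vandermonde d)
  also have "wirt (k, True) (\<lambda>z. vandermonde z * fc z) z = vandermonde z * wirt (k, True) fc z"
    by (subst wirt_mult) (auto simp: wirt_vandermonde d)
  finally show ?thesis by simp
qed

lemma wirt_fc: "wirt (k, True) fc z
    = 1 / 2 * (complex_of_real (dir_deriv (axis k 1) f z) + \<i> * complex_of_real (dir_deriv (axis k \<i>) f z))"
  by (simp add: wirt_def dfc)

lemma wirt_g_cspan: "wirt (k, True) g \<in> hm.cspan UNIV"
proof (rule Cc_cspan(1))
  show "continuous_on UNIV (wirt (k, True) g)"
    unfolding wirt_g[abs_def] wirt_fc
    by (intro continuous_intros zpoly_continuous[OF zpoly_vandermonde] df_cont)
  show "wirt (k, True) g z = 0" if "z \<notin> K" for z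
    using that by (simp add: wirt_g wirt_fc df_outside)
qed

text \<open>The factor is the ratio of the normalisations of neighbouring Hermite polynomials.\<close>

lemma coef_wirt_g:
  "(cmod (hm.coef (wirt (k, True) g) m))\<^sup>2
    = real CARD('n) * real (Suc (m (k, True))) * (cmod (hm.coef g (m((k, True) := Suc (m (k, True))))))\<^sup>2"
proof -
  let ?m = "m((k, True) := Suc (m (k, True)))"
  have lt: "1 / 4 < real CARD('n)" using card_ge_1 by linarith
  have "hm.coef (wirt (k, True) g) m = L2_inner gamma_n g (raise (k, True) (hm m))"
    unfolding hm.coef_def by (rule wirt_adjoint[OF tame_g zpoly_hm lt])
  also have "raise (k, True) (hm m) = (\<lambda>z. complex_of_real (1 / sqrt (idx_weight m)) * ladder ?m z)"
    unfolding hm_def[abs_def] raise_cmult[OF zpoly_ladder] ladder_Suc ..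
  also have "\<dots> = (\<lambda>z. complex_of_real (1 / sqrt (idx_weight m) * sqrt (idx_weight ?m)) * hm ?m z)"
    unfolding ladder_eq_hm[of ?m] by (simp add: mult.assoc)
  finally have "hm.coef (wirt (k, True) g) m = complex_of_real (1 / sqrt (idx_weight m) * sqrt (idx_weight ?m)) * hm.coef g ?m"
    unfolding L2_inner_cmult_right hm.coef_def by simp
  then have "(cmod (hm.coef (wirt (k, True) g) m))\<^sup>2
     = (1 / sqrt (idx_weight m) * sqrt (idx_weight ?m))\<^sup>2 * (cmod (hm.coef g ?m))\<^sup>2"
    by (simp only: norm_mult norm_of_real power_mult_distrib power2_abs)
  also have "(1 / sqrt (idx_weight m) * sqrt (idx_weight ?m))\<^sup>2 = idx_weight ?m / idx_weight m"
    using idx_weight_pos[of m] idx_weight_pos[of ?m]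
    by (simp add: power_mult_distrib power_divide less_imp_le del: fun_upd_apply)
  also have "\<dots> = real CARD('n) * real (Suc (m (k, True)))"
    unfolding idx_weight_Suc using idx_weight_pos[of m] by simp
  finally show ?thesis .
qed

text \<open>Parseval's identity for \<open>dbar_k g\<close>, re-indexed by the coefficients of \<open>g\<close>; indices with \<open>m (k, True) = 0\<close>
are not in the range of the shift, but contribute zero.\<close>

lemma has_sum_wirt_g:
  "((\<lambda>m. real CARD('n) * real (m (k, True)) * (cmod (hm.coef g m))\<^sup>2) has_sum (L2_norm gamma_n (wirt (k, True) g))\<^sup>2) UNIV"
proof -
  let ?s = "\<lambda>m :: 'n \<times> bool \<Rightarrow> nat. m((k, True) := Suc (m (k, True)))"
  let ?a = "\<lambda>m. real CARD('n) * real (m (k, True)) * (cmod (hm.coef g m))\<^sup>2"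
  have "((\<lambda>m. ?a (?s m)) has_sum (L2_norm gamma_n (wirt (k, True) g))\<^sup>2) UNIV"
    using hm.Parseval[OF wirt_g_cspan, of k] unfolding coef_wirt_g by simp
  moreover have inj: "inj ?s"
  proof (rule injI)
    fix m m' assume eq: "?s m = ?s m'"
    show "m = m'"
    proof
      fix i show "m i = m' i" using fun_cong[OF eq, of i] by (auto split: if_splits)
    qed
  qed
  ultimately have "(?a has_sum (L2_norm gamma_n (wirt (k, True) g))\<^sup>2) (range ?s)"
    by (subst has_sum_reindex[OF inj]) (simp add: o_def)
  moreover have "m \<in> range ?s" if "m (k, True) \<noteq> 0" for m
  proof
    show "m = ?s (m((k, True) := m (k, True) - 1))" using that by (auto simp: fun_eq_iff)
  qed simp
  ultimately show ?thesis
    by (intro has_sum_cong_neutral[where S = UNIV and T = "range ?s" and f = ?a and g = ?a, THEN iffD2]) auto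
qed

lemma f0_bounded: "\<exists>B. \<forall>z. norm (f0 z) \<le> B"
proof -
  obtain B where "\<And>z. norm (f z) \<le> B"
    using continuous_compact_support_bounded[OF f_cont compact_K f_outside] by blast
  then have "norm (f0 z) \<le> B + norm (\<integral>w. f w \<partial>mu_n)" for z
    unfolding f0_def by (meson add_right_mono norm_triangle_ineq4 order_trans)
  then show ?thesis by blast
qed

lemma bounded_continuous_integrable_mu:
  fixes F :: "complex ^ 'n::{finite,linorder} \<Rightarrow> 'b::{banach, second_countable_topology}"
  assumes "continuous_on UNIV F" "\<exists>B. \<forall>z. norm (F z) \<le> B"
  shows "integrable mu_n F"
proof -
  interpret prob_space "mu_n :: (complex ^ 'n::{finite,linorder}) measure" by (rule prob_space_mu_n)
  obtain B where "\<And>z. norm (F z) \<le> B" using assms(2) by blast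
  then show ?thesis
    by (intro integrable_const_bound[of _ B]) (auto intro: borel_measurable_continuous_onI assms(1))
qed

lemma supported_integrable_mu:
  fixes F :: "complex ^ 'n::{finite,linorder} \<Rightarrow> 'b::{banach, second_countable_topology}"
  assumes "continuous_on UNIV F" "\<And>z. z \<notin> K \<Longrightarrow> F z = 0"
  shows "integrable mu_n F"
  by (rule bounded_continuous_integrable_mu[OF assms(1) continuous_compact_support_bounded[OF assms(1) compact_K assms(2)]])

lemma dirichlet_eq: "dirichlet_mu f = 4 / real CARD('n) * (\<Sum>k\<in>UNIV. (L2_norm gamma_n (wirt (k, True) g))\<^sup>2)"
proof -
  have gk: "(cmod (wirt (k, True) g z))\<^sup>2 = mdens z * (1 / 4 * ((dir_deriv (axis k 1) f z)\<^sup>2 + (dir_deriv (axis k \<i>) f z)\<^sup>2))" for k z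
  proof -
    have "(cmod (wirt (k, True) fc z))\<^sup>2 = 1 / 4 * ((dir_deriv (axis k 1) f z)\<^sup>2 + (dir_deriv (axis k \<i>) f z)\<^sup>2)"
      unfolding wirt_fc by (simp add: norm_mult power_mult_distrib cmod_power2 power_divide)
    moreover have "wirt (k, True) g z = U_map (wirt (k, True) fc) z" by (simp add: wirt_g U_map_def)
    ultimately show ?thesis by (simp only: U_map_norm_sq)
  qed
  have cont: "continuous_on UNIV (\<lambda>z. (dir_deriv (axis k 1) f z)\<^sup>2 + (dir_deriv (axis k \<i>) f z)\<^sup>2)" for k
    by (intro continuous_intros df_cont)
  have I: "integrable mu_n (\<lambda>z. (dir_deriv (axis k 1) f z)\<^sup>2 + (dir_deriv (axis k \<i>) f z)\<^sup>2)" for k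
    by (rule supported_integrable_mu[OF cont]) (simp add: df_outside)
  have "(L2_norm gamma_n (wirt (k, True) g))\<^sup>2 = 1 / 4 * (\<integral>z. (dir_deriv (axis k 1) f z)\<^sup>2 + (dir_deriv (axis k \<i>) f z)\<^sup>2 \<partial>mu_n)" for k
    unfolding L2_norm_sq gk
    by (subst integral_mu_n) (auto intro: borel_measurable_continuous_onI cont simp: mult.left_commute)
  then have "(\<Sum>k\<in>UNIV. (L2_norm gamma_n (wirt (k, True) g))\<^sup>2)
     = 1 / 4 * (\<Sum>k\<in>UNIV. \<integral>z. (dir_deriv (axis k 1) f z)\<^sup>2 + (dir_deriv (axis k \<i>) f z)\<^sup>2 \<partial>mu_n)"
    by (simp only: sum_distrib_left)
  also have "(\<Sum>k\<in>UNIV. \<integral>z. (dir_deriv (axis k 1) f z)\<^sup>2 + (dir_deriv (axis k \<i>) f z)\<^sup>2 \<partial>mu_n) = (\<integral>z. (norm (grad f z))\<^sup>2 \<partial>mu_n)"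
    unfolding norm_grad_sq sum_Basis_cvec by (rule Bochner_Integration.integral_sum[symmetric]) (rule I)
  finally show ?thesis by (simp add: dirichlet_mu_def)
qed

lemma has_sum_dirichlet:
  "((\<lambda>m. 4 * real (bdeg m) * (cmod (hm.coef g m))\<^sup>2) has_sum dirichlet_mu f) UNIV"
proof -
  have "((\<lambda>m. \<Sum>k\<in>UNIV. real CARD('n) * real (m (k, True)) * (cmod (hm.coef g m))\<^sup>2)
      has_sum (\<Sum>k\<in>UNIV. (L2_norm gamma_n (wirt (k, True) g))\<^sup>2)) UNIV"
    by (rule has_sum_finite_sum) (simp_all add: has_sum_wirt_g)
  from has_sum_cmult_right[OF this, of "4 / real CARD('n)"]
  show ?thesis
    unfolding dirichlet_eq
    by (simp add: bdeg_def sum_distrib_left sum_distrib_right mult.assoc)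
qed

end

context test_function
begin

section \<open>The spectral decomposition\<close>

definition part :: "nat \<Rightarrow> complex ^ 'n::{finite,linorder} \<Rightarrow> complex" where
  "part d = L2_proj gamma_n (hermite_space d) g"

abbreviation energy :: "('n \<times> bool \<Rightarrow> nat) \<Rightarrow> real" where
  "energy i \<equiv> (cmod (hm.coef g i))\<^sup>2"

lemma part_cspan: "part d \<in> hm.cspan {i. bdeg i = d}"
  and coef_part: "hm.coef (part d) i = (if bdeg i = d then hm.coef g i else 0)"
  using hm.L2_proj_cspan[OF g_L2, of "{i. bdeg i = d}"] by (simp_all add: part_def hermite_space_eq)

lemma part_L2: "part d \<in> L2 gamma_n"
  using part_cspan by (rule hm.cspan_L2)

lemma part_cspan_UNIV: "part d \<in> hm.cspan UNIV"
  using part_cspan hm.cspan_mono[of "{i. bdeg i = d}" UNIV] by blast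

lemma has_sum_part: "(energy has_sum (L2_norm gamma_n (part d))\<^sup>2) {i. bdeg i = d}"
  using hm.Parseval[OF part_cspan] by (rule has_sum_cong[THEN iffD1, rotated]) (simp add: coef_part)

lemma has_sum_g: "(energy has_sum (L2_norm gamma_n g)\<^sup>2) UNIV"
  by (rule hm.Parseval[OF g_cspan])

lemma has_sum_by_degree:
  assumes "(h has_sum s) {i :: 'n \<times> bool \<Rightarrow> nat. bdeg i \<in> A}"
    and "\<And>d. d \<in> A \<Longrightarrow> (h has_sum b d) {i. bdeg i = d}"
  shows "(b has_sum (s :: real)) A"
proof -
  have inj: "inj_on snd (SIGMA d:A. {i :: 'n \<times> bool \<Rightarrow> nat. bdeg i = d})" by (auto simp: inj_on_def)
  have im: "snd ` (SIGMA d:A. {i :: 'n \<times> bool \<Rightarrow> nat. bdeg i = d}) = {i. bdeg i \<in> A}" by force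
  have "((h \<circ> snd) has_sum s) (SIGMA d:A. {i. bdeg i = d})"
    using assms(1) unfolding im[symmetric] has_sum_reindex[OF inj] .
  then show ?thesis by (rule has_sum_Sigma') (use assms(2) in simp)
qed

lemma parts_converge: "(\<lambda>N. L2_norm gamma_n (\<lambda>z. g z - (\<Sum>m<N. part m z))) \<longlonglongrightarrow> 0"
proof -
  define w where "w N z = g z - (\<Sum>m<N. part m z)" for N z
  have w0: "w 0 = g" by (simp add: w_def fun_eq_iff)
  have wS: "w (Suc N) = (\<lambda>z. w N z - part N z)" for N by (simp add: w_def fun_eq_iff)
  have w: "w N \<in> hm.cspan UNIV \<and> (\<forall>i. hm.coef (w N) i = (if bdeg i < N then 0 else hm.coef g i))" for N
  proof (induction N)
    case (Suc N)
    have "w (Suc N) \<in> hm.cspan UNIV" unfolding wS using Suc part_cspan_UNIV by (intro hm.cspan_diff) auto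
    moreover have "hm.coef (w (Suc N)) i = (if bdeg i < Suc N then 0 else hm.coef g i)" for i
      unfolding wS using Suc by (subst hm.coef_diff) (auto simp: hm.cspan_L2 part_L2 coef_part)
    ultimately show ?case by blast
  qed (simp add: w0 g_cspan)
  have tail: "(energy has_sum (L2_norm gamma_n (w N))\<^sup>2) {i. bdeg i \<ge> N}" for N
  proof -
    have c: "hm.coef (w N) i = (if bdeg i < N then 0 else hm.coef g i)" for i using w[of N] by blast
    have "((\<lambda>i. (cmod (hm.coef (w N) i))\<^sup>2) has_sum (L2_norm gamma_n (w N))\<^sup>2) UNIV"
      using w[of N] by (intro hm.Parseval) blast
    also have "?this \<longleftrightarrow> (energy has_sum (L2_norm gamma_n (w N))\<^sup>2) {i. bdeg i \<ge> N}"
      by (rule has_sum_cong_neutral) (simp_all add: c)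
    finally show ?thesis .
  qed
  have norm: "(L2_norm gamma_n (w N))\<^sup>2 = (L2_norm gamma_n g)\<^sup>2 - (\<Sum>m<N. (L2_norm gamma_n (part m))\<^sup>2)" for N
  proof (induction N)
    case (Suc N)
    have "(energy has_sum ((L2_norm gamma_n (part N))\<^sup>2 + (L2_norm gamma_n (w (Suc N)))\<^sup>2)) ({i. bdeg i = N} \<union> {i. bdeg i \<ge> Suc N})"
      by (intro has_sum_Un_disjoint has_sum_part tail) auto
    also have "{i. bdeg i = N} \<union> {i. bdeg i \<ge> Suc N} = {i. bdeg i \<ge> N}" by auto
    finally have "(L2_norm gamma_n (w N))\<^sup>2 = (L2_norm gamma_n (part N))\<^sup>2 + (L2_norm gamma_n (w (Suc N)))\<^sup>2"
      using tail[of N] has_sum_unique by blast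
    then show ?case using Suc by simp
  qed (simp add: w0)
  have "((\<lambda>d. (L2_norm gamma_n (part d))\<^sup>2) has_sum (L2_norm gamma_n g)\<^sup>2) UNIV"
    by (rule has_sum_by_degree[of energy]) (use has_sum_g has_sum_part in simp_all)
  from has_sum_imp_sums[OF this]
  have "(\<lambda>N. (L2_norm gamma_n g)\<^sup>2 - (\<Sum>m<N. (L2_norm gamma_n (part m))\<^sup>2)) \<longlonglongrightarrow> (L2_norm gamma_n g)\<^sup>2 - (L2_norm gamma_n g)\<^sup>2"
    unfolding sums_def by (intro tendsto_intros)
  then have "(\<lambda>N. (L2_norm gamma_n (w N))\<^sup>2) \<longlonglongrightarrow> 0" by (simp add: norm)
  from tendsto_real_sqrt[OF this] have "(\<lambda>N. L2_norm gamma_n (w N)) \<longlonglongrightarrow> 0"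
    by (simp add: L2_norm_nonneg)
  then show ?thesis by (simp add: w_def[abs_def])
qed

text \<open>The sum of \<open>(bdeg - 1) |coefficient|^2\<close> over all multi-indices is \<open>E / 4 - Var\<close>. Degree \<open>0\<close> contributes
\<open>- \<parallel>part 0\<parallel>^2\<close> to it and degree \<open>1\<close> nothing.\<close>

lemma has_sum_remainder:
  "((\<lambda>d. (real d - 1) * (L2_norm gamma_n (part d))\<^sup>2) has_sum
     (dirichlet_mu f / 4 - (L2_norm gamma_n g)\<^sup>2 + (L2_norm gamma_n (part 0))\<^sup>2)) {2..}"
proof -
  let ?h = "\<lambda>i. (real (bdeg i) - 1) * energy i"
  have "((\<lambda>i. 1 / 4 * (4 * real (bdeg i) * energy i) + (-1) * energy i)
      has_sum (1 / 4 * dirichlet_mu f + (-1) * (L2_norm gamma_n g)\<^sup>2)) UNIV"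
    by (intro has_sum_add has_sum_cmult_right has_sum_dirichlet has_sum_g)
  then have all: "(?h has_sum (dirichlet_mu f / 4 - (L2_norm gamma_n g)\<^sup>2)) UNIV"
    by (simp add: algebra_simps)
  have deg: "(?h has_sum ((real d - 1) * (L2_norm gamma_n (part d))\<^sup>2)) {i. bdeg i = d}" for d
    using has_sum_cmult_right[OF has_sum_part[of d], of "real d - 1"]
    by (rule has_sum_cong[THEN iffD1, rotated]) simp
  let ?b = "\<lambda>d. (real d - 1) * (L2_norm gamma_n (part d))\<^sup>2"
  have 1: "(?b has_sum (dirichlet_mu f / 4 - (L2_norm gamma_n g)\<^sup>2)) UNIV"
    by (rule has_sum_by_degree[of ?h]) (use all deg in simp_all)
  have 2: "(?b has_sum (- (L2_norm gamma_n (part 0))\<^sup>2)) {0, 1}"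
    by (rule has_sum_finiteI) simp_all
  have "UNIV - {0, 1} = {2 :: nat ..}" by auto
  with has_sum_Diff[OF 1 2 subset_UNIV] show ?thesis by simp
qed

lemma f0_L2: "(\<lambda>z. complex_of_real (f0 z)) \<in> L2 mu_n"
proof -
  obtain B where B: "\<And>z. norm (f0 z) \<le> B" using f0_bounded by blast
  have "(f0 z)\<^sup>2 \<le> B\<^sup>2" for z using power_mono[OF B[of z], of 2] by simp
  then have "integrable mu_n (\<lambda>z. (f0 z)\<^sup>2)"
    by (intro bounded_continuous_integrable_mu) (auto intro!: continuous_intros f0_cont)
  then show ?thesis
    using borel_measurable_continuous_onI[OF f0_cont] by (simp add: L2_def)
qed

lemma f_integrable: "integrable mu_n f"
  by (rule supported_integrable_mu[OF f_cont f_outside])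

lemma f0_mean: "(\<integral>z. f0 z \<partial>mu_n) = 0"
proof -
  interpret prob_space "mu_n :: (complex ^ 'n::{finite,linorder}) measure" by (rule prob_space_mu_n)
  show ?thesis using f_integrable prob_space by (simp add: f0_def)
qed

lemma g_norm_mu: "(L2_norm gamma_n g)\<^sup>2 = (\<integral>z. (f0 z)\<^sup>2 \<partial>mu_n)"
  unfolding g_def using L2_measurable[OF f0_L2] by (subst L2_norm_U_map) (simp_all add: L2_norm_sq)

lemma Var_eq: "Var_mu f = (L2_norm gamma_n g)\<^sup>2"
proof -
  interpret prob_space "mu_n :: (complex ^ 'n::{finite,linorder}) measure" by (rule prob_space_mu_n)
  let ?m = "\<integral>w. f w \<partial>mu_n"
  have I2: "integrable mu_n (\<lambda>z. (f z)\<^sup>2)"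
    by (rule supported_integrable_mu) (auto intro!: continuous_intros f_cont simp: f_outside)
  have "(f0 z)\<^sup>2 = (f z)\<^sup>2 - 2 * ?m * f z + ?m\<^sup>2" for z by (simp add: f0_def power2_diff)
  then have "(\<integral>z. (f0 z)\<^sup>2 \<partial>mu_n) = (\<integral>z. (f z)\<^sup>2 \<partial>mu_n) - 2 * ?m * ?m + ?m\<^sup>2"
    using I2 f_integrable prob_space by simp
  then show ?thesis unfolding g_norm_mu Var_mu_def by (simp add: power2_eq_square)
qed

section \<open>Integration by parts for the generator\<close>

text \<open>The density of \<open>mu_n\<close> with respect to Lebesgue measure, a constant multiple of \<open>exp (- Phi_n)\<close> on \<open>C_neq\<close>.
Unlike
\<open>Phi_n\<close> it is differentiable everywhere.\<close>

definition rho :: "complex ^ 'n::{finite,linorder} \<Rightarrow> real" where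
  "rho z = gdens z * mdens z"

lemma mu_lborel:
  fixes F :: "complex ^ 'n::{finite,linorder} \<Rightarrow> 'b::{banach, second_countable_topology}"
  assumes [measurable]: "F \<in> borel_measurable borel"
  shows "integrable mu_n F \<longleftrightarrow> integrable lborel (\<lambda>z. rho z *\<^sub>R F z)"
    and "(\<integral>z. F z \<partial>mu_n) = (\<integral>z. rho z *\<^sub>R F z \<partial>lborel)"
  by (subst integrable_mu_n, measurable, subst integrable_gamma_n, measurable, simp add: rho_def)
     (subst integral_mu_n, measurable, subst integral_gamma_n, measurable, simp add: rho_def)

text \<open>The same density as a product of polynomials and the Gaussian weight, which are known to be tame.\<close>

definition rhoc :: "complex ^ 'n::{finite,linorder} \<Rightarrow> complex" where
  "rhoc z = complex_of_real ((real CARD('n) / pi) ^ CARD('n) / norm_const TYPE('n))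
     * ((vandermonde z * cnj (vandermonde z)) * wt z)"

lemma rho_eq: "rho = (\<lambda>z. Re (rhoc z))"
proof
  fix z
  have "complex_of_real (rho z) = rhoc z"
    unfolding rho_def rhoc_def of_real_mult gdens_wt complex_norm_square[symmetric]
    by (simp add: mdens_def)
  then show "rho z = Re (rhoc z)" by (metis Re_complex_of_real)
qed

lemma rhoc_tame: "tame 1 rhoc"
proof -
  have "tame (1 / 2 + (- real CARD('n) + 1 / 2)) (\<lambda>z :: complex ^ 'n::{finite,linorder}. (vandermonde z * cnj (vandermonde z)) * wt z)"
    by (intro tame_mult tame_wt zpoly_tame zpoly_mult zpoly_cnj zpoly_vandermonde) auto
  then have "tame 1 (\<lambda>z :: complex ^ 'n::{finite,linorder}. (vandermonde z * cnj (vandermonde z)) * wt z)"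
    by (rule tame_mono) simp
  then show ?thesis unfolding rhoc_def[abs_def] by (rule tame_cmult)
qed

lemma rho_has_derivative: "(rho has_derivative (\<lambda>v. Re (dir_deriv v rhoc z))) (at z)"
  unfolding rho_eq
  by (intro bounded_linear.has_derivative[OF bounded_linear_Re] has_dir_deriv tame_differentiable[OF rhoc_tame])

lemma rho_differentiable: "rho differentiable at z"
  using rho_has_derivative differentiableI by blast

lemma drho: "dir_deriv v rho = (\<lambda>z. Re (dir_deriv v rhoc z))"
  by (rule ext) (rule dir_deriv_eq[OF rho_has_derivative])

lemma drho_cont: "continuous_on UNIV (dir_deriv v rho)"
  unfolding drho using rhoc_tame by (auto simp: tame_def intro: continuous_intros)

lemma rho_cont: "continuous_on UNIV rho"
  unfolding rho_eq by (intro continuous_intros tame_continuous[OF rhoc_tame])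

lemma rho_pos: "z \<in> C_neq \<Longrightarrow> rho z > 0"
  using norm_const_pos[where 'n = 'n] gdens_pos[of z] by (simp add: C_neq_vandermonde rho_def mdens_def)

lemma Phi_eq:
  assumes "z \<in> C_neq"
  shows "Phi_n z = ln ((real CARD('n) / pi) ^ CARD('n) / norm_const TYPE('n)) - ln (rho z)"
proof -
  define \<kappa> where "\<kappa> = (real CARD('n) / pi) ^ CARD('n) / norm_const TYPE('n)"
  have k: "\<kappa> > 0" using norm_const_pos[where 'n = 'n] by (simp add: \<kappa>_def)
  have V: "vandermonde z \<noteq> 0" using assms by (simp add: C_neq_vandermonde)
  have ne: "z $ k - z $ j \<noteq> 0" if "(j, k) \<in> pairs" for j k
    using assms that by (auto simp: C_neq_def pairs_def)
  have "cmod (vandermonde z) = (\<Prod>(j, k)\<in>pairs. cmod (z $ k - z $ j))"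
    by (simp add: vandermonde_pairs prod_norm[symmetric] case_prod_unfold)
  then have "ln (cmod (vandermonde z)) = (\<Sum>(j, k)\<in>pairs. ln (cmod (z $ k - z $ j)))"
    using ne by (simp add: case_prod_unfold) (subst ln_prod, auto)
  also have "\<dots> = (\<Sum>(j, k)\<in>pairs. ln (cmod (z $ j - z $ k)))" by (simp add: norm_minus_commute)
  finally have lnV: "ln (cmod (vandermonde z)) = (\<Sum>(j, k)\<in>pairs. ln (cmod (z $ j - z $ k)))" .
  have "rho z = \<kappa> * (exp (- real CARD('n) * (norm z)\<^sup>2) * (cmod (vandermonde z))\<^sup>2)"
    by (simp add: rho_def gdens_def mdens_def \<kappa>_def)
  then have "ln (rho z) = ln \<kappa> + (- real CARD('n) * (norm z)\<^sup>2 + 2 * ln (cmod (vandermonde z)))"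
    using k V by (simp add: ln_mult ln_realpow)
  moreover have "(norm z)\<^sup>2 = (\<Sum>j\<in>UNIV. (cmod (z $ j))\<^sup>2)"
    by (simp add: norm_vec_def L2_set_def sum_nonneg)
  ultimately show ?thesis unfolding \<kappa>_def[symmetric] by (simp add: Phi_n_def lnV pairs_def)
qed

lemma dPhi:
  assumes z: "z \<in> C_neq"
  shows "dir_deriv v Phi_n z = - dir_deriv v rho z / rho z"
proof -
  let ?k = "ln ((real CARD('n) / pi) ^ CARD('n) / norm_const TYPE('n))"
  have "((\<lambda>z. ln (rho z)) has_derivative (\<lambda>v. inverse (rho z) * Re (dir_deriv v rhoc z))) (at z)"
    by (rule has_derivative_ln[OF rho_pos[OF z] rho_has_derivative, THEN has_derivative_eq_rhs]) (simp add: mult.commute)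
  then have "((\<lambda>z. ?k - ln (rho z)) has_derivative (\<lambda>v. 0 - inverse (rho z) * Re (dir_deriv v rhoc z))) (at z)"
    by (intro has_derivative_diff has_derivative_const)
  then have "(Phi_n has_derivative (\<lambda>v. 0 - inverse (rho z) * Re (dir_deriv v rhoc z))) (at z)"
    by (rule has_derivative_transform_within_open[where s = C_neq]) (use z open_C_neq Phi_eq in auto)
  then show ?thesis by (simp add: dir_deriv_eq drho divide_inverse mult.commute)
qed

text \<open>The summands of \<open>\<nabla>Phi_n \<bullet> \<nabla>f\<close>. The potential is singular at collisions, where however \<open>\<nabla>f\<close>
vanishes identically.\<close>

definition drift :: "complex ^ 'n::{finite,linorder} \<Rightarrow> complex ^ 'n::{finite,linorder} \<Rightarrow> real" where
  "drift b z = dir_deriv b Phi_n z * dir_deriv b f z"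

lemma drift_outside: "z \<notin> K \<Longrightarrow> drift b z = 0"
  by (simp add: drift_def df_outside)

lemma continuous_from_C_neq:
  fixes F :: "complex ^ 'n::{finite,linorder} \<Rightarrow> real"
  assumes "continuous_on C_neq F" "\<And>z. z \<notin> K \<Longrightarrow> F z = 0"
  shows "continuous_on UNIV F"
proof -
  have "continuous_on (- K) F"
    by (rule continuous_on_eq[OF continuous_on_const[of _ 0]]) (simp add: assms(2))
  then have "continuous_on (C_neq \<union> - K) F"
    using closed_K by (intro continuous_on_open_Un open_C_neq assms(1)) auto
  moreover have "C_neq \<union> - K = UNIV" using K_sub by blast
  ultimately show ?thesis by simp
qed

lemma drift_cont: "continuous_on UNIV (drift b)"
proof (rule continuous_from_C_neq[OF _ drift_outside])
  have "continuous_on C_neq (\<lambda>z. - dir_deriv b rho z / rho z * dir_deriv b f z)"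
    using rho_pos by (intro continuous_intros continuous_on_subset[OF drho_cont] continuous_on_subset[OF rho_cont]
        continuous_on_subset[OF df_cont]) force+
  then show "continuous_on C_neq (drift b)"
    by (rule continuous_on_eq) (simp add: drift_def dPhi)
qed

lemma A_n_eq: "A_n f z = 1 / real CARD('n) * (\<Sum>b\<in>Basis. dir_deriv b (dir_deriv b f) z - drift b z)"
  unfolding A_n_def laplacian_def grad_inner drift_def sum_subtractf ..

lemma A_n_cont: "continuous_on UNIV (A_n f)"
  unfolding A_n_eq[abs_def] by (intro continuous_intros ddf_cont drift_cont)

lemma A_n_outside: "z \<notin> K \<Longrightarrow> A_n f z = 0"
  by (simp add: A_n_eq ddf_outside drift_outside)

lemma df0: "dir_deriv v f0 = dir_deriv v f"
proof
  fix z
  have "(f0 has_derivative (\<lambda>v. dir_deriv v f z - 0)) (at z)"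
    unfolding f0_def[abs_def]
    by (intro has_derivative_diff has_derivative_const has_dir_deriv smooth_differentiable smooth_f)
  then show "dir_deriv v f0 z = dir_deriv v f z" by (simp add: dir_deriv_eq)
qed

lemma f0_differentiable: "f0 differentiable at z"
  unfolding f0_def[abs_def] by (intro differentiable_diff smooth_differentiable smooth_f differentiable_const)

lemma A_n_f0: "A_n f0 = A_n f"
  by (rule ext) (simp add: A_n_def laplacian_def grad_def df0)

text \<open>The integrand times the density is the derivative in direction \<open>b\<close> of \<open>rho (\<partial>\<^sub>b f) f0\<close>, because the logarithmic
derivative of \<open>rho\<close> is \<open>- \<partial>\<^sub>b Phi_n\<close> on the support of \<open>f\<close>.\<close>

lemma generator_by_parts_direction:
  "(\<integral>z. (dir_deriv b (dir_deriv b f) z - drift b z) * f0 z + (dir_deriv b f z)\<^sup>2 \<partial>mu_n) = 0" (is "(\<integral>z. ?E z \<partial>mu_n) = 0")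
  and generator_integrable_direction:
  "integrable mu_n (\<lambda>z. (dir_deriv b (dir_deriv b f) z - drift b z) * f0 z + (dir_deriv b f z)\<^sup>2)"
proof -
  define G where "G z = rho z * (dir_deriv b f z * f0 z)" for z
  have diff: "f differentiable at z" "dir_deriv b f differentiable at z" for z
    by (intro smooth_differentiable smooth_dir_deriv smooth_f)+
  have Gdiff: "G differentiable at z" for z
    unfolding G_def[abs_def] by (intro differentiable_mult rho_differentiable diff f0_differentiable)
  have E_cont: "continuous_on UNIV ?E"
    by (intro continuous_intros ddf_cont drift_cont df_cont f0_cont)
  have dG: "dir_deriv b G z = rho z * ?E z" for z
  proof -
    have "dir_deriv b G z = dir_deriv b rho z * (dir_deriv b f z * f0 z)
        + rho z * (dir_deriv b (dir_deriv b f) z * f0 z + dir_deriv b f z * dir_deriv b f z)"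
      unfolding G_def[abs_def]
      by (subst dir_deriv_mult, rule rho_differentiable, intro differentiable_mult diff f0_differentiable,
          subst dir_deriv_mult[OF diff(2) f0_differentiable]) (simp add: df0)
    moreover have "dir_deriv b rho z * dir_deriv b f z = - rho z * drift b z"
    proof (cases "z \<in> K")
      case True
      then have z: "z \<in> C_neq" using K_sub by blast
      show ?thesis using rho_pos[OF z] by (simp add: drift_def dPhi[OF z])
    qed (simp add: df_outside drift_outside)
    ultimately show ?thesis by (simp add: algebra_simps power2_eq_square)
  qed
  show E_int: "integrable mu_n ?E"
    by (rule supported_integrable_mu[OF E_cont]) (simp add: ddf_outside drift_outside df_outside)
  have H_cont: "continuous_on UNIV (\<lambda>z. dir_deriv b f z * f0 z)"
    by (intro continuous_intros df_cont f0_cont)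
  have "integrable mu_n (\<lambda>z. dir_deriv b f z * f0 z)"
    by (rule supported_integrable_mu[OF H_cont]) (simp add: df_outside)
  then have GI: "integrable lborel G"
    using mu_lborel(1)[OF borel_measurable_continuous_onI[OF H_cont]] by (simp add: G_def[abs_def])
  have "(\<integral>z. dir_deriv b G z \<partial>lborel) = 0"
  proof (rule integral_directional_derivative_eq_0[where G = G])
    show "(G has_derivative (\<lambda>v. dir_deriv v G x)) (at x)" for x by (rule has_dir_deriv[OF Gdiff])
    show "continuous_on UNIV (\<lambda>x. dir_deriv b G x)"
      unfolding dG by (intro continuous_on_mult rho_cont E_cont)
    show "integrable lborel (\<lambda>x. dir_deriv b G x)"
      unfolding dG using E_int mu_lborel(1)[OF borel_measurable_continuous_onI[OF E_cont]] by simp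
  qed (rule GI)
  then show "(\<integral>z. ?E z \<partial>mu_n) = 0"
    unfolding dG using mu_lborel(2)[OF borel_measurable_continuous_onI[OF E_cont]] by simp
qed

lemma generator_by_parts: "(\<integral>z. A_n f z * f0 z \<partial>mu_n) = - dirichlet_mu f"
proof -
  let ?c = "real CARD('n)"
  let ?E = "\<lambda>b z. (dir_deriv b (dir_deriv b f) z - drift b z) * f0 z + (dir_deriv b f z)\<^sup>2"
  have c: "?c > 0" by simp
  have AI: "integrable mu_n (\<lambda>z. A_n f z * f0 z)"
    by (rule supported_integrable_mu) (auto intro!: continuous_intros A_n_cont f0_cont simp: A_n_outside)
  have gI: "integrable mu_n (\<lambda>z. (norm (grad f z))\<^sup>2)"
    unfolding norm_grad_sq by (rule supported_integrable_mu) (auto intro!: continuous_intros df_cont simp: df_outside)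
  have "(\<integral>z. (\<Sum>b\<in>Basis. ?E b z) \<partial>mu_n) = (\<Sum>b\<in>Basis. \<integral>z. ?E b z \<partial>mu_n)"
    by (rule Bochner_Integration.integral_sum) (rule generator_integrable_direction)
  also have "\<dots> = 0" by (simp only: generator_by_parts_direction sum.neutral_const)
  finally have "(\<integral>z. (\<Sum>b\<in>Basis. ?E b z) \<partial>mu_n) = 0" .
  moreover have "(\<Sum>b\<in>Basis. ?E b z) = ?c * (A_n f z * f0 z) + (norm (grad f z))\<^sup>2" for z
    using c by (simp add: sum.distrib A_n_eq norm_grad_sq sum_distrib_right[symmetric])
  ultimately have "?c * (\<integral>z. A_n f z * f0 z \<partial>mu_n) + (\<integral>z. (norm (grad f z))\<^sup>2 \<partial>mu_n) = 0"
    using AI gI by simp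
  then show ?thesis using c by (simp add: dirichlet_mu_def field_simps)
qed

lemma generator_expand:
  "(L2_norm mu_n (\<lambda>z. A_n f0 z + 2 * f0 z))\<^sup>2
    = (L2_norm mu_n (A_n f))\<^sup>2 - 4 * dirichlet_mu f + 4 * Var_mu f"
proof -
  have A2: "integrable mu_n (\<lambda>z. (A_n f z)\<^sup>2)"
    by (rule supported_integrable_mu) (auto intro!: continuous_intros A_n_cont simp: A_n_outside)
  have AI: "integrable mu_n (\<lambda>z. A_n f z * f0 z)"
    by (rule supported_integrable_mu) (auto intro!: continuous_intros A_n_cont f0_cont simp: A_n_outside)
  have f2: "integrable mu_n (\<lambda>z. (f0 z)\<^sup>2)" using L2_integrable[OF f0_L2] by simp
  have "(A_n f z + 2 * f0 z)\<^sup>2 = (A_n f z)\<^sup>2 + 4 * (A_n f z * f0 z) + 4 * (f0 z)\<^sup>2" for z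
    by (simp add: power2_eq_square algebra_simps)
  then have "(\<integral>z. (A_n f z + 2 * f0 z)\<^sup>2 \<partial>mu_n)
      = (\<integral>z. (A_n f z)\<^sup>2 \<partial>mu_n) + 4 * (\<integral>z. A_n f z * f0 z \<partial>mu_n) + 4 * (\<integral>z. (f0 z)\<^sup>2 \<partial>mu_n)"
    using A2 AI f2 by simp
  then show ?thesis
    unfolding Var_eq g_norm_mu by (simp add: L2_norm_sq A_n_f0 generator_by_parts)
qed

section \<open>The remainder of a symmetric function\<close>

definition hol :: "complex ^ 'n::{finite,linorder} \<Rightarrow> complex" where
  "hol = U_inv (part 0)"

lemma g_orthogonal_vandermonde: "L2_inner gamma_n g vandermonde = 0"
proof -
  let ?s = "complex_of_real (sqrt (norm_const TYPE('n)))"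
  have V: "vandermonde = (\<lambda>z :: complex ^ 'n::{finite,linorder}. ?s * U_map (\<lambda>z. 1) z)"
    using norm_const_pos[where 'n = 'n] by (simp add: U_map_def fun_eq_iff)
  have "L2_inner gamma_n g vandermonde = L2_inner gamma_n g (\<lambda>z. ?s * U_map (\<lambda>z. 1) z)"
    by (rule arg_cong[OF V])
  also have "\<dots> = cnj ?s * L2_inner gamma_n g (U_map (\<lambda>z. 1))" by (rule L2_inner_cmult_right)
  also have "L2_inner gamma_n g (U_map (\<lambda>z. 1)) = L2_inner mu_n (\<lambda>z. complex_of_real (f0 z)) (\<lambda>z. 1)"
    unfolding g_def by (rule L2_inner_U_map) (use L2_measurable[OF f0_L2] in auto)
  also have "\<dots> = 0" by (simp add: L2_inner_def f0_mean)
  finally show ?thesis by simp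
qed

text \<open>Expanding the square, \<open>f0\<close> has the same inner product \<open>\<parallel>part 0\<parallel>^2\<close> with \<open>hol\<close> and with its conjugate, and
\<open>hol\<close> is orthogonal to its conjugate, which is the statement that its square has mean zero.\<close>

lemma remainder_norm:
  assumes sym: "symmetric_fun f"
  shows "(L2_norm mu_n (\<lambda>z. complex_of_real (f0 z) - hol z - cnj (hol z)))\<^sup>2
    = Var_mu f - 2 * (L2_norm gamma_n (part 0))\<^sup>2"
proof -
  let ?F = "\<lambda>z. complex_of_real (f0 z)"
  let ?a = "(L2_norm gamma_n (part 0))\<^sup>2"
  have hL: "hol \<in> L2 mu_n" and Uh: "AE z in gamma_n. U_map hol z = part 0 z"
    using U_inv_L2[OF part_L2] by (simp_all add: hol_def)
  have [measurable]: "hol \<in> borel_measurable borel" "part 0 \<in> borel_measurable borel"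
      "?F \<in> borel_measurable borel" "g \<in> borel_measurable borel"
    using hL part_L2[of 0] f0_L2 g_L2 by (auto simp: L2_def)
  have [measurable]: "U_map hol \<in> borel_measurable borel" "U_map (\<lambda>z. cnj (hol z)) \<in> borel_measurable borel"
    by (rule U_map_measurable, measurable)+
  have chL: "(\<lambda>z. cnj (hol z)) \<in> L2 mu_n" by (rule L2_cnj[OF hL])
  have nh: "(L2_norm mu_n hol)\<^sup>2 = ?a"
  proof -
    have "L2_norm mu_n hol = L2_norm gamma_n (U_map hol)" by (rule L2_norm_U_map[symmetric]) simp
    also have "\<dots> = L2_norm gamma_n (part 0)"
      by (rule L2_norm_cong_AE[OF Uh]) (simp_all add: U_map_measurable)
    finally show ?thesis by simp
  qed
  have nch: "L2_norm mu_n (\<lambda>z. cnj (hol z)) = L2_norm mu_n hol" by (simp add: L2_norm_def)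
  have Fh: "L2_inner mu_n ?F hol = complex_of_real ?a"
  proof -
    have "L2_inner mu_n ?F hol = L2_inner gamma_n g (U_map hol)"
      unfolding g_def by (rule L2_inner_U_map[symmetric]) simp_all
    also have "\<dots> = L2_inner gamma_n g (part 0)"
      by (rule L2_inner_cong_AE[OF _ Uh]) (simp_all add: U_map_measurable)
    also have "\<dots> = L2_inner gamma_n (part 0) (part 0)"
    proof -
      have dL: "(\<lambda>z. g z - part 0 z) \<in> L2 gamma_n" by (rule L2_minus[OF g_L2 part_L2])
      have "L2_inner gamma_n (part 0) (\<lambda>z. g z - part 0 z) = 0"
      proof (rule hm.cspan_inner_eq_0[OF part_cspan dL])
        fix i :: "'n \<times> bool \<Rightarrow> nat" assume "i \<in> {i. bdeg i = 0}"
        then have "hm.coef (\<lambda>z. g z - part 0 z) i = 0"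
          by (simp add: hm.coef_diff[OF g_L2 part_L2] coef_part)
        then show "hm.coef (part 0) i * L2_inner gamma_n (hm i) (\<lambda>z. g z - part 0 z) = 0"
          by (subst L2_inner_commute) (simp add: hm.coef_def)
      qed
      then have "L2_inner gamma_n (\<lambda>z. g z - part 0 z) (part 0) = 0" by (subst L2_inner_commute) simp
      then show ?thesis using L2_inner_diff_left[OF g_L2 part_L2[of 0] part_L2[of 0]] by simp
    qed
    finally show ?thesis by (simp only: L2_inner_self)
  qed
  have Fch: "L2_inner mu_n ?F (\<lambda>z. cnj (hol z)) = complex_of_real ?a"
  proof -
    have "L2_inner mu_n ?F (\<lambda>z. cnj (hol z)) = cnj (L2_inner mu_n ?F hol)"
      unfolding L2_inner_def Bochner_Integration.integral_cnj[symmetric] by simp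
    then show ?thesis by (simp add: Fh)
  qed
  have anti: "g (permute_coords \<pi> z) = inv_sign \<pi> * g z" if "bij \<pi>" for \<pi> z
  proof -
    have "\<pi> permutes UNIV" using that by (simp add: permutes_univ bij_iff)
    then have "f (permute_coords \<pi> z) = f z" using sym by (simp add: symmetric_fun_def permute_coords_def)
    then show ?thesis
      using vandermonde_permute[OF bij_is_inj[OF that], of z] by (simp add: g_def U_map_def f0_def)
  qed
  have hch: "L2_inner mu_n hol (\<lambda>z. cnj (hol z)) = 0"
  proof -
    have "L2_inner mu_n hol (\<lambda>z. cnj (hol z)) = L2_inner gamma_n (U_map hol) (U_map (\<lambda>z. cnj (hol z)))"
      by (rule L2_inner_U_map[symmetric]) simp_all
    also have "\<dots> = (\<integral>z. part 0 z * part 0 z * (cnj (vandermonde z) / vandermonde z) \<partial>gamma_n)"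
      unfolding L2_inner_def
    proof (rule integral_cong_AE)
      show "AE z in gamma_n. U_map hol z * cnj (U_map (\<lambda>z. cnj (hol z)) z)
          = part 0 z * part 0 z * (cnj (vandermonde z) / vandermonde z)"
        using Uh AE_gamma_vandermonde
      proof eventually_elim
        case (elim z)
        then show ?case by (simp add: U_map_def flip: elim(1))
      qed
    qed measurable
    also have "\<dots> = 0"
      by (rule integral_square_eq_0[OF part_cspan])
         (use antisymmetric_coef_eq_0[OF g_L2 anti g_orthogonal_vandermonde] in \<open>simp add: coef_part\<close>)
    finally show ?thesis .
  qed
  have d: "(\<lambda>z. ?F z - hol z) \<in> L2 mu_n" by (rule L2_minus[OF f0_L2 hL])
  have nF: "(L2_norm mu_n ?F)\<^sup>2 = Var_mu f"
    unfolding Var_eq g_norm_mu by (simp add: L2_norm_sq)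
  have "(L2_norm mu_n (\<lambda>z. (?F z - hol z) - cnj (hol z)))\<^sup>2
     = (L2_norm mu_n (\<lambda>z. ?F z - hol z))\<^sup>2 + ?a - 2 * Re (L2_inner mu_n (\<lambda>z. ?F z - hol z) (\<lambda>z. cnj (hol z)))"
    by (simp add: L2_norm_sq_diff[OF d chL] nch nh)
  also have "L2_inner mu_n (\<lambda>z. ?F z - hol z) (\<lambda>z. cnj (hol z)) = complex_of_real ?a"
    by (simp only: L2_inner_diff_left[OF f0_L2 hL chL] Fch hch diff_zero)
  also have "(L2_norm mu_n (\<lambda>z. ?F z - hol z))\<^sup>2 = Var_mu f + ?a - 2 * ?a"
    by (simp add: L2_norm_sq_diff[OF f0_L2 hL] nh nF Fh del: of_real_power)
  finally show ?thesis by (simp del: of_real_power)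
qed

end

theorem theorem1p9:
  fixes f f_tilde :: "complex ^ 'n::{finite,linorder} \<Rightarrow> real"
    and g h r :: "complex ^ 'n::{finite,linorder} \<Rightarrow> complex"
    and g_part :: "nat \<Rightarrow> complex ^ 'n::{finite,linorder} \<Rightarrow> complex"
  assumes f: "f \<in> Cc_inf_neq" and sym: "symmetric_fun f"
    and f_tilde: "f_tilde = (\<lambda>z. f z - (\<integral>w. f w \<partial>mu_n))"
    and g: "g = U_map (\<lambda>z. complex_of_real (f_tilde z))"
    and g_part: "\<And>m. g_part m = L2_proj gamma_n (hermite_space m) g"
    and h: "h = U_inv (g_part 0)"
    and r: "r = (\<lambda>z. complex_of_real (f_tilde z) - h z - cnj (h z))"
  shows "(\<lambda>N. L2_norm gamma_n (\<lambda>z. g z - (\<Sum>m<N. g_part m z))) \<longlonglongrightarrow> 0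
    \<and> (AE z in mu_n. h z = U_inv (L2_proj gamma_n H_n g) z)
    \<and> (\<lambda>m. (real m - 1) * (L2_norm gamma_n (g_part m))\<^sup>2) summable_on {2..}
    \<and> dirichlet_mu f - 2 * Var_mu f
        = 2 * (L2_norm mu_n r)\<^sup>2
          + 4 * (\<Sum>\<^sub>\<infinity>m\<in>{2..}. (real m - 1) * (L2_norm gamma_n (g_part m))\<^sup>2)
    \<and> (L2_norm mu_n (A_n f))\<^sup>2 - 2 * dirichlet_mu f
        = (L2_norm mu_n (\<lambda>z. A_n f_tilde z + 2 * f_tilde z))\<^sup>2
          + 4 * (L2_norm mu_n r)\<^sup>2
          + 8 * (\<Sum>\<^sub>\<infinity>m\<in>{2..}. (real m - 1) * (L2_norm gamma_n (g_part m))\<^sup>2)"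
proof -
  interpret T: test_function f by unfold_locales (rule f)
  have ft: "f_tilde = T.f0" by (rule ext) (simp add: f_tilde T.f0_def)
  have gT: "g = T.g" by (simp add: g ft T.g_def)
  have pT: "g_part = T.part" by (rule ext) (simp only: g_part gT T.part_def)
  have hT: "h = T.hol" by (simp only: h pT T.hol_def)
  have rn: "(L2_norm mu_n r)\<^sup>2 = Var_mu f - 2 * (L2_norm gamma_n (g_part 0))\<^sup>2"
    unfolding r ft hT pT by (rule T.remainder_norm[OF sym])
  have sum: "((\<lambda>m. (real m - 1) * (L2_norm gamma_n (g_part m))\<^sup>2) has_sum
      (dirichlet_mu f / 4 - Var_mu f + (L2_norm gamma_n (g_part 0))\<^sup>2)) {2..}"
    unfolding pT T.Var_eq by (rule T.has_sum_remainder)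
  have inf: "(\<Sum>\<^sub>\<infinity>m\<in>{2..}. (real m - 1) * (L2_norm gamma_n (g_part m))\<^sup>2)
      = dirichlet_mu f / 4 - Var_mu f + (L2_norm gamma_n (g_part 0))\<^sup>2"
    by (rule infsumI[OF sum])
  have "(\<lambda>N. L2_norm gamma_n (\<lambda>z. g z - (\<Sum>m<N. g_part m z))) \<longlonglongrightarrow> 0"
    unfolding gT pT by (rule T.parts_converge)
  moreover have "h = U_inv (L2_proj gamma_n H_n g)"
    unfolding h g_part gT by (rule U_inv_cong_AE[OF L2_proj_H_n_AE(1)[OF T.g_cspan]])
  moreover have "(\<lambda>m. (real m - 1) * (L2_norm gamma_n (g_part m))\<^sup>2) summable_on {2..}"
    using sum by (rule has_sum_imp_summable)
  moreover have "dirichlet_mu f - 2 * Var_mu f = 2 * (L2_norm mu_n r)\<^sup>2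
      + 4 * (\<Sum>\<^sub>\<infinity>m\<in>{2..}. (real m - 1) * (L2_norm gamma_n (g_part m))\<^sup>2)"
    unfolding inf rn by simp
  moreover have "(L2_norm mu_n (A_n f))\<^sup>2 - 2 * dirichlet_mu f
        = (L2_norm mu_n (\<lambda>z. A_n f_tilde z + 2 * f_tilde z))\<^sup>2
          + 4 * (L2_norm mu_n r)\<^sup>2
          + 8 * (\<Sum>\<^sub>\<infinity>m\<in>{2..}. (real m - 1) * (L2_norm gamma_n (g_part m))\<^sup>2)"
    unfolding inf rn ft T.generator_expand by simp
  ultimately show ?thesis by simp
qed

end
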